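(* We have $\bar H_k=\bar H_k'$ for $0\le k<g$, and the polynomials $\bar H_g$ and $\bar H_g'$ have the same restriction to their Newton polygon's lowest edge.
   Context: Let $\mathbb{K}$ be a perfect field and $F\in\mathbb{K}[[x]][y]$ a square-free Weierstrass polynomial of degree $d$ (monic, with all lower coefficients vanishing at $x=0$), with $\mathrm{char}\,\mathbb{K}=0$ or $>d$. $v_x$ denotes the $x$-valuation (for a polynomial or series in $y$, the minimum of the valuations of its coefficients). The Newton polygon $\mathcal{N}(H)$ of $H=\sum_i a_i(x)y^i=\sum a_{ij}x^jy^i$ is the lower convex hull of the points $(i,v_x(a_i))$; its boundary polynomial is $\bar H=\sum_{(i,j)\in\mathcal{N}(H)}a_{ij}x^jy^i$. A Weierstrass polynomial $H$ over a field $\mathbb{L}$ is degenerated over $\mathbb{L}$ if $\mathcal N(H)$ is straight (one segment or one point) of slope $-m/q$, $q,m$ coprime, $q>0$, and $\bar H=(P(y^q/x^m)\,x^{m\deg P})^N$ with $N\in\mathbb{N}$ and $P\in\mathbb{L}[Z]$ monic irreducible; $(q,m,P,N)$ is then its edge data. Sequence $H_k$: $N_0=d$, $\mathbb{K}_0=\mathbb{K}$, $c_0=-\mathrm{coeff}(F,y^{d-1})/d$, $H_0=F(x,y+c_0(x))$. For $k\ge1$, if $N_{k-1}>1$ and $H_{k-1}$ is degenerated over $\mathbb{K}_{k-1}$, let $(q_k,m_k,P_k,N_k)$ be its edge data, $\ell_k=\deg P_k$, $\mathbb{K}_k=\mathbb{K}_{k-1}[Z_k]/(P_k(Z_k))$,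 $z_k$ the class of $Z_k$, and $(s_k,t_k)$ the unique integers with $q_ks_k-t_km_k=1$, $0\le t_k<q_k$. Then $H_{k-1}(z_k^{t_k}x^{q_k},x^{m_k}(y+z_k^{s_k}))=x^{q_km_k\ell_kN_k}G_kV_k$ with $V_k\in\mathbb{K}_k[[x,y]]^\times$ and $G_k\in\mathbb{K}_k[[x]][y]$ Weierstrass of degree $N_k$; put $c_k=-\mathrm{coeff}(G_k,y^{N_k-1})/N_k$ and $H_k=G_k(x,y+c_k(x))$. $g$ is the smallest index such that $N_g=1$ or $H_g$ is not degenerated over $\mathbb{K}_g$. Let $\pi_0(x,y)=(x,y+c_0(x))$, $\sigma_k(x,y)=(z_k^{t_k}x^{q_k},x^{m_k}(y+z_k^{s_k}+c_k(x)))$, $\pi_k=\pi_{k-1}\circ\sigma_k$, $\pi_k^*H=H\circ\pi_k$. Then $\pi_k(x,y)=(\mu_kx^{e_k},\alpha_kx^{r_k}y+S_k(x))$ with $e_k=q_1\cdots q_k$, $\mu_k,\alpha_k\in\mathbb{K}_k^\times$, $r_k\in\mathbb N$, $S_k\in\mathbb{K}_k[[x]]$. Put $f_k=\ell_1\cdots\ell_k$, $d_k=e_kf_k$ (so $d=N_kd_k$). The $k$-th minimal polynomial $\phi_k$ is the unique monic irreducible polynomial in $\mathbb{K}[[x]][y]$ with $\phi_k(\mu_kx^{e_k},S_k(x))=0$; it has degree $d_k$. Put $\phi_{-1}=x$. For $H\in\mathbb{K}[[x]][y]$ let $v_k(H)=v_x(\pi_k^*H)$ ($v_k(0)=\infty$),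 and for $H\ne0$ let $\lambda_k(H)\in\mathbb{K}_k$ be the trailing coefficient in $y$ (coefficient of the lowest power of $y$) of $\left(\pi_k^*H/x^{v_k(H)}\right)_{|x=0}$; $\lambda_k(0)=0$. For $0\le k\le g$ put $V=(v_k(\phi_{-1}),\dots,v_k(\phi_k))$, $\Lambda=(\lambda_k(\phi_{-1}),\dots,\lambda_k(\phi_k))$, $\mathcal{B}=\{(b_{-1},\dots,b_k)\in\mathbb{N}^{k+2}: b_{i-1}<q_i\ell_i,\ 1\le i\le k\}$, $\Lambda^B=\prod_i\lambda_k(\phi_i)^{b_i}$ (the entries of $\Lambda$ are nonzero), $\mathcal{B}(i,w)=\{B\in\mathcal{B}: b_k=i,\langle B,V\rangle=w\}$, $B_0=(0,\dots,0,N_k)$. Approximate roots: for $N\mid d$ the $N$-th approximate root of $F$ is the unique monic $\psi\in\mathbb{K}[[x]][y]$ of degree $d/N$ with $\deg(F-\psi^N)<d-d/N$. Let $\psi_{-1}=x$ and $\psi_k$ the $N_k$-th approximate root of $F$, $0\le k\le g$ (so $\deg\psi_k=\deg\phi_k$); $\Psi=(\psi_{-1},\dots,\psi_k)$, $\Psi^B=\prod_{i=-1}^k\psi_i^{b_i}$. $F$ has a unique $\Psi$-adic expansion $F=\sum_{B\in\mathcal{B}}f_B'\Psi^B$, $f_B'\in\mathbb{K}$. Define $w_i'=\min\{\langle B,V\rangle:B\in\mathcal{B},\,b_k=i,\,f_B'\ne0\}-v_k(F)$ ($\infty$ if the minimum is over the empty set), let $\mathcal{N}_k'$ be the lower convex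 hull of the points $(i,w_i')$, $0\le i\le N_k$, and $$\bar H_k'=\sum_{(i,w_i')\in\mathcal{N}_k'}\Big(\sum_{B\in\mathcal{B}(i,w_i'+v_k(F))}f_B'\Lambda^{B-B_0}\Big)x^{w_i'}y^i.$$ The lowest edge of a Newton polygon of a polynomial of degree $N_g$ here is the edge having $(N_g,0)$ as an endpoint (that point itself if the polygon is a point); the restriction of a polynomial to an edge is the sum of its terms $c\,x^jy^i$ with $(i,j)$ on the edge. *)

theory Defs
  imports "HOL-Analysis.Analysis" "HOL-Computational_Algebra.Computational_Algebra"
begin

text \<open>
  Conventions. \<open>K[[x]][y]\<close> is the type \<open>'a fps poly\<close>: the outer polynomial variable is \<open>y\<close>, the
  inner power series variable is \<open>x\<close>. Residue fields of the tower are subfields (as sets) of an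
  arbitrary extension field \<open>'b\<close> of \<open>K = 'a\<close>, given by an embedding \<open>emb\<close>. Boundary polynomials
  live in \<open>'b fls poly\<close>, because the exponents of \<open>x\<close> in the polynomial computed from a
  \<open>\<Psi>\<close>-adic expansion are a priori only integers.
\<close>

definition perfect_field :: "'a::field itself \<Rightarrow> bool" where
  "perfect_field _ \<longleftrightarrow> CHAR('a) = 0 \<or> surj (\<lambda>a::'a. a ^ CHAR('a))"

definition field_embedding :: "('a::field \<Rightarrow> 'b::field) \<Rightarrow> bool" where
  "field_embedding emb \<longleftrightarrow> emb 1 = 1 \<and> (\<forall>a b. emb (a + b) = emb a + emb b)
     \<and> (\<forall>a b. emb (a * b) = emb a * emb b)"

definition poly_over :: "'b::field set \<Rightarrow> 'b poly \<Rightarrow> bool" where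
  "poly_over L p \<longleftrightarrow> (\<forall>i. coeff p i \<in> L)"

definition irreducible_over :: "'b::field set \<Rightarrow> 'b poly \<Rightarrow> bool" where
  "irreducible_over L p \<longleftrightarrow> poly_over L p \<and> degree p > 0 \<and>
     (\<forall>a b. poly_over L a \<longrightarrow> poly_over L b \<longrightarrow> p = a * b \<longrightarrow> degree a = 0 \<or> degree b = 0)"

text \<open>
  For a root \<open>z\<close> of an irreducible \<open>P\<close> over the subfield \<open>L\<close>, this is the image of the evaluation
  map \<open>L[Z] \<rightarrow> 'b\<close>, \<open>Z \<mapsto> z\<close>, whose kernel is \<open>(P)\<close>; so it is \<open>L[Z]/(P)\<close> with \<open>z\<close> the class of \<open>Z\<close>.
\<close>
definition adjoin :: "'b::field set \<Rightarrow> 'b \<Rightarrow> 'b set" where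
  "adjoin L z = {poly p z | p. poly_over L p}"

definition fps_map :: "('a \<Rightarrow> 'b) \<Rightarrow> 'a fps \<Rightarrow> 'b fps" where
  "fps_map h a = Abs_fps (\<lambda>n. h (fps_nth a n))"

definition weierstrass :: "'a::field fps poly \<Rightarrow> bool" where
  "weierstrass H \<longleftrightarrow> lead_coeff H = 1 \<and> (\<forall>i<degree H. fps_nth (coeff H i) 0 = 0)"

definition fpoly_over :: "'b::field set \<Rightarrow> 'b fps poly \<Rightarrow> bool" where
  "fpoly_over L H \<longleftrightarrow> (\<forall>i j. fps_nth (coeff H i) j \<in> L)"

text \<open>\<open>L[[x,y]]\<close> is rendered inside \<open>'b fps fps\<close>, the outer variable being \<open>y\<close>.\<close>
definition fps2_over :: "'b::field set \<Rightarrow> 'b fps fps \<Rightarrow> bool" where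
  "fps2_over L V \<longleftrightarrow> (\<forall>i j. fps_nth (fps_nth V i) j \<in> L)"

definition fps2_unit_over :: "'b::field set \<Rightarrow> 'b fps fps \<Rightarrow> bool" where
  "fps2_unit_over L V \<longleftrightarrow> fps2_over L V \<and> (\<exists>W. fps2_over L W \<and> V * W = 1)"

definition vx :: "'a::field fps poly \<Rightarrow> enat" where
  "vx H = (INF i. if coeff H i = 0 then \<infinity> else enat (subdegree (coeff H i)))"

text \<open>
  A pair \<open>(A, B)\<close> stands for the map \<open>(x,y) \<mapsto> (A(x), B(x,y))\<close>, where \<open>A(0) = 0\<close>;
  \<open>subst_xy H (A, B)\<close> is \<open>H(A(x), B(x,y))\<close>, and \<open>comp_xy p s\<close> is the composite \<open>p \<circ> s\<close>.
\<close>
definition subst_xy :: "'b::field fps poly \<Rightarrow> 'b fps \<times> 'b fps poly \<Rightarrow> 'b fps poly" where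
  "subst_xy H s = poly (map_poly (\<lambda>a. [:fps_compose a (fst s):]) H) (snd s)"

definition comp_xy :: "'b::field fps \<times> 'b fps poly \<Rightarrow> 'b fps \<times> 'b fps poly \<Rightarrow> 'b fps \<times> 'b fps poly" where
  "comp_xy p s = (fps_compose (fst p) (fst s), subst_xy (snd p) s)"

definition lower_hull :: "(real \<times> real) set \<Rightarrow> (real \<times> real) set" where
  "lower_hull S = {(a, b). (a, b) \<in> convex hull S \<and> (\<forall>b'. (a, b') \<in> convex hull S \<longrightarrow> b \<le> b')}"

definition newton_polygon :: "'b::field fls poly \<Rightarrow> (real \<times> real) set" where
  "newton_polygon H =
     lower_hull {(real i, real_of_int (fls_subdegree (coeff H i))) | i. coeff H i \<noteq> 0}"

lift_definition fls_filter :: "(int \<Rightarrow> bool) \<Rightarrow> 'b::zero fls \<Rightarrow> 'b fls"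
  is "\<lambda>P f n. if P n then f n else 0"
  by (auto elim: MOST_mono)

text \<open>The sum of the terms \<open>c x^j y^i\<close> of \<open>H\<close> with \<open>(i, j) \<in> E\<close>.\<close>
definition restrict_terms :: "(real \<times> real) set \<Rightarrow> 'b::field fls poly \<Rightarrow> 'b fls poly" where
  "restrict_terms E H =
     (\<Sum>i\<le>degree H. monom (fls_filter (\<lambda>j. (real i, real_of_int j) \<in> E) (coeff H i)) i)"

definition to_fls :: "'b::field fps poly \<Rightarrow> 'b fls poly" where
  "to_fls H = map_poly fps_to_fls H"

definition boundary :: "'b::field fps poly \<Rightarrow> 'b fls poly" where
  "boundary H = restrict_terms (newton_polygon (to_fls H)) (to_fls H)"

text \<open>
  A Newton polygon is the graph of a convex piecewise affine function. If \<open>(n, 0)\<close> is its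
  rightmost point, the union of the segments from \<open>(n, 0)\<close> that stay inside it is the edge ending
  at \<open>(n, 0)\<close>, or \<open>{(n, 0)}\<close> if the polygon is a point.
\<close>
definition lowest_edge :: "nat \<Rightarrow> (real \<times> real) set \<Rightarrow> (real \<times> real) set" where
  "lowest_edge n NP = {u. closed_segment (real n, 0) u \<subseteq> NP}"

text \<open>\<open>qh_poly q m P = P(y^q / x^m) x^(m deg P)\<close>\<close>
definition qh_poly :: "nat \<Rightarrow> nat \<Rightarrow> 'b::field poly \<Rightarrow> 'b fls poly" where
  "qh_poly q m P =
     poly (map_poly (\<lambda>c. [:fls_const c:]) P) (monom (fls_X powi (- int m)) q)
       * [:fls_X ^ (m * degree P):]"

text \<open>
  \<open>edge_data L H q m P N\<close> says that the Weierstrass polynomial \<open>H\<close> is degenerated over \<open>L\<close> with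
  edge data \<open>(q, m, P, N)\<close>; that the polygon is straight of slope \<open>-m/q\<close> is expressed by
  its lying on a line of that slope.
\<close>
definition edge_data ::
  "'b::field set \<Rightarrow> 'b fps poly \<Rightarrow> nat \<Rightarrow> nat \<Rightarrow> 'b poly \<Rightarrow> nat \<Rightarrow> bool" where
  "edge_data L H q m P N \<longleftrightarrow>
     weierstrass H \<and> fpoly_over L H \<and> q > 0 \<and> coprime q m \<and>
     (\<exists>c. \<forall>(a, b) \<in> newton_polygon (to_fls H). real q * b + real m * a = c) \<and>
     lead_coeff P = 1 \<and> irreducible_over L P \<and>
     boundary H = qh_poly q m P ^ N"

definition degenerated :: "'b::field set \<Rightarrow> 'b fps poly \<Rightarrow> bool" where
  "degenerated L H \<longleftrightarrow> (\<exists>q m P N. edge_data L H q m P N)"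

text \<open>
  The field \<open>tX\<close> is the sequence \<open>X\<^sub>k\<close>, and \<open>tell\<close> below is \<open>\<ell>\<^sub>k\<close>. The only choice in a tower for \<open>F\<close> is that of
  the roots \<open>z\<^sub>k\<close>, that is, of the embeddings of the residue fields \<open>K\<^sub>k\<close> into \<open>'b\<close>.
\<close>
record (overloaded) 'b tower =
  tN :: "nat \<Rightarrow> nat"
  tK :: "nat \<Rightarrow> 'b set"
  tq :: "nat \<Rightarrow> nat"
  tm :: "nat \<Rightarrow> nat"
  tP :: "nat \<Rightarrow> 'b poly"
  tz :: "nat \<Rightarrow> 'b"
  ts :: "nat \<Rightarrow> int"
  tt :: "nat \<Rightarrow> nat"
  tG :: "nat \<Rightarrow> 'b fps poly"
  tc :: "nat \<Rightarrow> 'b fps"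
  tH :: "nat \<Rightarrow> 'b fps poly"

definition tell :: "'b::field tower \<Rightarrow> nat \<Rightarrow> nat" where
  "tell T k = degree (tP T k)"

definition tower_start :: "('a::field \<Rightarrow> 'b::field) \<Rightarrow> 'a fps poly \<Rightarrow> 'b tower \<Rightarrow> bool" where
  "tower_start emb F T \<longleftrightarrow>
     tN T 0 = degree F \<and> tK T 0 = range emb \<and>
     tc T 0 = - fps_map emb (coeff F (degree F - 1)) / of_nat (degree F) \<and>
     tH T 0 = pcompose (map_poly (fps_map emb) F) [:tc T 0, 1:]"

definition tower_step :: "'b::field tower \<Rightarrow> nat \<Rightarrow> bool" where
  "tower_step T k \<longleftrightarrow>
     tN T (k - 1) > 1 \<and>
     edge_data (tK T (k - 1)) (tH T (k - 1)) (tq T k) (tm T k) (tP T k) (tN T k) \<and>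
     poly (tP T k) (tz T k) = 0 \<and> tK T k = adjoin (tK T (k - 1)) (tz T k) \<and>
     int (tq T k) * ts T k - int (tt T k) * int (tm T k) = 1 \<and> tt T k < tq T k \<and>
     weierstrass (tG T k) \<and> fpoly_over (tK T k) (tG T k) \<and> degree (tG T k) = tN T k \<and>
     (\<exists>V. fps2_unit_over (tK T k) V \<and>
       fps_of_poly (subst_xy (tH T (k - 1))
           (fps_const (tz T k ^ tt T k) * fps_X ^ tq T k,
            [:fps_X ^ tm T k * fps_const (tz T k powi ts T k), fps_X ^ tm T k:]))
         = fps_const (fps_X ^ (tq T k * tm T k * tell T k * tN T k)) * fps_of_poly (tG T k) * V) \<and>
     tc T k = - coeff (tG T k) (tN T k - 1) / of_nat (tN T k) \<and>
     tH T k = pcompose (tG T k) [:tc T k, 1:]"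

text \<open>
  \<open>T\<close> lists the data of the sequence for \<open>F\<close> up to the stopping index \<open>g\<close> (entries
  beyond \<open>g\<close> are irrelevant). The steps up to \<open>g\<close> force \<open>N\<^sub>k > 1\<close> and \<open>H\<^sub>k\<close> degenerated for \<open>k < g\<close>,
  so \<open>g\<close> is the smallest index with the stopping property.
\<close>
definition tower_of :: "('a::field \<Rightarrow> 'b::field) \<Rightarrow> 'a fps poly \<Rightarrow> nat \<Rightarrow> 'b tower \<Rightarrow> bool" where
  "tower_of emb F g T \<longleftrightarrow>
     tower_start emb F T \<and> (\<forall>k\<in>{1..g}. tower_step T k) \<and>
     (tN T g = 1 \<or> \<not> degenerated (tK T g) (tH T g))"

definition tsigma :: "'b::field tower \<Rightarrow> nat \<Rightarrow> 'b fps \<times> 'b fps poly" where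
  "tsigma T k =
     (fps_const (tz T k ^ tt T k) * fps_X ^ tq T k,
      [:fps_X ^ tm T k * (fps_const (tz T k powi ts T k) + tc T k), fps_X ^ tm T k:])"

primrec tpi :: "'b::field tower \<Rightarrow> nat \<Rightarrow> 'b fps \<times> 'b fps poly" where
  "tpi T 0 = (fps_X, [:tc T 0, 1:])"
| "tpi T (Suc k) = comp_xy (tpi T k) (tsigma T (Suc k))"

definition pullback ::
  "('a::field \<Rightarrow> 'b::field) \<Rightarrow> 'b tower \<Rightarrow> nat \<Rightarrow> 'a fps poly \<Rightarrow> 'b fps poly" where
  "pullback emb T k H = subst_xy (map_poly (fps_map emb) H) (tpi T k)"

text \<open>
  The first component of \<open>\<pi>\<^sub>k\<close> is the series \<open>\<mu>\<^sub>k x^(e\<^sub>k)\<close>; \<open>S\<^sub>k\<close> is the part of degree \<open>0\<close> in \<open>y\<close> of the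
  second one.
\<close>
definition min_poly ::
  "('a::field \<Rightarrow> 'b::field) \<Rightarrow> 'b tower \<Rightarrow> nat \<Rightarrow> 'a fps poly" where
  "min_poly emb T k = (THE p. lead_coeff p = 1 \<and> irreducible p \<and>
     poly (map_poly (\<lambda>a. fps_compose (fps_map emb a) (fst (tpi T k))) p) (coeff (snd (tpi T k)) 0) = 0)"

definition vk ::
  "('a::field \<Rightarrow> 'b::field) \<Rightarrow> 'b tower \<Rightarrow> nat \<Rightarrow> 'a fps poly \<Rightarrow> enat" where
  "vk emb T k H = vx (pullback emb T k H)"

definition trailing_coeff :: "'b::zero poly \<Rightarrow> 'b" where
  "trailing_coeff p = coeff p (LEAST i. coeff p i \<noteq> 0)"

text \<open>
  Extracting the coefficients of \<open>x^v\<close>, \<open>v = v\<^sub>k(H)\<close>, amounts to dividing by \<open>x^v\<close> and setting \<open>x = 0\<close>.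
\<close>
definition lambda_k ::
  "('a::field \<Rightarrow> 'b::field) \<Rightarrow> 'b tower \<Rightarrow> nat \<Rightarrow> 'a fps poly \<Rightarrow> 'b" where
  "lambda_k emb T k H = (if H = 0 then 0 else
     trailing_coeff (map_poly (\<lambda>a. fps_nth a (the_enat (vk emb T k H))) (pullback emb T k H)))"

text \<open>
  Families indexed by \<open>-1, \<dots>, k\<close> are indexed here by \<open>0, \<dots>, k + 1\<close>: the entry with original
  index \<open>i\<close> sits at position \<open>i + 1\<close>. In particular \<open>b\<^sub>i\<^sub>-\<^sub>1\<close> is \<open>b i\<close> and \<open>b\<^sub>k\<close> is \<open>b (Suc k)\<close>.
\<close>
definition Phi ::
  "('a::field \<Rightarrow> 'b::field) \<Rightarrow> 'b tower \<Rightarrow> nat \<Rightarrow> 'a fps poly" where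
  "Phi emb T j = (case j of 0 \<Rightarrow> [:fps_X:] | Suc i \<Rightarrow> min_poly emb T i)"

definition V_entry ::
  "('a::field \<Rightarrow> 'b::field) \<Rightarrow> 'b tower \<Rightarrow> nat \<Rightarrow> nat \<Rightarrow> nat" where
  "V_entry emb T k j = the_enat (vk emb T k (Phi emb T j))"

definition exponents :: "'b::field tower \<Rightarrow> nat \<Rightarrow> (nat \<Rightarrow> nat) set" where
  "exponents T k = {b. (\<forall>j>Suc k. b j = 0) \<and> (\<forall>i\<in>{1..k}. b i < tq T i * tell T i)}"

definition weight ::
  "('a::field \<Rightarrow> 'b::field) \<Rightarrow> 'b tower \<Rightarrow> nat \<Rightarrow> (nat \<Rightarrow> nat) \<Rightarrow> nat" where
  "weight emb T k b = (\<Sum>j\<le>Suc k. b j * V_entry emb T k j)"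

definition exponents_at ::
  "('a::field \<Rightarrow> 'b::field) \<Rightarrow> 'b tower \<Rightarrow> nat \<Rightarrow> nat \<Rightarrow> int \<Rightarrow> (nat \<Rightarrow> nat) set" where
  "exponents_at emb T k i w = {b \<in> exponents T k. b (Suc k) = i \<and> int (weight emb T k b) = w}"

definition B0 :: "'b::field tower \<Rightarrow> nat \<Rightarrow> nat \<Rightarrow> nat" where
  "B0 T k = (\<lambda>j. if j = Suc k then tN T k else 0)"

text \<open>\<open>\<Lambda>^(B - B\<^sub>0)\<close>; the exponents may be negative.\<close>
definition Lambda_pow ::
  "('a::field \<Rightarrow> 'b::field) \<Rightarrow> 'b tower \<Rightarrow> nat \<Rightarrow> (nat \<Rightarrow> nat) \<Rightarrow> 'b" where
  "Lambda_pow emb T k b =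
     (\<Prod>j\<le>Suc k. lambda_k emb T k (Phi emb T j) powi (int (b j) - int (B0 T k j)))"

text \<open>The disjunct \<open>F = \<psi>^N\<close> accounts for the zero polynomial having degree \<open>-\<infinity>\<close>.\<close>
definition approx_root :: "nat \<Rightarrow> 'a::field fps poly \<Rightarrow> 'a fps poly" where
  "approx_root N F = (THE \<psi>. lead_coeff \<psi> = 1 \<and> degree \<psi> = degree F div N \<and>
     (F = \<psi> ^ N \<or> degree (F - \<psi> ^ N) < degree F - degree F div N))"

definition Psi :: "'a::field fps poly \<Rightarrow> 'b::field tower \<Rightarrow> nat \<Rightarrow> 'a fps poly" where
  "Psi F T j = (case j of 0 \<Rightarrow> [:fps_X:] | Suc i \<Rightarrow> approx_root (tN T i) F)"

text \<open>
  \<open>F = \<Sum>\<^sub>B f\<^sub>B \<Psi>^B\<close>. This sum is infinite only in the exponent \<open>b 0\<close> of \<open>\<psi>\<^sub>-\<^sub>1 = x\<close>; collecting the powers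
  of \<open>x\<close> into power series leaves a finite sum over the tuples with \<open>b 0 = 0\<close>.
\<close>
definition adic_expansion ::
  "'a::field fps poly \<Rightarrow> 'b::field tower \<Rightarrow> nat \<Rightarrow> ((nat \<Rightarrow> nat) \<Rightarrow> 'a) \<Rightarrow> bool" where
  "adic_expansion F T k f \<longleftrightarrow>
     (\<forall>b. b \<notin> exponents T k \<longrightarrow> f b = 0) \<and>
     (let D = {b. b 0 = 0 \<and> (\<exists>n. f (b(0 := n)) \<noteq> 0)} in
       finite D \<and>
       F = (\<Sum>b\<in>D. smult (Abs_fps (\<lambda>n. f (b(0 := n)))) (\<Prod>j\<in>{1..Suc k}. Psi F T j ^ b j)))"

definition adic_coeff ::
  "'a::field fps poly \<Rightarrow> 'b::field tower \<Rightarrow> nat \<Rightarrow> (nat \<Rightarrow> nat) \<Rightarrow> 'a" where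
  "adic_coeff F T k = (THE f. adic_expansion F T k f)"

definition weights_at ::
  "('a::field \<Rightarrow> 'b::field) \<Rightarrow> 'a fps poly \<Rightarrow> 'b tower \<Rightarrow> nat \<Rightarrow> nat \<Rightarrow> nat set" where
  "weights_at emb F T k i =
     {weight emb T k b | b. b \<in> exponents T k \<and> b (Suc k) = i \<and> adic_coeff F T k b \<noteq> 0}"

text \<open>
  \<open>w'\<^sub>i\<close>, meaningful only if \<open>weights_at emb F T k i\<close> is nonempty. Indices with \<open>w'\<^sub>i = \<infinity>\<close> are left out
  in the next two definitions.
\<close>
definition w' ::
  "('a::field \<Rightarrow> 'b::field) \<Rightarrow> 'a fps poly \<Rightarrow> 'b tower \<Rightarrow> nat \<Rightarrow> nat \<Rightarrow> int" where
  "w' emb F T k i = int (LEAST w. w \<in> weights_at emb F T k i) - int (the_enat (vk emb T k F))"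

definition newton_polygon' ::
  "('a::field \<Rightarrow> 'b::field) \<Rightarrow> 'a fps poly \<Rightarrow> 'b tower \<Rightarrow> nat \<Rightarrow> (real \<times> real) set" where
  "newton_polygon' emb F T k = lower_hull
     {(real i, real_of_int (w' emb F T k i)) | i. i \<le> tN T k \<and> weights_at emb F T k i \<noteq> {}}"

definition boundary' ::
  "('a::field \<Rightarrow> 'b::field) \<Rightarrow> 'a fps poly \<Rightarrow> 'b tower \<Rightarrow> nat \<Rightarrow> 'b fls poly" where
  "boundary' emb F T k =
     (\<Sum>i | i \<le> tN T k \<and> weights_at emb F T k i \<noteq> {} \<and>
           (real i, real_of_int (w' emb F T k i)) \<in> newton_polygon' emb F T k.
       monom (fls_const (\<Sum>b\<in>exponents_at emb T k i (w' emb F T k i + int (the_enat (vk emb T k F))).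
                  emb (adic_coeff F T k b) * Lambda_pow emb T k b)
              * fls_X powi (w' emb F T k i)) i)"

end

theory Submission
  imports Defs
begin

text \<open>
  The pullback of \<open>F\<close> under \<open>\<pi>\<^sub>k\<close> is a power of \<open>x\<close> times \<open>H\<^sub>k\<close> times a unit, so on every line
  supporting the Newton polygon of \<open>H\<^sub>k\<close> at \<open>(N\<^sub>k, 0)\<close> it has the leading form of \<open>H\<^sub>k\<close>, up to a
  constant. Every nonzero polynomial of degree less than \<open>d\<^sub>k\<close> pulls back to a power of \<open>x\<close> times a
  unit, and \<open>\<psi>\<^sub>k\<close> pulls back to \<open>x^V (\<lambda> y + \<dots>)\<close>; because \<open>H\<^sub>k\<close> has no term in \<open>y^(N\<^sub>k - 1)\<close> and
  the \<open>\<psi>\<^sub>k\<close>-adic expansion of \<open>F\<close> has none in \<open>\<psi>\<^sub>k^(N\<^sub>k - 1)\<close>, the remaining terms of the latter lie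
  strictly above the line. The leading form can therefore also be read off the \<open>\<Psi>\<close>-adic expansion,
  where no cancellation occurs since the products \<open>\<Lambda>^B\<close> of equal weight and equal \<open>b\<^sub>k\<close> are linearly
  independent over \<open>K\<close>. The minimal polynomials enter only through \<open>V\<close> and \<open>\<Lambda>\<close>, and \<open>\<phi>\<^sub>k\<close> and
  \<open>\<psi>\<^sub>k\<close> have the same values and leading coefficients.
\<close>

text \<open>The substitution x -> x^q, y -> x^m y turns the weight q j + m i into the order of a
  power series, so leading forms along a line are handled by the ring homomorphism
  \<open>weighted\<close> and the predicate \<open>lead\<close>. Up to constants and a translation
  of y this is also \<open>tsigma\<close>; one calculus thus serves both the edges and the passage
  to the next level. One induction carries all facts about level k. Besides the factorisation of F
  it keeps \<open>small\<close> (nonzero polynomials of degree below d_k have a unit-like pullback),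
  \<open>lift\<close> (every value from V on and every coefficient in K_k is attained by such a
  polynomial) and \<open>shape_ex\<close>. With \<open>lift\<close>, \<open>phi\<close> is built by
  successive approximation and the edge polynomial P is lifted. Noncancellation comes from z having
  degree l over K_k: the points of a line with y-exponent below q l involve only l consecutive
  powers of z. At level g no edge data are at hand, so the argument uses arbitrary lines supporting
  the polygon at (N, 0). Only along these is the pullback of \<open>psi\<close> controlled, which is
  why the lowest edge is what can be compared there.\<close>

unbundle fps_syntax
unbundle no vec_syntax

section \<open>Ring homomorphisms, as a predicate on functions\<close>

definition rhom :: "('x::comm_ring_1 \<Rightarrow> 'y::comm_ring_1) \<Rightarrow> bool" where
  "rhom h \<longleftrightarrow> h 1 = 1 \<and> (\<forall>a b. h (a + b) = h a + h b) \<and> (\<forall>a b. h (a * b) = h a * h b)"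

lemma rhomI:
  assumes "h 1 = 1" "\<And>a b. h (a + b) = h a + h b" "\<And>a b. h (a * b) = h a * h b"
  shows "rhom h"
  using assms by (simp add: rhom_def)

lemma rhom_1: "rhom h \<Longrightarrow> h 1 = 1"
  and rhom_add: "rhom h \<Longrightarrow> h (a + b) = h a + h b"
  and rhom_mult: "rhom h \<Longrightarrow> h (a * b) = h a * h b"
  by (simp_all add: rhom_def)

lemma rhom_0: "rhom h \<Longrightarrow> h 0 = 0"
  using rhom_add[of h 0 0] by simp

lemma rhom_uminus: "rhom h \<Longrightarrow> h (- a) = - h a"
  using rhom_add[of h a "- a"] rhom_0[of h] by (simp add: eq_neg_iff_add_eq_0 add.commute)

lemma rhom_diff: "rhom h \<Longrightarrow> h (a - b) = h a - h b"
  using rhom_add[of h a "- b"] by (simp add: rhom_uminus)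

lemma rhom_power: "rhom h \<Longrightarrow> h (a ^ n) = h a ^ n"
  by (induction n) (simp_all add: rhom_1 rhom_mult)

lemma rhom_sum: "rhom h \<Longrightarrow> h (sum f A) = (\<Sum>x\<in>A. h (f x))"
  by (induction A rule: infinite_finite_induct) (simp_all add: rhom_0 rhom_add)

lemma rhom_prod: "rhom h \<Longrightarrow> h (prod f A) = (\<Prod>x\<in>A. h (f x))"
  by (induction A rule: infinite_finite_induct) (simp_all add: rhom_1 rhom_mult)

lemma rhom_of_nat: "rhom h \<Longrightarrow> h (of_nat n) = of_nat n"
  by (induction n) (simp_all add: rhom_1 rhom_add rhom_0)

lemmas rhom_simps = rhom_0 rhom_1 rhom_add rhom_mult rhom_uminus rhom_diff rhom_power rhom_sum rhom_prod

lemma rhom_comp: "rhom f \<Longrightarrow> rhom h \<Longrightarrow> rhom (\<lambda>x. f (h x))"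
  by (simp add: rhom_def)

lemma rhom_const_poly: "rhom (\<lambda>a. [:a:])"
  by (rule rhomI) (simp_all add: one_pCons)

lemma rhom_poly: "rhom (\<lambda>p. poly p c)"
  by (rule rhomI) simp_all

lemma rhom_fps_nth_0: "rhom (\<lambda>a::'x::comm_ring_1 fps. a $ 0)"
  by (rule rhomI) simp_all

lemma rhom_map_poly:
  assumes "rhom h" shows "rhom (map_poly h)"
proof (rule rhomI)
  note h0 = rhom_0[OF assms]
  show "map_poly h 1 = 1"
    by (simp add: one_pCons map_poly_pCons h0 rhom_1[OF assms])
  show "map_poly h (a + b) = map_poly h a + map_poly h b" for a b
    by (rule poly_eqI) (simp add: coeff_map_poly h0 rhom_add[OF assms])
  show "map_poly h (a * b) = map_poly h a * map_poly h b" for a b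
    by (rule poly_eqI) (simp add: coeff_map_poly h0 coeff_mult rhom_sum[OF assms] rhom_mult[OF assms])
qed

lemma rhom_fps_map:
  assumes "rhom h" shows "rhom (fps_map h)"
proof (rule rhomI)
  note h0 = rhom_0[OF assms]
  show "fps_map h 1 = 1"
    by (rule fps_ext) (simp add: fps_map_def h0 rhom_1[OF assms])
  show "fps_map h (a + b) = fps_map h a + fps_map h b" for a b
    by (rule fps_ext) (simp add: fps_map_def rhom_add[OF assms])
  show "fps_map h (a * b) = fps_map h a * fps_map h b" for a b
    by (rule fps_ext) (simp add: fps_map_def fps_mult_nth rhom_sum[OF assms] rhom_mult[OF assms])
qed

lemma rhom_fps_compose:
  fixes A :: "'x::idom fps"
  assumes "A $ 0 = 0" shows "rhom (\<lambda>a. a oo A)"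
  by (rule rhomI) (simp_all add: fps_compose_add_distrib fps_compose_mult_distrib assms)

text \<open>A polynomial is built from constants and y by ring operations. Substitution identities
  below are reduced to these generators.\<close>

lemma rhom_eqI:
  assumes "rhom f" "rhom h" "\<And>a. f [:a:] = h [:a:]" "f [:0, 1:] = h [:0, 1:]"
  shows "f p = h p"
proof (induction p)
  case 0
  show ?case by (simp add: rhom_0 assms)
next
  case (pCons a p)
  have "pCons a p = [:a:] + [:0, 1:] * p" by simp
  then show ?case using pCons by (simp only: rhom_add rhom_mult assms)
qed

lemma rhom_poly_eval:
  assumes "rhom h" shows "rhom (\<lambda>H. poly (map_poly h H) Y)"
  by (rule rhom_comp[OF rhom_poly rhom_map_poly[OF assms]])

lemma coeff_poly_monom_arg:
  fixes h :: "'x::comm_ring_1 \<Rightarrow> 'y::comm_ring_1"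
  assumes "h 0 = 0"
  shows "coeff (poly (map_poly (\<lambda>a. [:h a:]) H) [:0, c:]) i = h (coeff H i) * c ^ i"
proof (induction H arbitrary: i)
  case 0
  show ?case by (simp add: assms)
next
  case (pCons a p)
  then show ?case by (cases i) (simp_all add: map_poly_pCons assms algebra_simps)
qed

section \<open>Substitutions\<close>

lemma rhom_subst_xy:
  assumes "fst s $ 0 = 0" shows "rhom (\<lambda>H. subst_xy H s)"
  unfolding subst_xy_def
  by (rule rhom_poly_eval, rule rhom_comp[OF rhom_const_poly rhom_fps_compose[OF assms]])

lemma subst_xy_const: "subst_xy [:a:] s = [:a oo fst s:]"
  by (cases "a = 0") (simp_all add: subst_xy_def map_poly_pCons)

lemma subst_xy_y: "subst_xy [:0, 1:] s = snd s"
  by (simp add: subst_xy_def map_poly_pCons)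

lemma rhom_pcompose: "rhom (\<lambda>p. pcompose p c)"
  by (rule rhomI) (simp_all add: pcompose_add pcompose_mult one_pCons pcompose_pCons)

lemma subst_xy_comp:
  assumes "fst s $ 0 = 0" "fst p $ 0 = 0"
  shows "subst_xy H (comp_xy p s) = subst_xy (subst_xy H p) s"
proof (rule rhom_eqI[of "\<lambda>H. subst_xy H (comp_xy p s)" "\<lambda>H. subst_xy (subst_xy H p) s"])
  show "rhom (\<lambda>H. subst_xy H (comp_xy p s))"
    by (rule rhom_subst_xy) (simp add: comp_xy_def assms)
  show "rhom (\<lambda>H. subst_xy (subst_xy H p) s)"
    by (rule rhom_comp) (simp_all add: rhom_subst_xy assms)
  show "subst_xy [:a:] (comp_xy p s) = subst_xy (subst_xy [:a:] p) s" for a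
    by (simp add: subst_xy_const comp_xy_def fps_compose_assoc assms)
  show "subst_xy [:0, 1:] (comp_xy p s) = subst_xy (subst_xy [:0, 1:] p) s"
    by (simp add: subst_xy_y comp_xy_def)
qed

lemma pcompose_subst_xy:
  assumes "A $ 0 = 0"
  shows "pcompose (subst_xy H (A, B)) C = subst_xy H (A, pcompose B C)"
proof (rule rhom_eqI[of "\<lambda>H. pcompose (subst_xy H (A, B)) C" "\<lambda>H. subst_xy H (A, pcompose B C)"])
  show "rhom (\<lambda>H. pcompose (subst_xy H (A, B)) C)"
    by (rule rhom_comp[OF rhom_pcompose rhom_subst_xy]) (simp add: assms)
  show "rhom (\<lambda>H. subst_xy H (A, pcompose B C))"
    by (rule rhom_subst_xy) (simp add: assms)
qed (simp_all add: subst_xy_const subst_xy_y)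

text \<open>This is the monomial part of \<open>tsigma\<close>; what remains of
  \<open>tsigma\<close> is a translation of y. For \<open>\<zeta> = 1\<close> it only
  regrades.\<close>

definition monom_subst :: "'b::field \<Rightarrow> nat \<Rightarrow> nat \<Rightarrow> 'b fps poly \<Rightarrow> 'b fps poly" where
  "monom_subst \<zeta> q m H = subst_xy H (fps_const \<zeta> * fps_X ^ q, [:0, fps_X ^ m:])"

lemma fps_nth_compose_const_X_power:
  fixes a :: "'x::field fps"
  assumes "q > 0"
  shows "(a oo (fps_const \<zeta> * fps_X ^ q)) $ n = (if q dvd n then \<zeta> ^ (n div q) * a $ (n div q) else 0)"
proof -
  have "a oo (fps_const \<zeta> * fps_X ^ q) = (a oo (fps_const \<zeta> * fps_X)) oo (fps_X ^ q)"
    using assms by (subst fps_compose_assoc[symmetric]) (simp_all add: fps_compose_mult_distrib)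
  then show ?thesis
    using assms by (simp add: fps_nth_compose_X_power fps_compose_linear)
qed

lemma coeff_monom_subst:
  "coeff (monom_subst \<zeta> q m H) i = (coeff H i oo (fps_const \<zeta> * fps_X ^ q)) * fps_X ^ (m * i)"
  by (simp add: monom_subst_def subst_xy_def coeff_poly_monom_arg power_mult)

lemma nth_coeff_monom_subst:
  assumes "q > 0"
  shows "coeff (monom_subst \<zeta> q m H) i $ n =
    (if m * i \<le> n \<and> q dvd (n - m * i)
     then \<zeta> ^ ((n - m * i) div q) * coeff H i $ ((n - m * i) div q) else 0)"
  by (simp add: coeff_monom_subst fps_nth_compose_const_X_power assms fps_X_power_mult_right_nth)

lemma rhom_monom_subst: "q > 0 \<Longrightarrow> rhom (monom_subst \<zeta> q m)"
  unfolding monom_subst_def by (rule rhom_subst_xy) simp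

section \<open>Leading forms\<close>

text \<open>Exchanging the roles of the variables makes the x-adic order the order of a power
  series, and the lowest x-coefficient an element of K[y].\<close>

definition swap_xy :: "'b::field fps poly \<Rightarrow> 'b poly fps" where
  "swap_xy H = Abs_fps (\<lambda>n. map_poly (\<lambda>a. a $ n) H)"

lemma coeff_swap_xy [simp]: "coeff (swap_xy H $ n) i = coeff H i $ n"
  by (simp add: swap_xy_def coeff_map_poly)

lemma rhom_swap_xy: "rhom swap_xy"
proof (rule rhomI)
  show "swap_xy (1 :: 'x::field fps poly) = 1"
    by (rule fps_ext, rule poly_eqI) (simp add: coeff_eq_0 split: if_splits)
  show "swap_xy (a + b) = swap_xy a + swap_xy b" for a b :: "'x::field fps poly"
    by (rule fps_ext, rule poly_eqI) simp
  show "swap_xy (a * b) = swap_xy a * swap_xy b" for a b :: "'x::field fps poly"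
  proof (rule fps_ext, rule poly_eqI)
    fix n i
    have "coeff (swap_xy (a * b) $ n) i = (\<Sum>l\<le>i. \<Sum>j=0..n. coeff a l $ j * coeff b (i - l) $ (n - j))"
      by (simp add: coeff_mult fps_sum_nth fps_mult_nth)
    also have "\<dots> = (\<Sum>j=0..n. \<Sum>l\<le>i. coeff a l $ j * coeff b (i - l) $ (n - j))"
      by (rule sum.swap)
    also have "\<dots> = coeff ((swap_xy a * swap_xy b) $ n) i"
      by (simp add: fps_mult_nth coeff_sum coeff_mult)
    finally show "coeff (swap_xy (a * b) $ n) i = coeff ((swap_xy a * swap_xy b) $ n) i" .
  qed
qed

text \<open>The congruence f = p t^n modulo t^(n+1). The coefficient p may be zero: sums may cancel,
  and terms of too high order enter with p = 0, so that no case distinction is needed.\<close>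

definition lead :: "'c::comm_ring_1 fps \<Rightarrow> nat \<Rightarrow> 'c \<Rightarrow> bool" where
  "lead f n p \<longleftrightarrow> (\<forall>k<n. f $ k = 0) \<and> f $ n = p"

lemma lead_add: "lead f n p \<Longrightarrow> lead h n r \<Longrightarrow> lead (f + h) n (p + r)"
  by (simp add: lead_def)

lemma lead_0: "lead 0 n 0"
  by (simp add: lead_def)

lemma lead_sum: "(\<And>x. x \<in> A \<Longrightarrow> lead (f x) n (p x)) \<Longrightarrow> lead (sum f A) n (sum p A)"
  by (induction A rule: infinite_finite_induct) (simp_all add: lead_0 lead_add)

lemma lead_weaken: "lead f n p \<Longrightarrow> n' < n \<Longrightarrow> lead f n' 0"
  by (simp add: lead_def)

lemma lead_mult:
  assumes "lead f n p" "lead h m r"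
  shows "lead (f * h) (n + m) (p * r)"
proof -
  have "(f * h) $ k = 0" if "k < n + m" for k
  proof -
    have "f $ i * h $ (k - i) = 0" if "i \<le> k" for i
      using assms \<open>k < n + m\<close> that unfolding lead_def
      by (cases "i < n") auto
    then show ?thesis by (simp add: fps_mult_nth)
  qed
  moreover have "(f * h) $ (n + m) = p * r"
  proof -
    have "(f * h) $ (n + m) = (\<Sum>i=0..n+m. if i = n then p * r else 0)"
      unfolding fps_mult_nth
    proof (rule sum.cong)
      fix i assume "i \<in> {0..n+m}"
      then show "f $ i * h $ (n + m - i) = (if i = n then p * r else 0)"
        using assms unfolding lead_def by (cases "i < n"; cases "i = n") auto
    qed simp
    then show ?thesis by simp
  qed
  ultimately show ?thesis by (simp add: lead_def)
qed

lemma lead_1: "lead 1 0 1"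
  by (simp add: lead_def)

lemma lead_power: "lead f n p \<Longrightarrow> lead (f ^ k) (k * n) (p ^ k)"
  by (induction k) (auto simp: lead_1 dest: lead_mult)

lemma lead_prod: "(\<And>x. x \<in> A \<Longrightarrow> lead (f x) (n x) (p x)) \<Longrightarrow> lead (prod f A) (sum n A) (prod p A)"
  by (induction A rule: infinite_finite_induct) (simp_all add: lead_1 lead_mult)

lemma lead_unique:
  assumes "lead f n p" "lead f m r" "p \<noteq> 0" "r \<noteq> 0"
  shows "n = m \<and> p = r"
  using assms unfolding lead_def by (metis nat_neq_iff)

text \<open>The series variable counts the weight q j + m i of x^j y^i, and the coefficient at
  weight n is the part of H on that line with x set to 1. For q > 0 the exponent j can be recovered
  from i and n.\<close>

definition weighted :: "nat \<Rightarrow> nat \<Rightarrow> 'b::field fps poly \<Rightarrow> 'b poly fps" where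
  "weighted q m H = swap_xy (monom_subst 1 q m H)"

lemma rhom_weighted: "q > 0 \<Longrightarrow> rhom (weighted q m)"
  unfolding weighted_def by (rule rhom_comp[OF rhom_swap_xy rhom_monom_subst])

lemma coeff_weighted:
  assumes "q > 0"
  shows "coeff (weighted q m H $ n) i =
    (if m * i \<le> n \<and> q dvd (n - m * i) then coeff H i $ ((n - m * i) div q) else 0)"
  by (simp add: weighted_def nth_coeff_monom_subst assms)

lemma weighted_nth_eq_0:
  assumes "q > 0" "\<And>i j. coeff H i $ j \<noteq> 0 \<Longrightarrow> n \<le> q * j + m * i" "k < n"
  shows "weighted q m H $ k = 0"
proof (rule poly_eqI)
  fix i
  show "coeff (weighted q m H $ k) i = coeff 0 i"
  proof (cases "m * i \<le> k \<and> q dvd (k - m * i)")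
    case True
    then have "q * ((k - m * i) div q) + m * i = k" by simp
    then have "coeff H i $ ((k - m * i) div q) = 0" using assms(2,3) by fastforce
    then show ?thesis by (simp add: coeff_weighted assms(1))
  qed (auto simp: coeff_weighted assms(1))
qed

lemma lead_weightedI:
  assumes "q > 0" "\<And>i j. coeff H i $ j \<noteq> 0 \<Longrightarrow> n \<le> q * j + m * i"
    and "\<And>i j. q * j + m * i = n \<Longrightarrow> coeff p i = coeff H i $ j"
    and "\<And>i. coeff p i \<noteq> 0 \<Longrightarrow> \<exists>j. q * j + m * i = n"
  shows "lead (weighted q m H) n p"
  unfolding lead_def
proof (intro conjI allI impI)
  show "weighted q m H $ k = 0" if "k < n" for k
    using assms(1,2) that by (rule weighted_nth_eq_0)
next
  show "weighted q m H $ n = p"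
  proof (rule poly_eqI)
    fix i
    show "coeff (weighted q m H $ n) i = coeff p i"
    proof (cases "m * i \<le> n \<and> q dvd (n - m * i)")
      case True
      then have "q * ((n - m * i) div q) + m * i = n" by simp
      then have "coeff p i = coeff H i $ ((n - m * i) div q)" by (rule assms(3))
      then show ?thesis using True by (simp add: coeff_weighted assms(1))
    next
      case False
      then have "\<not> (\<exists>j. q * j + m * i = n)" using assms(1) by force
      then show ?thesis using False assms(4) by (auto simp add: coeff_weighted assms(1))
    qed
  qed
qed

lemma lead_weightedD:
  assumes "q > 0" "lead (weighted q m H) n p"
  shows "coeff H i $ j \<noteq> 0 \<Longrightarrow> n \<le> q * j + m * i"
    and "q * j + m * i = n \<Longrightarrow> coeff p i = coeff H i $ j"
    and "coeff p i \<noteq> 0 \<Longrightarrow> \<exists>j. q * j + m * i = n"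
proof -
  have *: "coeff (weighted q m H $ (q * j + m * i)) i = coeff H i $ j" for i j
    using assms(1) by (simp add: coeff_weighted)
  show "n \<le> q * j + m * i" if "coeff H i $ j \<noteq> 0"
    using that assms(2) *[of j i] unfolding lead_def by (metis coeff_0 not_le)
  show "coeff p i = coeff H i $ j" if "q * j + m * i = n"
    using that assms(2) *[of j i] unfolding lead_def by metis
  show "\<exists>j. q * j + m * i = n" if "coeff p i \<noteq> 0"
  proof -
    have "coeff (weighted q m H $ n) i \<noteq> 0" using that assms(2) by (simp add: lead_def)
    then have "m * i \<le> n \<and> q dvd (n - m * i)" by (simp add: coeff_weighted assms(1) split: if_splits)
    then have "q * ((n - m * i) div q) + m * i = n" by simp
    then show ?thesis by blast
  qed
qed

text \<open>After division by x^n only the value at x = 0 matters, where the shift by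
  \<open>\<kappa>\<close> is the shift by its constant term.\<close>

lemma lead_translate:
  assumes "lead (swap_xy D) n p"
  shows "lead (swap_xy (pcompose D [:\<kappa>, 1:])) n (pcompose p [:\<kappa> $ 0, 1:])"
proof -
  have div: "coeff D i = fps_X ^ n * fps_shift n (coeff D i)" for i
  proof -
    have "coeff D i $ k = 0" if "k < n" for k
      using assms that by (metis lead_def coeff_swap_xy coeff_0)
    then show ?thesis
      by (intro fps_ext) (auto simp: fps_X_power_mult_nth)
  qed
  define D' where "D' = map_poly (fps_shift n) D"
  have D: "D = [:fps_X ^ n:] * D'"
    by (rule poly_eqI) (simp add: D'_def coeff_map_poly div[symmetric])
  have p: "p = map_poly (\<lambda>a. a $ 0) D'"
    using assms by (intro poly_eqI) (auto simp: D'_def coeff_map_poly lead_def simp flip: coeff_swap_xy)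
  have h: "rhom (map_poly (\<lambda>a::'a fps. a $ 0))"
    by (rule rhom_map_poly[OF rhom_fps_nth_0])
  have e: "map_poly (\<lambda>a. a $ 0) (pcompose D' [:\<kappa>, 1:]) = pcompose p [:\<kappa> $ 0, 1:]"
    unfolding p
    by (rule rhom_eqI[of "\<lambda>D'. map_poly (\<lambda>a. a $ 0) (pcompose D' [:\<kappa>, 1:])"
          "\<lambda>D'. pcompose (map_poly (\<lambda>a. a $ 0) D') [:\<kappa> $ 0, 1:]"])
      (simp_all add: rhom_comp[OF h rhom_pcompose] rhom_comp[OF rhom_pcompose h] map_poly_pCons pcompose_pCons)
  have c: "coeff (pcompose D [:\<kappa>, 1:]) i = fps_X ^ n * coeff (pcompose D' [:\<kappa>, 1:]) i" for i
    by (simp add: D pcompose_smult)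
  show ?thesis
    unfolding lead_def
  proof (intro conjI allI impI)
    show "swap_xy (pcompose D [:\<kappa>, 1:]) $ k = 0" if "k < n" for k
      using that by (intro poly_eqI) (simp add: c fps_X_power_mult_nth)
    show "swap_xy (pcompose D [:\<kappa>, 1:]) $ n = pcompose p [:\<kappa> $ 0, 1:]"
      unfolding e[symmetric] by (intro poly_eqI) (simp add: c fps_X_power_mult_nth coeff_map_poly)
  qed
qed

text \<open>A substitution of this shape splits into \<open>monom_subst\<close> and the translation
  of y by \<open>\<kappa>\<close>. On the line of weight n the x-exponent that belongs to y^i is (n
  - m i) / q, which explains the power of \<open>\<zeta>\<close> in \<open>p'\<close>.\<close>

lemma lead_sigma:
  fixes \<zeta> :: "'b::field"
  assumes "q > 0" "lead (weighted q m H) n p"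
  defines "p' \<equiv> (\<Sum>i\<le>degree p. monom (coeff p i * \<zeta> ^ ((n - m * i) div q)) i)"
  shows "lead (swap_xy (subst_xy H (fps_const \<zeta> * fps_X ^ q, [:fps_X ^ m * \<kappa>, fps_X ^ m:])))
    n (pcompose p' [:\<kappa> $ 0, 1:])"
proof -
  have "subst_xy H (fps_const \<zeta> * fps_X ^ q, [:fps_X ^ m * \<kappa>, fps_X ^ m:])
      = pcompose (monom_subst \<zeta> q m H) [:\<kappa>, 1:]"
    unfolding monom_subst_def by (subst pcompose_subst_xy) (use assms(1) in \<open>simp_all add: pcompose_pCons mult.commute\<close>)
  moreover have "lead (swap_xy (monom_subst \<zeta> q m H)) n p'"
  proof -
    have p': "coeff p' i = coeff p i * \<zeta> ^ ((n - m * i) div q)" for i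
      by (auto simp: p'_def coeff_sum coeff_eq_0)
    have "coeff (monom_subst \<zeta> q m H) i $ k = coeff (weighted q m H $ k) i * \<zeta> ^ ((k - m * i) div q)" for i k
      by (simp add: coeff_weighted nth_coeff_monom_subst assms(1))
    then show ?thesis
      using assms(2) unfolding lead_def by (auto intro!: poly_eqI simp: p')
  qed
  ultimately show ?thesis by (simp add: lead_translate)
qed

section \<open>Subfields and simple extensions\<close>

text \<open>The residue fields are subsets of the fixed field \<open>'b\<close>, so closure is
  tracked by membership.\<close>

definition subfld :: "'b::field set \<Rightarrow> bool" where
  "subfld L \<longleftrightarrow> 0 \<in> L \<and> 1 \<in> L \<and> (\<forall>a\<in>L. \<forall>b\<in>L. a + b \<in> L \<and> a * b \<in> L) \<and> (\<forall>a\<in>L. - a \<in> L \<and> inverse a \<in> L)"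

lemma
  assumes "subfld L"
  shows subfld_0: "0 \<in> L" and subfld_1: "1 \<in> L"
    and subfld_add: "a \<in> L \<Longrightarrow> b \<in> L \<Longrightarrow> a + b \<in> L"
    and subfld_mult: "a \<in> L \<Longrightarrow> b \<in> L \<Longrightarrow> a * b \<in> L"
    and subfld_uminus: "a \<in> L \<Longrightarrow> - a \<in> L"
    and subfld_inverse: "a \<in> L \<Longrightarrow> inverse a \<in> L"
  using assms by (auto simp: subfld_def)

lemma subfld_diff: "subfld L \<Longrightarrow> a \<in> L \<Longrightarrow> b \<in> L \<Longrightarrow> a - b \<in> L"
  using subfld_add[of L a "- b"] subfld_uminus[of L b] by simp

lemma subfld_divide: "subfld L \<Longrightarrow> a \<in> L \<Longrightarrow> b \<in> L \<Longrightarrow> a / b \<in> L"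
  by (simp add: divide_inverse subfld_mult subfld_inverse)

lemma subfld_power: "subfld L \<Longrightarrow> a \<in> L \<Longrightarrow> a ^ n \<in> L"
  by (induction n) (simp_all add: subfld_1 subfld_mult)

lemma subfld_sum: "subfld L \<Longrightarrow> (\<And>x. x \<in> A \<Longrightarrow> f x \<in> L) \<Longrightarrow> sum f A \<in> L"
  by (induction A rule: infinite_finite_induct) (simp_all add: subfld_0 subfld_add)

lemma subfld_prod: "subfld L \<Longrightarrow> (\<And>x. x \<in> A \<Longrightarrow> f x \<in> L) \<Longrightarrow> prod f A \<in> L"
  by (induction A rule: infinite_finite_induct) (simp_all add: subfld_1 subfld_mult)

lemma subfld_of_nat: "subfld L \<Longrightarrow> of_nat n \<in> L"
  by (induction n) (simp_all add: subfld_0 subfld_1 subfld_add)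

lemmas subfld_closed = subfld_0 subfld_1 subfld_add subfld_mult subfld_uminus subfld_inverse
  subfld_diff subfld_divide subfld_power subfld_sum subfld_prod subfld_of_nat

lemma poly_over_mult: "subfld L \<Longrightarrow> poly_over L p \<Longrightarrow> poly_over L r \<Longrightarrow> poly_over L (p * r)"
  by (simp add: poly_over_def coeff_mult subfld_closed)

lemma poly_over_add: "subfld L \<Longrightarrow> poly_over L p \<Longrightarrow> poly_over L r \<Longrightarrow> poly_over L (p + r)"
  by (simp add: poly_over_def subfld_closed)

lemma poly_over_uminus: "subfld L \<Longrightarrow> poly_over L p \<Longrightarrow> poly_over L (- p)"
  by (simp add: poly_over_def subfld_closed)

lemma poly_over_const: "subfld L \<Longrightarrow> c \<in> L \<Longrightarrow> poly_over L [:c:]"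
  by (auto simp: poly_over_def subfld_closed coeff_pCons split: nat.splits)

lemma poly_over_smult: "subfld L \<Longrightarrow> c \<in> L \<Longrightarrow> poly_over L p \<Longrightarrow> poly_over L (smult c p)"
  by (simp add: poly_over_def subfld_closed)

lemma poly_over_X: "subfld L \<Longrightarrow> poly_over L [:0, 1:]"
  by (auto simp: poly_over_def subfld_closed coeff_pCons split: nat.splits)

text \<open>The set S allows two uses: with S = \<open>UNIV\<close> this is division in K[[x]][y],
  and with S a subfield it shows that quotient and remainder stay over the subfield.\<close>

lemma monic_division:
  fixes f g :: "'c::comm_ring_1 poly"
  assumes "lead_coeff g = 1" "degree g > 0"
    and S: "0 \<in> S" "\<And>a b. a \<in> S \<Longrightarrow> b \<in> S \<Longrightarrow> a + b \<in> S" "\<And>a b. a \<in> S \<Longrightarrow> b \<in> S \<Longrightarrow> a - b \<in> S"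
      "\<And>a b. a \<in> S \<Longrightarrow> b \<in> S \<Longrightarrow> a * b \<in> S"
    and g: "\<And>i. coeff g i \<in> S" and "\<And>i. coeff f i \<in> S"
  shows "\<exists>u r. f = g * u + r \<and> degree r < degree g \<and> (\<forall>i. coeff u i \<in> S) \<and> (\<forall>i. coeff r i \<in> S)"
  using assms(8)
proof (induction "degree f" arbitrary: f rule: less_induct)
  case less
  show ?case
  proof (cases "degree f < degree g")
    case True
    then show ?thesis using less(2) S(1) by (intro exI[of _ 0] exI[of _ f]) simp
  next
    case False
    define c where "c = lead_coeff f"
    define n where "n = degree f - degree g"
    define f' where "f' = f - monom c n * g"
    have "c \<in> S" using less(2) by (simp add: c_def)
    have cm: "coeff (monom c n * g) i \<in> S" for i
      using S \<open>c \<in> S\<close> g by (simp add: coeff_monom_mult)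
    have S': "coeff f' i \<in> S" for i
      unfolding f'_def coeff_diff by (rule S(3)[OF less(2) cm])
    have "degree (monom c n * g) \<le> degree f"
      by (rule order.trans[OF degree_mult_le]) (use False degree_monom_le[of c n] in \<open>simp add: n_def\<close>)
    then have le: "degree f' \<le> degree f"
      unfolding f'_def by (rule degree_diff_le[OF order.refl])
    have "coeff f' (degree f) = 0"
      using False assms(1) by (simp add: f'_def coeff_monom_mult n_def c_def)
    then have "degree f' < degree f"
      using le False assms(2) by (metis degree_0 le_neq_implies_less leading_coeff_0_iff not_less)
    then obtain u r where *: "f' = g * u + r" "degree r < degree g" "\<forall>i. coeff u i \<in> S" "\<forall>i. coeff r i \<in> S"
      using less(1) S' by blast
    have "f = g * (u + monom c n) + r"
      using * by (simp add: f'_def algebra_simps)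
    moreover have "\<forall>i. coeff (u + monom c n) i \<in> S"
      using * S \<open>c \<in> S\<close> by simp
    ultimately show ?thesis using * by blast
  qed
qed

locale simple_ext =
  fixes L :: "'b::field set" and P :: "'b poly" and z :: 'b
  assumes L: "subfld L" and irr: "irreducible_over L P" and monic: "lead_coeff P = 1"
    and root: "poly P z = 0"
begin

lemma deg_pos: "degree P > 0" and P_over: "poly_over L P"
  using irr by (simp_all add: irreducible_over_def)

lemma division:
  assumes "poly_over L f" "poly_over L g" "lead_coeff g = 1" "degree g > 0"
  obtains u r where "f = g * u + r" "degree r < degree g" "poly_over L u" "poly_over L r"
  using monic_division[of g L f] assms L by (auto simp: poly_over_def subfld_closed)

text \<open>Euclidean descent: in P = Q' u + r the remainder is nonzero by irreducibility, and r(z)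
  = - Q'(z) u(z), so an inverse of r(z) yields one of Q(z).\<close>

lemma inverse_ex:
  assumes "poly_over L Q" "degree Q < degree P" "Q \<noteq> 0"
  shows "\<exists>A. poly_over L A \<and> poly A z * poly Q z = 1"
  using assms
proof (induction "degree Q" arbitrary: Q rule: less_induct)
  case less
  define c where "c = lead_coeff Q"
  have c: "c \<in> L" "c \<noteq> 0" using less by (auto simp: c_def poly_over_def)
  show ?case
  proof (cases "degree Q = 0")
    case True
    then obtain a where a: "Q = [:a:]" by (metis degree_eq_zeroE)
    with less.prems have "a \<noteq> 0" "a \<in> L" by (auto simp: c_def poly_over_def dest: spec[of _ 0])
    then show ?thesis using a L
      by (intro exI[of _ "[:inverse a:]"]) (simp add: poly_over_const subfld_closed)
  next
    case False
    define Q' where "Q' = smult (inverse c) Q"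
    have Q': "poly_over L Q'" "lead_coeff Q' = 1" "degree Q' = degree Q"
      using c L less.prems by (auto simp: Q'_def poly_over_smult subfld_closed c_def)
    then obtain u r where *: "P = Q' * u + r" "degree r < degree Q'" "poly_over L u" "poly_over L r"
      using division[OF P_over Q'(1) Q'(2)] False by auto
    have "r \<noteq> 0"
    proof
      assume "r = 0"
      then have P: "P = Q' * u" using * by simp
      then have "degree Q' = 0 \<or> degree u = 0"
        using irr Q'(1) *(3) by (auto simp: irreducible_over_def)
      then have "degree u = 0" using Q' False by simp
      then have "degree P = degree Q'" using P monic
        by (metis add.right_neutral degree_0 degree_mult_eq deg_pos less_irrefl mult_zero_left mult_zero_right)
      then show False using less.prems Q' by simp
    qed
    then obtain A where A: "poly_over L A" "poly A z * poly r z = 1"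
      using less.hyps[of r] * Q' less.prems by (metis order.strict_trans)
    have "poly r z = - poly Q' z * poly u z"
      using root *(1) by (simp add: add_eq_0_iff2)
    then have "poly (- smult (inverse c) (A * u)) z * poly Q z = 1"
      using A(2) by (simp add: Q'_def algebra_simps)
    moreover have "poly_over L (- smult (inverse c) (A * u))"
      using A * c L by (intro poly_over_uminus poly_over_smult poly_over_mult) (auto simp: subfld_closed)
    ultimately show ?thesis by blast
  qed
qed

lemma root_degree:
  assumes "poly_over L Q" "degree Q < degree P" "poly Q z = 0"
  shows "Q = 0"
  using inverse_ex[OF assms(1,2)] assms(3) by auto

lemma adjoin_reduced:
  assumes "c \<in> adjoin L z"
  obtains Q where "poly_over L Q" "degree Q < degree P" "c = poly Q z"
proof -
  from assms obtain f where f: "poly_over L f" "c = poly f z" by (auto simp: adjoin_def)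
  obtain u r where "f = P * u + r" "degree r < degree P" "poly_over L u" "poly_over L r"
    using division[OF f(1) P_over monic deg_pos] .
  then show thesis using that[of r] f root by simp
qed

lemma subfld_adjoin: "subfld (adjoin L z)"
proof -
  have "inverse a \<in> adjoin L z" if a: "a \<in> adjoin L z" for a
  proof (cases "a = 0")
    case True
    then show ?thesis using a by simp
  next
    case False
    obtain Q where Q: "poly_over L Q" "degree Q < degree P" "a = poly Q z"
      using adjoin_reduced[OF a] .
    then have "Q \<noteq> 0" using False by auto
    then obtain A where "poly_over L A" "poly A z * poly Q z = 1"
      using inverse_ex[OF Q(1,2)] by blast
    then have "inverse a = poly A z" using Q by (metis inverse_unique mult.commute)
    then show ?thesis unfolding adjoin_def using \<open>poly_over L A\<close> by blast
  qed
  moreover have "0 \<in> adjoin L z" "1 \<in> adjoin L z"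
    unfolding adjoin_def using L by (auto intro!: exI[of _ "[:_:]"] poly_over_const simp: subfld_closed)
  moreover have "a + b \<in> adjoin L z \<and> a * b \<in> adjoin L z" if ab: "a \<in> adjoin L z" "b \<in> adjoin L z" for a b
  proof -
    from ab obtain f h where "poly_over L f" "a = poly f z" "poly_over L h" "b = poly h z"
      by (auto simp: adjoin_def)
    then show ?thesis unfolding adjoin_def using L
      by (auto intro: exI[of _ "f + h"] exI[of _ "f * h"] simp: poly_over_add poly_over_mult)
  qed
  moreover have "- a \<in> adjoin L z" if a: "a \<in> adjoin L z" for a
  proof -
    from a obtain f where "poly_over L f" "a = poly f z" by (auto simp: adjoin_def)
    then show ?thesis unfolding adjoin_def using L
      by (auto intro!: exI[of _ "- f"] simp: poly_over_uminus)
  qed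
  ultimately show ?thesis by (simp add: subfld_def)
qed

lemma subset_adjoin: "L \<subseteq> adjoin L z"
proof
  fix c assume "c \<in> L"
  then show "c \<in> adjoin L z"
    unfolding adjoin_def using L by (auto intro!: exI[of _ "[:c:]"] poly_over_const)
qed

lemma generator_in_adjoin: "z \<in> adjoin L z"
  unfolding adjoin_def using L by (auto intro!: exI[of _ "[:0, 1:]"] poly_over_X)

text \<open>
  On the line \<open>q j + m i = w\<close> one has \<open>q (t j + s i) = t w + i\<close>, so that \<open>z^(t j + s i)\<close> is a constant
  times \<open>z^(i div q)\<close>.
\<close>
lemma line_exponent:
  fixes q m s t w i j :: nat
  assumes "q > 0" "q * s = t * m + 1" "q * j + m * i = w"
  shows "t * j + s * i = (t * w + i mod q) div q + i div q"
proof -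
  have "q * (t * j + s * i) = t * (q * j) + (q * s) * i" by (simp add: algebra_simps)
  also have "\<dots> = t * w + i" by (simp add: assms(2) assms(3)[symmetric] algebra_simps)
  also have "\<dots> = t * w + i mod q + q * (i div q)" by (simp add: algebra_simps)
  finally have "t * j + s * i = (t * w + i mod q + q * (i div q)) div q"
    using assms(1) by (metis nonzero_mult_div_cancel_left not_gr_zero)
  also have "\<dots> = i div q + (t * w + i mod q) div q"
    by (rule div_mult_self2) (use assms(1) in simp)
  finally show ?thesis by (simp only: add.commute)
qed

text \<open>Two lattice points of the line differ by a multiple of (q, -m), because q and m are
  coprime.\<close>

lemma line_residue:
  fixes q m w i j i' j' :: nat
  assumes "coprime q m" "q * j + m * i = w" "q * j' + m * i' = w"
  shows "i mod q = i' mod q"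
proof -
  have "int m * (int i - int i') = int q * (int j' - int j)"
    using assms(2,3) by (simp add: algebra_simps flip: of_nat_mult of_nat_add)
  then have "int q dvd int i - int i'"
    using assms(1) by (metis coprime_dvd_mult_right_iff coprime_int_iff dvd_triv_left)
  then have "int i mod int q = int i' mod int q" by (simp add: mod_eq_dvd_iff)
  then show ?thesis by (simp flip: zmod_int)
qed

text \<open>All exponents i in the sum are congruent modulo q, so \<open>i div q\<close> determines
  i, and up to one common power of z the sum is a polynomial in z over L of degree below deg P. Such
  a relation is trivial. Both \<open>small_next\<close> and \<open>independent_next\<close> rest on
  this.\<close>

lemma line_sum_eq_0:
  fixes q m s t w :: nat and j :: "nat \<Rightarrow> nat"
  assumes "z \<noteq> 0" "coprime q m" "q > 0" "q * s = t * m + 1" "finite I"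
    and I: "\<And>i. i \<in> I \<Longrightarrow> i < q * degree P" "\<And>i. i \<in> I \<Longrightarrow> \<kappa> i \<in> L" "\<And>i. i \<in> I \<Longrightarrow> q * j i + m * i = w"
    and sum: "(\<Sum>i\<in>I. \<kappa> i * z ^ (t * j i + s * i)) = 0" and "i \<in> I"
  shows "\<kappa> i = 0"
proof -
  define C where "C = (t * w + i mod q) div q"
  define Q where "Q = (\<Sum>l\<in>I. monom (\<kappa> l) (l div q))"
  have res: "l mod q = i mod q" if "l \<in> I" for l
    using line_residue[OF assms(2) I(3)[OF that] I(3)[OF \<open>i \<in> I\<close>]] .
  have "z ^ (t * j l + s * l) = z ^ C * z ^ (l div q)" if "l \<in> I" for l
    unfolding line_exponent[OF assms(3,4) I(3)[OF that]] C_def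
    by (simp add: res[OF that] power_add)
  then have "(\<Sum>l\<in>I. \<kappa> l * z ^ (t * j l + s * l)) = (\<Sum>l\<in>I. z ^ C * (\<kappa> l * z ^ (l div q)))"
    by (intro sum.cong) auto
  also have "\<dots> = z ^ C * poly Q z"
    by (simp add: Q_def poly_sum poly_monom sum_distrib_left)
  finally have "poly Q z = 0" using sum \<open>z \<noteq> 0\<close> by simp
  moreover have "poly_over L Q"
    using L I(2) by (auto simp: Q_def poly_over_def coeff_sum intro!: subfld_closed)
  moreover have "degree Q < degree P"
  proof -
    have "degree Q \<le> degree P - 1"
      unfolding Q_def
    proof (rule degree_sum_le[OF assms(5)])
      fix l assume "l \<in> I"
      then have "l div q < degree P" using I(1) by (simp add: less_mult_imp_div_less mult.commute)
      then show "degree (monom (\<kappa> l) (l div q)) \<le> degree P - 1"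
        using degree_monom_le[of "\<kappa> l" "l div q"] by linarith
    qed
    then show ?thesis using deg_pos by linarith
  qed
  ultimately have "Q = 0" by (intro root_degree)
  then have "0 = coeff Q (i div q)" by simp
  also have "\<dots> = (\<Sum>l\<in>I. if l = i then \<kappa> l else 0)"
    unfolding Q_def coeff_sum
  proof (rule sum.cong)
    fix l assume "l \<in> I"
    then have "l div q = i div q \<longleftrightarrow> l = i"
      using res by (metis div_mult_mod_eq)
    then show "coeff (monom (\<kappa> l) (l div q)) (i div q) = (if l = i then \<kappa> l else 0)"
      by simp
  qed simp
  also have "\<dots> = \<kappa> i" using assms(5) \<open>i \<in> I\<close> by simp
  finally show ?thesis by simp
qed

end

section \<open>Unit-like and linear leading forms\<close>

definition ulead :: "'b::field fps poly \<Rightarrow> nat \<Rightarrow> 'b \<Rightarrow> bool" where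
  "ulead H v c \<longleftrightarrow> (\<forall>i. \<forall>j<v. coeff H i $ j = 0) \<and> coeff H 0 $ v = c"

text \<open>For c nonzero, H / x^v at x = 0 has a simple zero at y = 0.\<close>

definition ylead :: "'b::field fps poly \<Rightarrow> nat \<Rightarrow> 'b \<Rightarrow> bool" where
  "ylead H v c \<longleftrightarrow> (\<forall>i. \<forall>j<v. coeff H i $ j = 0) \<and> coeff H 0 $ v = 0 \<and> coeff H 1 $ v = c"

lemma coeff_pcompose_linear:
  fixes p :: "'b::field poly"
  shows "coeff (pcompose p [:c, 1:]) 0 = poly p c"
    and "coeff (pcompose p [:c, 1:]) (Suc 0) = poly (pderiv p) c"
proof -
  show "coeff (pcompose p [:c, 1:]) 0 = poly p c"
    by (simp flip: poly_0_coeff_0 add: poly_pcompose)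
  have "coeff (pcompose p [:c, 1:]) (Suc 0) = coeff (pderiv (pcompose p [:c, 1:])) 0"
    by (simp add: coeff_pderiv)
  also have "\<dots> = poly (pderiv p) c"
    by (simp flip: poly_0_coeff_0 add: pderiv_pcompose poly_pcompose pderiv_pCons)
  finally show "coeff (pcompose p [:c, 1:]) (Suc 0) = poly (pderiv p) c" .
qed

lemma ulead_swap: "ulead H n c \<longleftrightarrow> (\<exists>p. lead (swap_xy H) n p \<and> coeff p 0 = c)"
  by (auto simp: ulead_def lead_def poly_eq_iff simp flip: coeff_swap_xy)

lemma ylead_swap: "ylead H n c \<longleftrightarrow> (\<exists>p. lead (swap_xy H) n p \<and> coeff p 0 = 0 \<and> coeff p 1 = c)"
  by (auto simp: ylead_def lead_def poly_eq_iff simp flip: coeff_swap_xy)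

lemma vx_lead:
  assumes "lead (swap_xy H) n p" "p \<noteq> 0"
  shows "vx H = enat n"
proof -
  have z: "coeff H i $ j = 0" if "j < n" for i j
    using assms(1) that by (metis lead_def coeff_swap_xy coeff_0)
  have c: "coeff H i $ n = coeff p i" for i
    using assms(1) by (metis lead_def coeff_swap_xy)
  obtain i where i: "coeff p i \<noteq> 0" using assms(2) by (auto simp: poly_eq_iff)
  show ?thesis
    unfolding vx_def
  proof (rule antisym)
    have "subdegree (coeff H i) \<le> n" using i c by (intro subdegree_leI) simp
    moreover have "coeff H i \<noteq> 0" using i c by (metis fps_zero_nth)
    ultimately show "(INF i. if coeff H i = 0 then \<infinity> else enat (subdegree (coeff H i))) \<le> enat n"
      by (intro INF_lower2[of i]) auto
    show "enat n \<le> (INF i. if coeff H i = 0 then \<infinity> else enat (subdegree (coeff H i)))"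
      by (intro INF_greatest) (auto intro!: subdegree_geI z)
  qed
qed

lemma trailing_coeff_0: "coeff p 0 \<noteq> 0 \<Longrightarrow> trailing_coeff p = coeff p 0"
  unfolding trailing_coeff_def by (subst Least_equality[of _ 0]) auto

lemma trailing_coeff_1: "coeff p 0 = 0 \<Longrightarrow> coeff p (Suc 0) \<noteq> 0 \<Longrightarrow> trailing_coeff p = coeff p (Suc 0)"
  unfolding trailing_coeff_def
  by (subst Least_equality[of _ "Suc 0"]) (auto simp: Suc_le_eq intro!: Nat.gr0I)

lemma ulead_vx:
  assumes "ulead H v c" "c \<noteq> 0"
  shows "vx H = enat v" "trailing_coeff (map_poly (\<lambda>a. a $ v) H) = c"
proof -
  obtain p where p: "lead (swap_xy H) v p" "coeff p 0 = c" using assms by (auto simp: ulead_swap)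
  show "vx H = enat v" by (rule vx_lead[OF p(1)]) (use p assms in auto)
  show "trailing_coeff (map_poly (\<lambda>a. a $ v) H) = c"
    by (subst trailing_coeff_0) (use assms in \<open>auto simp: coeff_map_poly ulead_def\<close>)
qed

lemma ylead_vx:
  assumes "ylead H v c" "c \<noteq> 0"
  shows "vx H = enat v" "trailing_coeff (map_poly (\<lambda>a. a $ v) H) = c"
proof -
  obtain p where p: "lead (swap_xy H) v p" "coeff p 1 = c" using assms by (auto simp: ylead_swap)
  show "vx H = enat v" by (rule vx_lead[OF p(1)]) (use p assms in auto)
  show "trailing_coeff (map_poly (\<lambda>a. a $ v) H) = c"
    by (subst trailing_coeff_1) (use assms in \<open>auto simp: coeff_map_poly ylead_def\<close>)
qed

text \<open>As m > 0, every term that involves y and has x-order at least v has weight above q v. A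
  unit-like polynomial therefore looks constant in every such grading.\<close>

lemma lead_weighted_ulead:
  assumes "q > 0" "m > 0" "ulead H v c"
  shows "lead (weighted q m H) (q * v) [:c:]"
proof (rule lead_weightedI[OF assms(1)])
  fix i j
  show "q * v \<le> q * j + m * i" if "coeff H i $ j \<noteq> 0"
    using that assms by (metis ulead_def mult_le_mono2 not_le trans_le_add1)
  show "coeff [:c:] i = coeff H i $ j" if e: "q * j + m * i = q * v"
  proof (cases i)
    case 0
    then show ?thesis using e assms by (simp add: ulead_def)
  next
    case (Suc n)
    then have "j < v" using e assms by (metis add_gr_0 less_add_same_cancel1 mult_less_cancel1 nat_0_less_mult_iff zero_less_Suc)
    then show ?thesis using Suc assms by (simp add: ulead_def)
  qed
next
  fix i assume "coeff [:c:] i \<noteq> 0"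
  then have "i = 0" by (auto simp: coeff_pCons split: nat.splits)
  then show "\<exists>j. q * j + m * i = q * v" by auto
qed

text \<open>Terms in y^i with i > 1 exceed the weight of the linear term because m > 0. Only pure
  powers of x can interfere, and these the hypotheses control; s is zero if the line has no lattice
  point in column 0.\<close>

lemma lead_weighted_linear:
  assumes "q > 0" "m > 0" "ylead H v c" and ge: "\<And>j. coeff H 0 $ j \<noteq> 0 \<Longrightarrow> q * v + m \<le> q * j"
    and s: "\<And>j. q * j = q * v + m \<Longrightarrow> s = coeff H 0 $ j" "s \<noteq> 0 \<Longrightarrow> \<exists>j. q * j = q * v + m"
  shows "lead (weighted q m H) (q * v + m) [:s, c:]"
proof (rule lead_weightedI[OF assms(1)])
  fix i j
  have low: "v \<le> j" if "coeff H i $ j \<noteq> 0"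
    using that assms(3) by (metis ylead_def not_le)
  show "q * v + m \<le> q * j + m * i" if nz: "coeff H i $ j \<noteq> 0"
    using ge[of j] nz low[OF nz] by (cases i) (auto simp: add_mono)
  show "coeff [:s, c:] i = coeff H i $ j" if e: "q * j + m * i = q * v + m"
  proof -
    consider "i = 0" | "i = 1" | "i \<ge> 2" by linarith
    then show ?thesis
    proof cases
      case 1
      then show ?thesis using e s(1)[of j] by simp
    next
      case 2
      then show ?thesis using e assms by (simp add: ylead_def)
    next
      case 3
      then have "m * 2 \<le> m * i" by simp
      then have "q * j < q * v" using e assms(2) by linarith
      then have "coeff H i $ j = 0" using low by (metis mult_le_mono2 not_le)
      moreover have "coeff [:s, c:] i = 0" using 3 by (intro coeff_eq_0) (auto simp: degree_pCons_eq_if)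
      ultimately show ?thesis by simp
    qed
  qed
  show "\<exists>j. q * j + m * i = q * v + m" if "coeff [:s, c:] i \<noteq> 0"
  proof -
    have "i = 0 \<and> s \<noteq> 0 \<or> i = 1" using that by (auto simp: coeff_pCons split: nat.splits)
    then show ?thesis using s(2) by auto
  qed
qed

lemma lead_power_sum:
  assumes "finite I" "\<And>i. i \<in> I \<Longrightarrow> lead (f i) (u i) (p i)" "lead X V r" "\<And>i. i \<in> I \<Longrightarrow> n \<le> u i + i * V"
  shows "lead (\<Sum>i\<in>I. f i * X ^ i) n (\<Sum>i\<in>I. if u i + i * V = n then p i * r ^ i else 0)"
proof (rule lead_sum)
  fix i assume i: "i \<in> I"
  have l: "lead (f i * X ^ i) (u i + i * V) (p i * r ^ i)"
    by (intro lead_mult lead_power assms i)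
  show "lead (f i * X ^ i) n (if u i + i * V = n then p i * r ^ i else 0)"
    using l lead_weaken[OF l] assms(4)[OF i] by (auto simp: le_less)
qed

text \<open>The sum over J may still vanish. The callers exclude this by a coefficient to which only
  one index of J contributes.\<close>

lemma lead_power_sum_min:
  assumes "finite I" "I \<noteq> {}" "\<And>i. i \<in> I \<Longrightarrow> lead (f i) (u i) (p i)" "lead X V r"
  shows "\<exists>M J. J \<noteq> {} \<and> J = {i\<in>I. u i + i * V = M} \<and> (\<forall>i\<in>I. M \<le> u i + i * V)
    \<and> lead (\<Sum>i\<in>I. f i * X ^ i) M (\<Sum>i\<in>J. p i * r ^ i)"
proof -
  define M where "M = Min ((\<lambda>i. u i + i * V) ` I)"
  have M: "M \<le> u i + i * V" if "i \<in> I" for i using that assms(1) by (simp add: M_def)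
  have "M \<in> (\<lambda>i. u i + i * V) ` I" unfolding M_def by (rule Min_in) (use assms in auto)
  then have ne: "{i\<in>I. u i + i * V = M} \<noteq> {}" by auto
  have "lead (\<Sum>i\<in>I. f i * X ^ i) M (\<Sum>i | i \<in> I \<and> u i + i * V = M. p i * r ^ i)"
    unfolding sum.inter_filter[OF assms(1)] by (rule lead_power_sum[OF assms(1,3,4) M])
  then show ?thesis
    by (intro exI[of _ M] exI[of _ "{i\<in>I. u i + i * V = M}"] conjI ne refl ballI M)
qed

section \<open>Expansions in powers of a monic polynomial\<close>

lemma monic_expansion:
  fixes G :: "'c::idom poly"
  assumes "lead_coeff p = 1" "degree p > 0" "G = 0 \<or> degree G < n * degree p"
  obtains a where "\<And>i. degree (a i) < degree p" "G = (\<Sum>i<n. a i * p ^ i)"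
proof -
  have "\<exists>a. (\<forall>i. degree (a i) < degree p) \<and> G = (\<Sum>i<n. a i * p ^ i)"
    using assms(3)
  proof (induction n arbitrary: G)
    case 0
    then show ?case using assms(2) by (intro exI[of _ "\<lambda>_. 0"]) auto
  next
    case (Suc n)
    obtain u r where ur: "G = p * u + r" "degree r < degree p"
      using monic_division[of p UNIV G] assms by auto
    have "u = 0 \<or> degree u < n * degree p"
    proof (rule ccontr)
      assume c: "\<not> ?thesis"
      then have d: "degree (p * u) = degree p + degree u" using assms by (subst degree_mult_eq) auto
      then have "degree G = degree p + degree u" using ur by (subst ur(1), subst degree_add_eq_left) auto
      moreover have "G \<noteq> 0" using calculation assms(2) by auto
      ultimately show False using Suc.prems c by auto
    qed
    then obtain a where a: "\<forall>i. degree (a i) < degree p" "u = (\<Sum>i<n. a i * p ^ i)"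
      using Suc.IH by blast
    define b where "b i = (case i of 0 \<Rightarrow> r | Suc k \<Rightarrow> a k)" for i
    have "G = (\<Sum>i<Suc n. b i * p ^ i)"
      unfolding ur(1) a(2) sum.lessThan_Suc_shift
      by (simp add: b_def sum_distrib_left algebra_simps)
    moreover have "\<forall>i. degree (b i) < degree p"
      using a ur by (auto simp: b_def split: nat.splits)
    ultimately show ?case by blast
  qed
  then show thesis using that by blast
qed

text \<open>Induction on the exponent of x: modulo x the polynomial G is y^N, so the coefficient of
  y^(i+N) in the product is that of y^i in W plus contributions of smaller x-order, and it vanishes
  on the right-hand side.\<close>

lemma weierstrass_quotient_0:
  assumes G: "weierstrass G" and W: "fps_of_poly G * W = fps_of_poly R" and R: "degree R < degree G"
  shows "W = 0"
proof -
  have "\<forall>i. W $ i $ n = 0" for n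
  proof (induction n rule: less_induct)
    case (less n)
    show ?case
    proof
      fix i
      let ?N = "degree G"
      have z: "(coeff G l * W $ (i + ?N - l)) $ n = 0" if "l \<noteq> ?N" for l
      proof (cases "l < ?N")
        case True
        then have "coeff G l $ 0 = 0" using G by (simp add: weierstrass_def)
        then have "coeff G l $ j * W $ (i + ?N - l) $ (n - j) = 0" if "j \<le> n" for j
          using less.IH[of "n - j"] that by (cases "j = 0") auto
        then show ?thesis unfolding fps_mult_nth by (intro sum.neutral) auto
      next
        case False
        then show ?thesis using that by (simp add: coeff_eq_0)
      qed
      have "0 = fps_of_poly R $ (i + ?N) $ n" using R by (simp add: coeff_eq_0)
      also have "\<dots> = (\<Sum>l=0..i + ?N. (coeff G l * W $ (i + ?N - l)) $ n)"
        by (simp add: W[symmetric] fps_mult_nth[of "fps_of_poly G"] fps_sum_nth)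
      also have "\<dots> = (\<Sum>l=0..i + ?N. if l = ?N then W $ i $ n else 0)"
        using G by (intro sum.cong) (auto simp: z weierstrass_def)
      finally show "W $ i $ n = 0" by simp
    qed
  qed
  then show ?thesis by (simp add: fps_eq_iff)
qed

text \<open>
  By this lemma the unit \<open>V\<close> of a tower step is a polynomial in \<open>y\<close>, so that all pullbacks and their
  factors stay in \<open>K[[x]][y]\<close>.
\<close>
lemma weierstrass_division:
  assumes G: "weierstrass G" "degree G > 0"
    and Q: "fps_of_poly Q = fps_const (fps_X ^ M) * fps_of_poly G * V"
  obtains U where "Q = [:fps_X ^ M:] * (G * U)" "coeff U 0 = V $ 0"
proof -
  define Q' where "Q' = map_poly (\<lambda>a. fps_shift M a) Q"
  have nth: "coeff Q i = fps_X ^ M * (fps_of_poly G * V) $ i" for i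
    using arg_cong[OF Q, of "\<lambda>f. f $ i"] by (simp add: mult.assoc)
  have Q'nth: "coeff Q' i = (fps_of_poly G * V) $ i" for i
    unfolding Q'_def
    by (subst coeff_map_poly) (simp_all add: nth, intro fps_ext, simp add: fps_X_power_mult_nth)
  have QQ': "Q = [:fps_X ^ M:] * Q'"
    by (rule poly_eqI) (simp add: Q'nth nth)
  have Q': "fps_of_poly Q' = fps_of_poly G * V"
    by (rule fps_ext) (simp add: Q'nth)
  obtain u r where ur: "Q' = G * u + r" "degree r < degree G"
    using monic_division[of G UNIV Q'] G by (auto simp: weierstrass_def)
  have "fps_of_poly G * (V - fps_of_poly u) = fps_of_poly r"
    using Q' unfolding ur(1) by (simp add: fps_of_poly_add fps_of_poly_mult algebra_simps)
  then have "V - fps_of_poly u = 0"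
    by (rule weierstrass_quotient_0[OF G(1) _ ur(2)])
  then have "V = fps_of_poly u" by simp
  moreover from this have "fps_of_poly Q' = fps_of_poly (G * u)" using Q' by (simp add: fps_of_poly_mult)
  ultimately show thesis
    using that[of u] QQ' by (simp add: fps_of_poly_eq_iff)
qed

section \<open>Newton polygons and supporting lines\<close>

lemma fls_nth_fls_filter [simp]: "fls_filter P f $$ n = (if P n then f $$ n else 0)"
  by transfer simp

lemma coeff_restrict_terms:
  "coeff (restrict_terms E A) i = fls_filter (\<lambda>j. (real i, real_of_int j) \<in> E) (coeff A i)"
proof (cases "i \<le> degree A")
  case True
  then show ?thesis by (simp add: restrict_terms_def coeff_sum)
next
  case False
  then have "coeff A i = 0" by (simp add: coeff_eq_0)
  then show ?thesis using False by (auto simp add: restrict_terms_def coeff_sum intro!: fls_eqI)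
qed

lemma restrict_terms_cong:
  assumes "\<And>i j. coeff A i $$ j \<noteq> 0 \<Longrightarrow> (real i, real_of_int j) \<in> E \<longleftrightarrow> (real i, real_of_int j) \<in> E'"
  shows "restrict_terms E A = restrict_terms E' A"
  using assms by (intro poly_eqI fls_eqI) (auto simp: coeff_restrict_terms)

definition support_line :: "nat \<Rightarrow> nat \<Rightarrow> nat \<Rightarrow> (real \<times> real) set" where
  "support_line q m n = {(a, b). real q * b + real m * a = real m * real n}"

definition above_line :: "nat \<Rightarrow> nat \<Rightarrow> nat \<Rightarrow> 'b::field fls poly \<Rightarrow> bool" where
  "above_line q m n A \<longleftrightarrow>
    (\<forall>i j. coeff A i $$ j \<noteq> 0 \<longrightarrow> real m * real n \<le> real q * real_of_int j + real m * real i)"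

abbreviation newton_points :: "'b::field fls poly \<Rightarrow> (real \<times> real) set" where
  "newton_points A \<equiv> {(real i, real_of_int (fls_subdegree (coeff A i))) | i. coeff A i \<noteq> 0}"

lemma finite_newton_points: "finite (newton_points A)"
proof -
  have "newton_points A \<subseteq> (\<lambda>i. (real i, real_of_int (fls_subdegree (coeff A i)))) ` {..degree A}"
    by (auto intro!: le_degree)
  then show ?thesis by (rule finite_subset) simp
qed

lemma convex_hull_above:
  assumes "\<And>a b. (a, b) \<in> S \<Longrightarrow> c \<le> u * b + v * a" "(a, b) \<in> convex hull S"
  shows "c \<le> u * b + v * (a::real)"
proof -
  have "convex hull S \<subseteq> {x. c \<le> inner (v, u) x}"
  proof (rule hull_minimal)
    show "S \<subseteq> {x. c \<le> inner (v, u) x}"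
      using assms(1) by (auto simp: inner_prod_def add.commute)
  qed (rule convex_halfspace_ge)
  then show ?thesis using assms(2) by (auto simp: inner_prod_def add.commute)
qed

text \<open>Compactness of the hull gives a lowest point on each vertical line that meets
  it.\<close>

lemma lower_hull_below:
  assumes "finite S" "(a, b) \<in> S"
  obtains b' where "b' \<le> b" "(a, b') \<in> lower_hull S"
proof -
  let ?C = "convex hull S \<inter> {x. fst x = a}"
  have ab: "(a, b) \<in> ?C" using assms by (simp add: hull_inc)
  have "closed {x::real \<times> real. fst x = a}"
    by (rule closed_Collect_eq) (auto intro!: continuous_intros)
  then have "compact ?C"
    by (intro compact_Int_closed compact_convex_hull finite_imp_compact assms)
  then obtain x where x: "x \<in> ?C" "\<And>y. y \<in> ?C \<Longrightarrow> snd x \<le> snd y"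
    using continuous_attains_inf[of ?C snd] ab by (fastforce intro!: continuous_intros)
  obtain b' where "x = (a, b')" using x(1) by (cases x) auto
  then have "(a, b') \<in> lower_hull S" "b' \<le> b"
    using x ab unfolding lower_hull_def by fastforce+
  then show thesis using that by blast
qed

lemma on_line_in_lower_hull:
  assumes "\<And>a b. (a, b) \<in> S \<Longrightarrow> c \<le> u * b + v * a" "(a, b) \<in> convex hull S" "u * b + v * a = c" "u > 0"
  shows "(a, b) \<in> lower_hull S"
proof -
  have "b \<le> b'" if "(a, b') \<in> convex hull S" for b'
  proof -
    have "c \<le> u * b' + v * a" using convex_hull_above[OF assms(1) that] by blast
    then have "u * b \<le> u * b'" using assms(3) by linarith
    then show ?thesis using assms(4) by simp
  qed
  then show ?thesis using assms(2) by (auto simp: lower_hull_def)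
qed

lemma above_line_newton_points:
  assumes "above_line q m n A" "(a, b) \<in> newton_points A"
  shows "real m * real n \<le> real q * b + real m * a"
  using assms by (auto simp: above_line_def)

text \<open>A term on a supporting line is the lowest of its column, and no point of the hull lies
  below the line.\<close>

lemma on_line_in_polygon:
  assumes "above_line q m n A" "q > 0" "coeff A i $$ j \<noteq> 0" "(real i, real_of_int j) \<in> support_line q m n"
  shows "(real i, real_of_int j) \<in> newton_points A" "(real i, real_of_int j) \<in> newton_polygon A"
proof -
  have nz: "coeff A i \<noteq> 0" using assms(3) by auto
  have le: "fls_subdegree (coeff A i) \<le> j" using assms(3) by (meson fls_subdegree_leI)
  have "real m * real n \<le> real q * real_of_int (fls_subdegree (coeff A i)) + real m * real i"
    using assms(1) nz unfolding above_line_def by (metis nth_fls_subdegree_nonzero)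
  then have "real q * real_of_int j \<le> real q * real_of_int (fls_subdegree (coeff A i))"
    using assms(4) by (simp add: support_line_def)
  then have "j = fls_subdegree (coeff A i)" using le assms(2) by simp
  then show *: "(real i, real_of_int j) \<in> newton_points A" using nz by auto
  show "(real i, real_of_int j) \<in> newton_polygon A"
    unfolding newton_polygon_def
  proof (rule on_line_in_lower_hull[where u = "real q" and v = "real m" and c = "real m * real n"])
    show "(real i, real_of_int j) \<in> convex hull newton_points A" using * by (simp add: hull_inc)
  qed (use above_line_newton_points[OF assms(1)] assms in \<open>auto simp: support_line_def\<close>)
qed

lemma above_lineI_polygon:
  assumes "newton_polygon A \<subseteq> support_line q m n"
  shows "above_line q m n A"
  unfolding above_line_def
proof (intro allI impI)
  fix i j assume nz: "coeff A i $$ j \<noteq> 0"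
  then have le: "fls_subdegree (coeff A i) \<le> j" by (meson fls_subdegree_leI)
  have "(real i, real_of_int (fls_subdegree (coeff A i))) \<in> newton_points A" using nz by auto
  then obtain b' where b': "b' \<le> real_of_int (fls_subdegree (coeff A i))" "(real i, b') \<in> newton_polygon A"
    unfolding newton_polygon_def by (rule lower_hull_below[OF finite_newton_points])
  then have "real q * b' + real m * real i = real m * real n" using assms by (auto simp: support_line_def)
  moreover have "real q * b' \<le> real q * real_of_int j" using b'(1) le by (intro mult_left_mono) auto
  ultimately show "real m * real n \<le> real q * real_of_int j + real m * real i" by linarith
qed

lemma restrict_terms_straight:
  assumes "newton_polygon A \<subseteq> support_line q m n" "q > 0"
  shows "restrict_terms (newton_polygon A) A = restrict_terms (support_line q m n) A"
  using assms on_line_in_polygon(2)[OF above_lineI_polygon[OF assms(1)] assms(2)]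
  by (intro restrict_terms_cong) auto

lemma restrict_terms_line_polygon:
  assumes "above_line q m n A" "q > 0"
  shows "restrict_terms (support_line q m n) (restrict_terms (newton_polygon A) A)
    = restrict_terms (support_line q m n) A"
  using on_line_in_polygon(2)[OF assms] by (intro poly_eqI fls_eqI) (auto simp: coeff_restrict_terms)

lemma above_line_restrict_terms: "above_line q m n A \<Longrightarrow> above_line q m n (restrict_terms E A)"
  by (auto simp: above_line_def coeff_restrict_terms split: if_splits)

text \<open>The segment between the two end terms bounds the lower hull from above in every column
  from 0 to n, and the line bounds it from below.\<close>

lemma polygon_on_line:
  assumes "above_line q m n A" "q > 0" "n > 0" "\<And>i. coeff A i \<noteq> 0 \<Longrightarrow> i \<le> n"
    and "coeff A n $$ 0 \<noteq> 0" "coeff A 0 $$ j0 \<noteq> 0" "(0, real_of_int j0) \<in> support_line q m n"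
  shows "newton_polygon A \<subseteq> support_line q m n"
proof
  fix x assume x: "x \<in> newton_polygon A"
  obtain a b where ab: "x = (a, b)" by (cases x)
  have hull: "(a, b) \<in> convex hull newton_points A"
    and min: "\<And>b'. (a, b') \<in> convex hull newton_points A \<Longrightarrow> b \<le> b'"
    using x by (auto simp: ab newton_polygon_def lower_hull_def)
  have lo: "real m * real n \<le> real q * b + real m * a"
    using convex_hull_above[OF above_line_newton_points[OF assms(1)] hull] .
  have "0 \<le> 0 * b + 1 * a"
    by (rule convex_hull_above[OF _ hull]) auto
  then have a0: "0 \<le> a" by simp
  have "- real n \<le> 0 * b + (- 1) * a"
    by (rule convex_hull_above[OF _ hull]) (use assms(4) in auto)
  then have an: "a \<le> real n" by simp
  have p0: "(0, real_of_int j0) \<in> convex hull newton_points A"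
    using on_line_in_polygon(1)[of q m n A 0 j0] assms by (intro hull_inc) auto
  have p1: "(real n, 0) \<in> convex hull newton_points A"
    using on_line_in_polygon(1)[of q m n A n 0] assms by (intro hull_inc) (auto simp: support_line_def)
  define u where "u = a / real n"
  have u: "0 \<le> u" "u \<le> 1" using a0 an assms(3) by (auto simp: u_def)
  have "(1 - u) *\<^sub>R (0, real_of_int j0) + u *\<^sub>R (real n, 0) \<in> convex hull newton_points A"
    by (rule convexD_alt[OF convex_convex_hull p0 p1 u])
  then have "(a, (1 - u) * real_of_int j0) \<in> convex hull newton_points A"
    using assms(3) by (simp add: u_def)
  then have "b \<le> (1 - u) * real_of_int j0" by (rule min)
  then have "real q * b \<le> real q * ((1 - u) * real_of_int j0)" by (intro mult_left_mono) auto
  also have "\<dots> = (1 - u) * (real q * real_of_int j0)" by simp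
  also have "\<dots> = (1 - u) * (real m * real n)" using assms(7) by (simp add: support_line_def)
  also have "\<dots> = real m * real n - real m * a" using assms(3) by (simp add: u_def algebra_simps)
  finally show "x \<in> support_line q m n" using lo by (simp add: ab support_line_def)
qed

text \<open>The term at (i0, j0) makes the line carry an edge of positive length at (n, 0): a
  segment from (n, 0) inside the polygon cannot leave the line, and a segment on the line between
  terms stays in the lower hull.\<close>

lemma restrict_terms_lowest_edge:
  assumes "above_line q m n A" "q > 0" "\<And>i. coeff A i \<noteq> 0 \<Longrightarrow> i \<le> n"
    and "coeff A n $$ 0 \<noteq> 0" "i0 < n" "coeff A i0 $$ j0 \<noteq> 0" "(real i0, real_of_int j0) \<in> support_line q m n"
  shows "restrict_terms (lowest_edge n (newton_polygon A)) A = restrict_terms (support_line q m n) A"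
proof (rule restrict_terms_cong)
  fix i j assume nz: "coeff A i $$ j \<noteq> 0"
  let ?C = "convex hull newton_points A"
  have i: "i \<le> n" using nz assms(3) by force
  have lo: "real m * real n \<le> real q * real_of_int j + real m * real i"
    using assms(1) nz by (simp add: above_line_def)
  have p0: "(real i0, real_of_int j0) \<in> ?C"
    using on_line_in_polygon(1)[of q m n A i0 j0] assms by (intro hull_inc) auto
  have p1: "(real n, 0) \<in> ?C"
    using on_line_in_polygon(1)[of q m n A n 0] assms by (intro hull_inc) (auto simp: support_line_def)
  show "(real i, real_of_int j) \<in> lowest_edge n (newton_polygon A) \<longleftrightarrow> (real i, real_of_int j) \<in> support_line q m n"
  proof
    assume "(real i, real_of_int j) \<in> lowest_edge n (newton_polygon A)"
    then have seg: "closed_segment (real n, 0) (real i, real_of_int j) \<subseteq> newton_polygon A"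
      by (simp add: lowest_edge_def)
    have min: "b \<le> b'" if "(a, b) \<in> closed_segment (real n, 0) (real i, real_of_int j)" "(a, b') \<in> ?C" for a b b'
      using that seg by (auto simp: newton_polygon_def lower_hull_def)
    show "(real i, real_of_int j) \<in> support_line q m n"
    proof (cases "i = n")
      case True
      have "real_of_int j \<le> 0" by (rule min[of "real i"]) (use True p1 in auto)
      then have "real q * real_of_int j \<le> 0" by (simp add: mult_nonneg_nonpos)
      then show ?thesis using lo True by (simp add: support_line_def)
    next
      case False
      then have il: "i < n" using i by simp
      \<comment> \<open>Above the abscissa a both segments, to (i, j) and to (i0, j0), have a point.
        The first one is on the lower hull, hence not above the second; u and v locate the two
        points.\<close>
      define a where "a = max (real i) (real i0)"
      have a: "real i \<le> a" "real i0 \<le> a" "a < real n" using il assms(5) by (auto simp: a_def)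
      define u where "u = (real n - a) / (real n - real i)"
      define v where "v = (real n - a) / (real n - real i0)"
      have u: "0 < u" "u \<le> 1" "u * (real n - real i) = real n - a" using a il by (auto simp: u_def field_simps)
      have v: "0 \<le> v" "v \<le> 1" "v * (real n - real i0) = real n - a" using a assms(5) by (auto simp: v_def field_simps)
      have su: "(1 - u) *\<^sub>R (real n, 0) + u *\<^sub>R (real i, real_of_int j) \<in> closed_segment (real n, 0) (real i, real_of_int j)"
        using u by (auto simp: closed_segment_def)
      have s: "(a, u * real_of_int j) \<in> closed_segment (real n, 0) (real i, real_of_int j)"
      proof -
        have "(1 - u) * real n + u * real i = a" using u(3) by (simp add: algebra_simps)
        with su show ?thesis by simp
      qed
      have sv: "(1 - v) *\<^sub>R (real n, 0) + v *\<^sub>R (real i0, real_of_int j0) \<in> ?C"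
        by (rule convexD_alt[OF convex_convex_hull p1 p0]) (use v in auto)
      have "(a, v * real_of_int j0) \<in> ?C"
      proof -
        have "(1 - v) * real n + v * real i0 = a" using v(3) by (simp add: algebra_simps)
        with sv show ?thesis by simp
      qed
      then have "u * real_of_int j \<le> v * real_of_int j0" using min s by blast
      then have "real q * (u * real_of_int j) \<le> real q * (v * real_of_int j0)" by (intro mult_left_mono) auto
      also have "\<dots> = v * (real q * real_of_int j0)" by simp
      also have "real q * real_of_int j0 = real m * (real n - real i0)" using assms(7) by (simp add: support_line_def algebra_simps)
      also have "v * (real m * (real n - real i0)) = real m * (v * (real n - real i0))" by simp
      also have "\<dots> = u * (real m * (real n - real i))" unfolding v u(3)[symmetric] by simp
      finally have "u * (real q * real_of_int j) \<le> u * (real m * (real n - real i))" by (simp add: algebra_simps)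
      then have "real q * real_of_int j \<le> real m * (real n - real i)" using u(1) by simp
      then show ?thesis using lo by (simp add: support_line_def algebra_simps)
    qed
  next
    assume on: "(real i, real_of_int j) \<in> support_line q m n"
    have p2: "(real i, real_of_int j) \<in> ?C"
      using on_line_in_polygon(1)[of q m n A i j] assms nz on by (intro hull_inc) auto
    have "(a, b) \<in> newton_polygon A" if ab: "(a, b) \<in> closed_segment (real n, 0) (real i, real_of_int j)" for a b
      unfolding newton_polygon_def
    proof (rule on_line_in_lower_hull[where u = "real q" and v = "real m" and c = "real m * real n"])
      show "(a, b) \<in> ?C"
        using ab closed_segment_subset[OF p1 p2 convex_convex_hull] by blast
      obtain u where u: "a = (1 - u) * real n + u * real i" "b = u * real_of_int j"
        using ab by (auto simp: closed_segment_def)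
      have "real q * real_of_int j + real m * real i = real m * real n" using on by (simp add: support_line_def)
      then have "u * (real q * real_of_int j + real m * real i) = u * (real m * real n)" by simp
      then show "real q * b + real m * a = real m * real n" unfolding u by (simp add: algebra_simps)
    qed (use above_line_newton_points[OF assms(1)] assms(2) in auto)
    then show "(real i, real_of_int j) \<in> lowest_edge n (newton_polygon A)"
      by (auto simp: lowest_edge_def)
  qed
qed

lemma coeff_to_fls [simp]: "coeff (to_fls H) i = fps_to_fls (coeff H i)"
  by (simp add: to_fls_def coeff_map_poly)

lemma above_line_to_fls:
  assumes "\<And>i j. coeff H i $ j \<noteq> 0 \<Longrightarrow> m * n \<le> q * j + m * i"
  shows "above_line q m n (to_fls H)"
  unfolding above_line_def
proof (intro allI impI)
  fix i j assume "coeff (to_fls H) i $$ j \<noteq> 0"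
  then have "j \<ge> 0" "coeff H i $ nat j \<noteq> 0" by (auto simp: fps_to_fls_nth split: if_splits)
  then have "real (m * n) \<le> real (q * nat j + m * i)" using assms by (metis of_nat_le_iff)
  then show "real m * real n \<le> real q * real_of_int j + real m * real i" using \<open>j \<ge> 0\<close> by simp
qed

text \<open>The edge at (n, 0) leads to the point (i, v_i) with the least ratio v_i / (n - i). Its
  weights are q = n - i and m = v_i, not reduced to lowest terms; m > 0 since the lower coefficients
  vanish at x = 0.\<close>

lemma exists_edge_weights:
  assumes H: "weierstrass H" "H \<noteq> monom 1 (degree H)"
  obtains q m i j where "q > 0" "m > 0" "\<And>i j. coeff H i $ j \<noteq> 0 \<Longrightarrow> m * degree H \<le> q * j + m * i"
    "i < degree H" "coeff H i $ j \<noteq> 0" "q * j + m * i = m * degree H"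
proof -
  let ?n = "degree H" and ?v = "\<lambda>i. subdegree (coeff H i)"
  define I where "I = {i. i < ?n \<and> coeff H i \<noteq> 0}"
  have lc: "coeff H ?n = 1" using H by (simp add: weierstrass_def)
  have "I \<noteq> {}"
  proof
    assume "I = {}"
    then have "coeff H i = coeff (monom 1 ?n) i" for i using lc
      by (cases i ?n rule: linorder_cases) (auto simp: I_def coeff_eq_0)
    then have "H = monom 1 ?n" by (rule poly_eqI)
    then show False using H by simp
  qed
  moreover have "finite I" by (simp add: I_def)
  ultimately obtain i where i: "i \<in> I" "\<And>l. l \<in> I \<Longrightarrow> real (?v i) / real (?n - i) \<le> real (?v l) / real (?n - l)"
    using ex_min_if_finite[of "(\<lambda>i. real (?v i) / real (?n - i)) ` I"] by (metis (no_types, lifting) finite_imageI image_iff image_is_empty not_less)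
  have i': "i < ?n" "coeff H i \<noteq> 0" using i by (auto simp: I_def)
  have vpos: "?v i > 0"
  proof (rule Nat.gr0I)
    assume "?v i = 0"
    then have "coeff H i $ 0 \<noteq> 0" using i'(2) by (metis nth_subdegree_nonzero)
    then show False using i'(1) H by (simp add: weierstrass_def)
  qed
  have le: "?v i * ?n \<le> (?n - i) * j + ?v i * l" if nz: "coeff H l $ j \<noteq> 0" for l j
  proof -
    consider "l < ?n" | "l = ?n" | "l > ?n" by linarith
    then show ?thesis
    proof cases
      case 1
      then have l: "l \<in> I" using nz by (auto simp: I_def)
      have "real (?v i) * real (?n - l) \<le> real (?v l) * real (?n - i)"
        using i(2)[OF l] i' 1 by (simp add: field_simps)
      then have "?v i * (?n - l) \<le> ?v l * (?n - i)" by (metis of_nat_le_iff of_nat_mult)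
      also have "\<dots> \<le> j * (?n - i)" using nz by (intro mult_right_mono subdegree_leI) auto
      finally have "?v i * ?n - ?v i * l \<le> j * (?n - i)" by (simp add: diff_mult_distrib2)
      then show ?thesis by (simp add: mult.commute)
    next
      case 3
      then have "coeff H l = 0" by (simp add: coeff_eq_0)
      then show ?thesis using nz by simp
    qed simp
  qed
  have "(?n - i) * ?v i + ?v i * i = ?v i * (?n - i + i)" by (simp only: add_mult_distrib2 mult.commute)
  then have eq: "(?n - i) * ?v i + ?v i * i = ?v i * ?n" using i' by simp
  show thesis
    by (rule that[of "?n - i" "?v i" i "?v i"]) (use i' vpos le eq in \<open>auto simp: nth_subdegree_nonzero\<close>)
qed

section \<open>Edge data\<close>

lemma qh_poly_altdef:
  "qh_poly q m P = (\<Sum>i\<le>degree P. monom (fls_const (coeff P i) * fls_X ^ (m * (degree P - i))) (q * i))"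
proof -
  let ?Y = "monom (fls_X powi (- int m)) q :: 'a fls poly"
  have deg: "degree (map_poly (\<lambda>c. [:fls_const c:]) P) = degree P"
    by (rule degree_map_poly) auto
  have c0: "[:fls_const 0:] = (0 :: 'a fls poly)" by simp
  have pw: "?Y ^ i = monom (fls_X powi (- int (m * i))) (q * i)" for i
    by (simp only: monom_power power_int_power' mult.commute[of i]) (simp add: power_int_mult)
  have "qh_poly q m P = (\<Sum>i\<le>degree P. [:fls_const (coeff P i):] * ?Y ^ i * [:fls_X ^ (m * degree P):])"
    unfolding qh_poly_def poly_altdef[of "map_poly _ _"] deg sum_distrib_right
    by (rule sum.cong) (simp_all only: coeff_map_poly[of "\<lambda>c. [:fls_const c:]", OF c0])
  also have "\<dots> = (\<Sum>i\<le>degree P. monom (fls_const (coeff P i) * fls_X ^ (m * (degree P - i))) (q * i))"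
  proof (rule sum.cong)
    fix i assume "i \<in> {..degree P}"
    then have "m * degree P = m * i + m * (degree P - i)" by (simp flip: add_mult_distrib2)
    then have "fls_X powi (- int (m * i)) * fls_X ^ (m * degree P)
        = inverse ((fls_X :: 'a fls) ^ (m * i)) * (fls_X ^ (m * i) * fls_X ^ (m * (degree P - i)))"
      by (simp only: power_add power_int_minus power_int_of_nat)
    also have "\<dots> = fls_X ^ (m * (degree P - i))"
      by (subst mult.assoc[symmetric], subst left_inverse) (simp_all only: power_eq_0_iff fls_X_nonzero mult_1_left simp_thms)
    finally have "fls_X powi (- int (m * i)) * fls_X ^ (m * degree P) = (fls_X :: 'a fls) ^ (m * (degree P - i))" .
    then show "[:fls_const (coeff P i):] * ?Y ^ i * [:fls_X ^ (m * degree P):]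
      = monom (fls_const (coeff P i) * fls_X ^ (m * (degree P - i))) (q * i)"
      unfolding pw by (simp only: mult_pCons_left mult_pCons_right smult_monom mult_ac mult_zero_left mult_zero_right pCons_0_0 add_0_right)
  qed simp
  finally show ?thesis .
qed

lemma coeff_qh_poly:
  assumes "q > 0"
  shows "coeff (qh_poly q m P) (q * i) = fls_const (coeff P i) * fls_X ^ (m * (degree P - i))"
    and "\<not> q dvd l \<Longrightarrow> coeff (qh_poly q m P) l = 0"
  using assms by (auto simp: qh_poly_altdef coeff_sum coeff_eq_0 intro!: sum.neutral)

lemma degree_qh_poly:
  assumes "q > 0" "P \<noteq> 0"
  shows "degree (qh_poly q m P) = q * degree P"
proof (rule antisym)
  show "degree (qh_poly q m P) \<le> q * degree P"
    unfolding qh_poly_altdef by (rule degree_sum_le) (auto intro!: order.trans[OF degree_monom_le])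
  show "q * degree P \<le> degree (qh_poly q m P)"
    by (rule le_degree) (use assms in \<open>simp add: coeff_qh_poly\<close>)
qed

text \<open>The point (n, 0) fixes the constant of the line. If P had no constant term,
  irreducibility would give P = Z and the boundary would be y^n alone, against the second point
  given by \<open>exists_edge_weights\<close>. Hence the edge reaches column 0, and m > 0 follows
  from H(0, 0) = 0.\<close>

lemma edge_data_line:
  assumes e: "edge_data L H q m P N" and L: "subfld L"
    and n: "degree H > 0" and H: "H \<noteq> monom 1 (degree H)"
  shows "degree H = q * degree P * N" "m > 0" "coeff P 0 \<noteq> 0"
    and "\<And>i j. coeff H i $ j \<noteq> 0 \<Longrightarrow> m * degree H \<le> q * j + m * i"
    and "newton_polygon (to_fls H) \<subseteq> support_line q m (degree H)"
    and "\<exists>j. q * j = m * degree H \<and> coeff H 0 $ j \<noteq> 0"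
proof -
  let ?n = "degree H" and ?A = "to_fls H"
  from e have W: "weierstrass H" and q: "q > 0" and P: "lead_coeff P = 1" "irreducible_over L P"
    and bd: "boundary H = qh_poly q m P ^ N"
    by (auto simp: edge_data_def)
  from e obtain c where c: "\<And>a b. (a, b) \<in> newton_polygon ?A \<Longrightarrow> real q * b + real m * a = c"
    unfolding edge_data_def by blast
  have lc: "coeff H ?n = 1" using W by (simp add: weierstrass_def)
  obtain q' m' i' j' where w': "q' > 0" "m' > 0" "\<And>i j. coeff H i $ j \<noteq> 0 \<Longrightarrow> m' * ?n \<le> q' * j + m' * i"
    "i' < ?n" "coeff H i' $ j' \<noteq> 0" "q' * j' + m' * i' = m' * ?n"
    using exists_edge_weights[OF W H] by metis
  have ab': "above_line q' m' ?n ?A" by (rule above_line_to_fls) (use w' in auto)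
  have n_in: "(real ?n, 0) \<in> newton_polygon ?A"
    using on_line_in_polygon(2)[OF ab' w'(1), of ?n 0] lc by (simp add: support_line_def fps_to_fls_nth)
  have "real q' * real j' + real m' * real i' = real m' * real ?n"
    using w'(6) by (metis of_nat_add of_nat_mult)
  then have i'_in: "(real i', real j') \<in> newton_polygon ?A"
    using on_line_in_polygon(2)[OF ab' w'(1), of i' "int j'"] w'(5) by (simp add: support_line_def fps_to_fls_nth)
  have "c = real m * real ?n" using c[OF n_in] by simp
  with c show sub: "newton_polygon ?A \<subseteq> support_line q m ?n" by (auto simp: support_line_def)
  show le: "m * ?n \<le> q * j + m * i" if "coeff H i $ j \<noteq> 0" for i j
  proof -
    have "real m * real ?n \<le> real q * real_of_int (int j) + real m * real i"
      using above_lineI_polygon[OF sub] that unfolding above_line_def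
      by (metis coeff_to_fls fps_to_fls_nth nat_int of_nat_less_0_iff)
    then have "real (m * ?n) \<le> real (q * j + m * i)" by simp
    then show ?thesis by linarith
  qed
  have bdc: "coeff (boundary H) i $$ j = (if (real i, real_of_int j) \<in> newton_polygon ?A then fps_to_fls (coeff H i) $$ j else 0)" for i j
    by (simp add: boundary_def coeff_restrict_terms)
  have "coeff (boundary H) ?n $$ 0 \<noteq> 0" using n_in lc by (simp add: bdc fps_to_fls_nth)
  then have "?n \<le> degree (boundary H)" by (intro le_degree) auto
  moreover have "degree (boundary H) \<le> ?n"
    by (rule degree_le) (auto simp: boundary_def coeff_restrict_terms coeff_eq_0 intro!: fls_eqI)
  moreover have "degree (boundary H) = N * (q * degree P)"
  proof -
    have P0: "P \<noteq> 0" using P by auto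
    have "coeff (qh_poly q m P) (q * degree P) \<noteq> 0" using P coeff_qh_poly(1)[OF q, of m P "degree P"] by simp
    then have "qh_poly q m P \<noteq> 0" by auto
    then show ?thesis unfolding bd by (simp add: degree_power_eq degree_qh_poly[OF q P0])
  qed
  ultimately show nN: "?n = q * degree P * N" by (simp add: mult_ac)
  show P0: "coeff P 0 \<noteq> 0"
  proof
    assume "coeff P 0 = 0"
    then obtain P' where P': "P = [:0, 1:] * P'" using poly_eq_0_iff_dvd[of P 0] by (auto simp: poly_0_coeff_0 dvd_def)
    have "coeff P' i = coeff P (Suc i)" for i by (simp add: P')
    then have "poly_over L P'" using P(2) by (simp add: irreducible_over_def poly_over_def)
    then have "degree [:0, 1::'a:] = 0 \<or> degree P' = 0"
      using P(2) P' poly_over_X[OF L] by (auto simp: irreducible_over_def)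
    then obtain a where "P' = [:a:]" by (auto elim: degree_eq_zeroE)
    then have "P = [:0, 1:]" using P' P(1) by (cases "a = 0") auto
    then have "qh_poly q m P = monom 1 q" by (simp add: qh_poly_altdef)
    then have "boundary H = monom 1 (q * N)" unfolding bd by (simp add: monom_power)
    moreover have "q * N = ?n" using nN \<open>P = [:0, 1:]\<close> by simp
    ultimately have "coeff (boundary H) i' $$ int j' = 0" using w'(4) by simp
    then show False using i'_in w'(5) by (simp add: bdc fps_to_fls_nth)
  qed
  let ?j = "m * degree P * N"
  have "coeff (boundary H) 0 = coeff (qh_poly q m P) (q * 0) ^ N"
    unfolding bd by (simp flip: poly_0_coeff_0 add: poly_power)
  also have "\<dots> = fls_const (coeff P 0 ^ N) * fls_X ^ ?j"
    unfolding coeff_qh_poly(1)[OF q] by (simp add: power_mult_distrib fls_const_power power_mult[symmetric])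
  finally have "coeff (boundary H) 0 $$ int ?j = coeff P 0 ^ N"
    by (simp add: fls_X_power_times_conv_shift(2) fls_const_nth)
  then have "fps_to_fls (coeff H 0) $$ int ?j \<noteq> 0" using P0 unfolding bdc by (metis power_not_zero)
  then have "coeff H 0 $ ?j \<noteq> 0" by (auto simp only: fps_to_fls_nth nat_int split: if_splits)
  moreover have "q * ?j = m * ?n" by (simp add: nN)
  ultimately show ex: "\<exists>j. q * j = m * ?n \<and> coeff H 0 $ j \<noteq> 0" by blast
  then obtain j where "q * j = m * ?n" "coeff H 0 $ j \<noteq> 0" by blast
  moreover have "coeff H 0 $ 0 = 0" using W n by (simp add: weierstrass_def)
  ultimately show "m > 0" using q n by (cases m) auto
qed

section \<open>The tower\<close>

text \<open>The calculus of \<open>lead\<close>, applied to series in y instead of x.\<close>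

lemma coeff_mult_power_lowest:
  fixes p r :: "'c::idom poly"
  assumes "coeff r 0 = 0"
  shows "j < i \<Longrightarrow> coeff (p * r ^ i) j = 0" "coeff (p * r ^ i) i = coeff p 0 * coeff r 1 ^ i"
proof -
  have "lead (fps_of_poly r) 1 (coeff r 1)" "lead (fps_of_poly p) 0 (coeff p 0)"
    using assms by (simp_all add: lead_def)
  then have "lead (fps_of_poly p * fps_of_poly r ^ i) (0 + i * 1) (coeff p 0 * coeff r 1 ^ i)"
    by (intro lead_mult lead_power)
  then have l: "lead (fps_of_poly (p * r ^ i)) i (coeff p 0 * coeff r 1 ^ i)"
    by (simp add: fps_of_poly_mult fps_of_poly_power)
  show "j < i \<Longrightarrow> coeff (p * r ^ i) j = 0" "coeff (p * r ^ i) i = coeff p 0 * coeff r 1 ^ i"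
    using l by (simp_all add: lead_def)
qed

lemma lead_swap_X_power: "lead (swap_xy [:fps_X ^ v:]) v 1"
  unfolding lead_def by (auto intro!: poly_eqI simp: coeff_pCons split: nat.splits)

lemma fps_nth_divide_of_nat:
  fixes a :: "'b::field fps"
  assumes "of_nat n \<noteq> (0::'b)"
  shows "(a / of_nat n) $ j = a $ j / of_nat n"
proof -
  have "a / of_nat n = a * fps_const (inverse (of_nat n))"
    using assms by (simp flip: fps_of_nat add: fps_divide_unit fps_const_inverse)
  then show ?thesis by (simp add: divide_inverse)
qed

text \<open>The Tschirnhausen shift c removes the term in y^(N-1). It vanishes at x = 0, so nothing
  changes modulo x.\<close>

lemma weierstrass_centred:
  fixes G :: "'b::field fps poly"
  assumes G: "weierstrass G" "degree G = N" "N > 0" and N: "of_nat N \<noteq> (0::'b)"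
  defines "c \<equiv> - coeff G (N - 1) / of_nat N" and "H \<equiv> pcompose G [:- coeff G (N - 1) / of_nat N, 1:]"
  shows "c $ 0 = 0" "weierstrass H" "degree H = N" "coeff H (N - 1) = 0"
proof -
  note H = H_def[folded c_def]
  show c0: "c $ 0 = 0" using G by (simp add: c_def fps_nth_divide_of_nat[OF N] weierstrass_def)
  show deg: "degree H = N" by (simp add: H degree_pcompose G(2))
  have lc: "lead_coeff H = 1" using G(1) by (simp add: H lead_coeff_comp weierstrass_def)
  have "map_poly (\<lambda>a. a $ 0) H = map_poly (\<lambda>a. a $ 0) G"
    using lead_translate[of G 0 "map_poly (\<lambda>a. a $ 0) G" c] c0
    by (simp add: lead_def swap_xy_def H)
  then have "coeff H i $ 0 = coeff G i $ 0" for i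
    by (metis (no_types, lifting) coeff_map_poly fps_zero_nth)
  then show "weierstrass H" using G(1,2) deg lc by (simp add: weierstrass_def)
  have cN: "of_nat N * c = - coeff G (N - 1)"
    by (rule fps_ext) (simp add: c_def fps_mult_of_nat_nth fps_nth_divide_of_nat[OF N] N)
  have co: "coeff ([:c, 1:] ^ i) l = of_nat (i choose l) * c ^ (i - l)" for i l
  proof (cases "l \<le> i")
    case False
    moreover have "degree ([:c, 1:] ^ i) = i" by (simp add: degree_power_eq)
    ultimately show ?thesis by (simp add: coeff_eq_0 binomial_eq_0)
  qed (simp add: coeff_linear_poly_power)
  have "coeff H (N - 1) = (\<Sum>i\<le>N. coeff G i * coeff ([:c, 1:] ^ i) (N - 1))"
    by (simp add: H pcompose_altdef poly_altdef[of "map_poly _ _"] coeff_sum coeff_map_poly G(2) degree_map_poly)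
  also have "\<dots> = (\<Sum>i\<in>{N - 1, N}. coeff G i * coeff ([:c, 1:] ^ i) (N - 1))"
  proof (rule sum.mono_neutral_right)
    show "\<forall>i\<in>{..N} - {N - 1, N}. coeff G i * coeff ([:c, 1:] ^ i) (N - 1) = 0"
      unfolding co by (auto simp: binomial_eq_0)
  qed auto
  also have "\<dots> = coeff G (N - 1) + coeff G N * (of_nat N * c)"
  proof -
    have "N choose (N - 1) = N" using binomial_symmetric[of "N - 1" N] G(3) by simp
    then show ?thesis using G(3) by (simp add: co)
  qed
  also have "\<dots> = 0" using G by (simp add: cN weierstrass_def)
  finally show "coeff H (N - 1) = 0" .
qed

lemma ulead_unique:
  assumes "ulead H w c" "c \<noteq> 0" "ulead H u d" "d \<noteq> 0"
  shows "u = w"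
  using assms unfolding ulead_def by (metis nat_neq_iff)

locale approximant_tower =
  fixes emb :: "'a::field \<Rightarrow> 'b::field" and F :: "'a fps poly" and g :: nat and T :: "'b tower"
  assumes F_W: "weierstrass F" and F_deg: "degree F > 0" and F_sqf: "squarefree F"
    and char: "CHAR('a) = 0 \<or> CHAR('a) > degree F"
    and embedding: "field_embedding emb" and tower: "tower_of emb F g T"
begin

abbreviation pb :: "nat \<Rightarrow> 'a fps poly \<Rightarrow> 'b fps poly" where "pb \<equiv> pullback emb T"

text \<open>This is d_k, the common degree of \<open>phi\<close> and \<open>psi\<close> at level
  k.\<close>

definition dg :: "nat \<Rightarrow> nat" where "dg k = (\<Prod>i\<in>{1..k}. tq T i * tell T i)"

lemma dg_0: "dg 0 = 1" and dg_Suc: "dg (Suc k) = dg k * (tq T (Suc k) * tell T (Suc k))"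
  by (simp_all add: dg_def)

lemma rhom_emb: "rhom emb"
  using embedding by (simp add: field_embedding_def rhom_def)

lemma emb_eq_0_iff: "emb a = 0 \<longleftrightarrow> a = 0"
  using rhom_mult[OF rhom_emb, of a "inverse a"] rhom_1[OF rhom_emb] rhom_0[OF rhom_emb]
  by (cases "a = 0") auto

lemma of_nat_neq_0:
  assumes "0 < n" "n \<le> degree F"
  shows "of_nat n \<noteq> (0::'a)" "of_nat n \<noteq> (0::'b)"
proof -
  show *: "of_nat n \<noteq> (0::'a)"
    using char assms by (auto simp: of_nat_eq_0_iff_char_dvd dest: dvd_imp_le)
  then show "of_nat n \<noteq> (0::'b)"
    using emb_eq_0_iff[of "of_nat n"] rhom_of_nat[OF rhom_emb] by metis
qed

lemma start: "tower_start emb F T" and step: "1 \<le> k \<Longrightarrow> k \<le> g \<Longrightarrow> tower_step T k"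
  using tower by (auto simp: tower_of_def)

lemma fst_tpi_nth_0: "fst (tpi T k) $ 0 = 0"
  by (induction k) (simp_all add: comp_xy_def)

lemma rhom_pb: "rhom (pb k)"
  unfolding pullback_def
  by (rule rhom_comp[OF rhom_subst_xy[OF fst_tpi_nth_0] rhom_map_poly[OF rhom_fps_map[OF rhom_emb]]])

lemmas pb_simps = rhom_simps[OF rhom_pb]

lemma pb_const: "pb k [:a:] = [:fps_map emb a oo fst (tpi T k):]"
proof -
  have "map_poly (fps_map emb) [:a:] = [:fps_map emb a:]"
    using rhom_0[OF rhom_fps_map[OF rhom_emb]] by (cases "a = 0") (simp_all add: map_poly_pCons)
  then show ?thesis by (simp add: pullback_def subst_xy_const)
qed

lemma pb_y: "pb k [:0, 1:] = snd (tpi T k)"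
  using rhom_0[OF rhom_fps_map[OF rhom_emb]] rhom_1[OF rhom_fps_map[OF rhom_emb]]
  by (simp add: pullback_def map_poly_pCons subst_xy_y)

lemma fps_map_X_power: "fps_map emb (fps_X ^ n) = fps_X ^ n"
  using rhom_0[OF rhom_emb] rhom_1[OF rhom_emb] by (intro fps_ext) (simp add: fps_map_def)

lemma pb_X_power: "pb k [:fps_X ^ n:] = [:fst (tpi T k) ^ n:]"
  by (simp add: pb_const fps_map_X_power fps_compose_power[symmetric] fst_tpi_nth_0)

lemma q_pos: "1 \<le> k \<Longrightarrow> k \<le> g \<Longrightarrow> tq T k > 0"
  using step[of k] by (simp add: tower_step_def edge_data_def)

lemma pb_Suc:
  assumes "Suc k \<le> g"
  shows "pb (Suc k) G = subst_xy (pb k G) (tsigma T (Suc k))"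
  using q_pos[of "Suc k"] assms
  by (simp add: pullback_def subst_xy_comp fst_tpi_nth_0 tsigma_def)

lemma pb_0: "pb 0 G = pcompose (map_poly (fps_map emb) G) [:tc T 0, 1:]"
  unfolding pullback_def tpi.simps
  by (rule rhom_eqI[of "\<lambda>H. subst_xy H (fps_X, [:tc T 0, 1:])" "\<lambda>H. pcompose H [:tc T 0, 1:]"])
    (simp_all add: rhom_subst_xy rhom_pcompose subst_xy_const subst_xy_y pcompose_pCons)

end

text \<open>
  \<open>V\<close> and \<open>lam\<close> are \<open>v\<^sub>k(\<phi>\<^sub>k)\<close> and \<open>\<lambda>\<^sub>k(\<phi>\<^sub>k)\<close>, \<open>v\<close> is \<open>v\<^sub>k(F)\<close>, and \<open>mu\<close>, \<open>e\<close> are \<open>\<mu>\<^sub>k\<close>, \<open>e\<^sub>k\<close>. The unit \<open>U\<close> is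
  recorded through its constant term only.
\<close>
locale level = approximant_tower emb F g T
  for emb :: "'a::field \<Rightarrow> 'b::field" and F :: "'a fps poly" and g :: nat and T :: "'b tower" +
  fixes k V :: nat and lam mu :: 'b and e v :: nat and U :: "'b fps poly"
  assumes k_le: "k \<le> g" and K: "subfld (tK T k)"
    and deg_F: "degree F = tN T k * dg k" and N_pos: "tN T k > 0"
    and H_W: "weierstrass (tH T k)" and H_deg: "degree (tH T k) = tN T k"
    and H_mid: "coeff (tH T k) (tN T k - 1) = 0"
    and pb_F: "pb k F = [:fps_X ^ v:] * (tH T k * U)" and U0: "coeff U 0 $ 0 \<noteq> 0"
    and fst_tpi: "fst (tpi T k) = fps_const mu * fps_X ^ e" and mu: "mu \<noteq> 0" "mu \<in> tK T k" and e_pos: "e > 0"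
    and over: "\<And>G. fpoly_over (tK T k) (pb k G)"
    and small: "\<And>A. A \<noteq> 0 \<Longrightarrow> degree A < dg k \<Longrightarrow> \<exists>w c. c \<noteq> 0 \<and> ulead (pb k A) w c"
    and lift: "\<And>c w. c \<in> tK T k \<Longrightarrow> V \<le> w \<Longrightarrow> \<exists>A. degree A < dg k \<and> ulead (pb k A) w c"
    and lam: "lam \<noteq> 0"
    and shape_ex: "\<exists>G. lead_coeff G = 1 \<and> degree G = dg k \<and> ylead (pb k G) V lam"
begin

abbreviation N :: nat where "N \<equiv> tN T k"
abbreviation D :: nat where "D \<equiv> dg k"

text \<open>The properties shared by \<open>phi\<close> and \<open>psi\<close>; both are found as
  particular members of this class.\<close>

definition shape :: "'a fps poly \<Rightarrow> bool" where
  "shape G \<longleftrightarrow> lead_coeff G = 1 \<and> degree G = D \<and> ylead (pb k G) V lam"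

lemma D_pos: "D > 0"
  using deg_F F_deg by (cases "D = 0") auto

lemma of_nat_N: "of_nat N \<noteq> (0::'a)" "of_nat N \<noteq> (0::'b)"
  using of_nat_neq_0[of N] N_pos deg_F D_pos by (metis One_nat_def Suc_leI mult.right_neutral mult_le_mono2)+

lemma ulead_pb_1: "ulead (pb k 1) 0 1"
  by (simp add: pb_simps ulead_def)

lemma degree_power_sum:
  fixes p :: "'a fps poly"
  assumes "degree p = D" "\<And>i. degree (a i) < D"
  shows "(\<Sum>i<n. a i * p ^ i) = 0 \<or> degree (\<Sum>i<n. a i * p ^ i) < n * D"
proof (cases "n = 0")
  case False
  have "degree (a i * p ^ i) \<le> n * D - 1" if "i < n" for i
  proof -
    have "degree (a i * p ^ i) \<le> degree (a i) + i * D"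
      using degree_mult_le[of "a i" "p ^ i"] degree_power_le[of p i] assms(1)
      by (metis add_left_mono mult.commute order.trans)
    also have "\<dots> < D + i * D" using assms(2) by simp
    also have "\<dots> \<le> n * D" using that by (metis Suc_leI mult_Suc mult_le_mono1)
    finally show ?thesis by simp
  qed
  then have "degree (\<Sum>i<n. a i * p ^ i) \<le> n * D - 1"
    by (intro degree_sum_le) auto
  moreover have "n * D > 0" using False D_pos by simp
  ultimately show ?thesis by linarith
qed simp

lemma F_minus_power:
  assumes "lead_coeff G = 1" "degree G = D"
  shows "F - G ^ N = 0 \<or> degree (F - G ^ N) < N * D"
proof -
  have "G \<noteq> 0" using assms by auto
  then have "degree (G ^ N) = N * D" using assms by (simp add: degree_power_eq)
  moreover have "lead_coeff (G ^ N) = 1" using assms by (simp only: lead_coeff_power power_one)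
  ultimately have "coeff (F - G ^ N) (N * D) = 0" "degree (F - G ^ N) \<le> N * D"
    using F_W deg_F by (auto simp: weierstrass_def intro!: degree_diff_le)
  then show ?thesis by (metis le_neq_implies_less leading_coeff_0_iff)
qed

text \<open>At x = 0 the Weierstrass polynomial H_k becomes y^N, and U a polynomial with nonzero
  constant term.\<close>

lemma lead_swap_pb_F:
  "lead (swap_xy (pb k F)) v (monom 1 N * swap_xy U $ 0)" "monom 1 N * swap_xy U $ 0 \<noteq> 0"
proof -
  have lH: "lead (swap_xy (tH T k)) 0 (monom 1 N)"
  proof -
    have "coeff (tH T k) l $ 0 = coeff (monom 1 N) l" for l
      using H_W H_deg by (cases l N rule: linorder_cases) (auto simp: weierstrass_def coeff_eq_0)
    then show ?thesis by (auto simp: lead_def intro!: poly_eqI)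
  qed
  have "lead (swap_xy U) 0 (swap_xy U $ 0)" by (simp add: lead_def)
  from lead_mult[OF lead_swap_X_power[of v] lead_mult[OF lH this]]
  show "lead (swap_xy (pb k F)) v (monom 1 N * swap_xy U $ 0)"
    by (simp only: pb_F rhom_mult[OF rhom_swap_xy] add_0_right mult_1_left)
  have "coeff (monom 1 N * swap_xy U $ 0) N = coeff U 0 $ 0" by (simp add: coeff_monom_mult)
  then show "monom 1 N * swap_xy U $ 0 \<noteq> 0" using U0 by (metis coeff_0)
qed

text \<open>Zero coefficients are dropped, as they have no value, and the leading power enters as
  the index N with coefficient 1. Used with n = N - 1, it preserves the absence of a term in
  G^(N-1).\<close>

lemma leading_terms:
  assumes F: "F = G ^ N + (\<Sum>i<n. a i * G ^ i)" and n: "n \<le> N" and a: "\<And>i. degree (a i) < D"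
  shows "\<exists>I a' c u. finite I \<and> N \<in> I \<and> I \<subseteq> insert N {..<n} \<and> F = (\<Sum>i\<in>I. a' i * G ^ i)
    \<and> (\<forall>i<n. a i \<noteq> 0 \<longrightarrow> i \<in> I \<and> a' i = a i)
    \<and> (\<forall>i\<in>I. c i \<noteq> 0 \<and> ulead (pb k (a' i)) (u i) (c i)) \<and> u N = 0 \<and> c N = 1"
proof -
  define J where "J = {i. i < n \<and> a i \<noteq> 0}"
  define a' where "a' i = (if i = N then 1 else a i)" for i
  have J: "finite J" "N \<notin> J" using n by (auto simp: J_def)
  have "(\<Sum>i<n. a i * G ^ i) = (\<Sum>i\<in>J. a' i * G ^ i)"
    using n by (intro sum.mono_neutral_cong_right) (auto simp: a'_def J_def)
  then have Fs: "F = (\<Sum>i\<in>insert N J. a' i * G ^ i)"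
    unfolding F by (subst sum.insert) (use J in \<open>auto simp: a'_def\<close>)
  have "\<exists>w c. c \<noteq> 0 \<and> ulead (pb k (a' i)) w c \<and> (i = N \<longrightarrow> w = 0 \<and> c = 1)" if iJ: "i \<in> insert N J" for i
  proof (cases "i = N")
    case True
    then show ?thesis using ulead_pb_1 by (intro exI[of _ 0] exI[of _ 1]) (simp add: a'_def)
  next
    case False
    then show ?thesis using small[of "a i"] a[of i] iJ by (auto simp: J_def a'_def)
  qed
  then obtain u c where "\<And>i. i \<in> insert N J \<Longrightarrow> c i \<noteq> 0 \<and> ulead (pb k (a' i)) (u i) (c i) \<and> (i = N \<longrightarrow> u i = 0 \<and> c i = 1)"
    by metis
  then show ?thesis
    by (intro exI[of _ "insert N J"] exI[of _ a'] exI[of _ c] exI[of _ u] conjI Fs)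
      (use J n in \<open>auto simp: J_def a'_def\<close>)
qed

text \<open>
  At \<open>x = 0\<close>, the \<open>y\<close>-order of the pullback of \<open>F\<close> is \<open>N\<close>, whereas a term \<open>a\<^sub>i G^i\<close> has order \<open>i\<close>.
\<close>
lemma coeff_valuation:
  assumes G: "shape G" and F: "F = G ^ N + (\<Sum>i<N. a i * G ^ i)" and a: "\<And>i. degree (a i) < D"
    and i: "i < N" "a i \<noteq> 0" and ul: "ulead (pb k (a i)) w c" "c \<noteq> 0"
  shows "N * V < w + i * V"
proof -
  obtain I a' c' u where I: "finite I" "N \<in> I" "I \<subseteq> insert N {..<N}" and Fs: "F = (\<Sum>i\<in>I. a' i * G ^ i)"
    and a': "\<forall>i<N. a i \<noteq> 0 \<longrightarrow> i \<in> I \<and> a' i = a i"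
    and u: "\<forall>i\<in>I. c' i \<noteq> 0 \<and> ulead (pb k (a' i)) (u i) (c' i)" "u N = 0"
    using leading_terms[OF F order.refl a] by (elim exE conjE)
  define p where "p i = swap_xy (pb k (a' i)) $ u i" for i
  have p: "lead (swap_xy (pb k (a' i))) (u i) (p i)" "coeff (p i) 0 \<noteq> 0" if "i \<in> I" for i
    using bspec[OF u(1) that] unfolding ulead_swap p_def lead_def by auto
  obtain r where r: "lead (swap_xy (pb k G)) V r" "coeff r 0 = 0" "coeff r 1 = lam"
    using G by (auto simp: shape_def ylead_swap)
  have "\<exists>M J. J \<noteq> {} \<and> J = {i\<in>I. u i + i * V = M} \<and> (\<forall>i\<in>I. M \<le> u i + i * V)
      \<and> lead (\<Sum>i\<in>I. swap_xy (pb k (a' i)) * swap_xy (pb k G) ^ i) M (\<Sum>i\<in>J. p i * r ^ i)"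
    by (rule lead_power_sum_min) (use I p(1) r(1) in auto)
  then obtain M J where J: "J \<noteq> {}" "J = {i\<in>I. u i + i * V = M}" and M: "\<forall>i\<in>I. M \<le> u i + i * V"
    and l: "lead (\<Sum>i\<in>I. swap_xy (pb k (a' i)) * swap_xy (pb k G) ^ i) M (\<Sum>i\<in>J. p i * r ^ i)"
    by (elim exE conjE)
  have finJ: "finite J" using I(1) J(2) by simp
  define S where "S = (\<Sum>i\<in>J. p i * r ^ i)"
  have lS: "lead (swap_xy (pb k F)) M S"
    using l unfolding S_def Fs by (simp only: rhom_simps[OF rhom_swap_xy] pb_simps)
  \<comment> \<open>The smallest index of J gives the lowest power of y in S, to which only its own
    term contributes. As S has y-order at least N, this forces J to consist of N alone.\<close>
  define i0 where "i0 = Min J"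
  have i0: "i0 \<in> J" "\<And>i. i \<in> J \<Longrightarrow> i0 \<le> i" unfolding i0_def using finJ J(1) by auto
  have "coeff S i0 = (\<Sum>i\<in>J. if i = i0 then coeff (p i0) 0 * lam ^ i0 else 0)"
    unfolding S_def coeff_sum
  proof (rule sum.cong)
    fix i assume "i \<in> J"
    then have "i0 \<le> i" by (rule i0(2))
    then show "coeff (p i * r ^ i) i0 = (if i = i0 then coeff (p i0) 0 * lam ^ i0 else 0)"
      using coeff_mult_power_lowest(1)[OF r(2), of i0 i "p i"]
        coeff_mult_power_lowest(2)[OF r(2), of "p i" i] r(3) by (cases "i = i0") auto
  qed simp
  then have nz: "coeff S i0 \<noteq> 0" using i0(1) finJ J(2) p(2)[of i0] lam by simp
  have "S \<noteq> 0" using nz by auto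
  then have "S = monom 1 N * swap_xy U $ 0"
    using lead_unique[OF lS lead_swap_pb_F(1)] lead_swap_pb_F(2) by blast
  then have "\<not> i0 < N" using nz by (auto simp: coeff_monom_mult)
  then have JN: "J = {N}" using i0 J(2) I(3) by fastforce
  have i': "i \<in> I" "a' i = a i" using a' i by auto
  have "N \<in> {i\<in>I. u i + i * V = M}" unfolding J(2)[symmetric] JN by simp
  then have "M = N * V" using u(2) by simp
  moreover have "i \<notin> {i\<in>I. u i + i * V = M}" unfolding J(2)[symmetric] JN using i(1) by simp
  then have "u i + i * V \<noteq> M" using i'(1) by simp
  ultimately have "N * V < u i + i * V" using bspec[OF M i'(1)] by linarith
  moreover have "u i = w"
    using ulead_unique[of "pb k (a i)" w c "u i" "c' i"] ul u(1) i' by auto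
  ultimately show ?thesis by simp
qed

end

section \<open>Existence and uniqueness of the approximate root\<close>

context level
begin

lemma shapeD:
  assumes "shape G"
  shows "lead_coeff G = 1" "degree G = D" "ylead (pb k G) V lam"
  using assms unfolding shape_def by blast+

lemma shape_add:
  assumes "shape G" "degree h < D" "ulead (pb k h) w c" "V < w"
  shows "shape (G + h)"
proof -
  have "degree (G + h) = D" using assms(2) shapeD(2)[OF assms(1)] by (simp add: degree_add_eq_left)
  moreover have "coeff (G + h) D = 1" using assms(2) shapeD(1,2)[OF assms(1)] by (simp add: coeff_eq_0)
  moreover have "ylead (pb k (G + h)) V lam"
    using assms by (auto simp: shape_def ylead_def ulead_def pb_simps)
  ultimately show ?thesis by (simp add: shape_def)
qed

text \<open>
  One step of the Tschirnhausen iteration: it removes the coefficient of \<open>G^(N-1)\<close> from the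
  \<open>G\<close>-adic expansion of \<open>F\<close> up to terms of smaller degree.
\<close>
lemma tschirnhausen_step:
  assumes G: "shape G" and "F \<noteq> G ^ N" and ge: "\<not> degree (F - G ^ N) < degree F - D"
  obtains G' where "shape G'" "F = G' ^ N \<or> degree (F - G' ^ N) < degree (F - G ^ N)"
proof -
  define R where "R = F - G ^ N"
  have G': "lead_coeff G = 1" "degree G = D" using shapeD[OF G] by simp_all
  obtain n where n: "N = Suc n" using N_pos by (cases N) auto
  have R0: "R \<noteq> 0" using assms by (simp add: R_def)
  obtain a where a: "\<And>i. degree (a i) < D" "R = (\<Sum>i<N. a i * G ^ i)"
    using monic_expansion[of G R N] F_minus_power[OF G'] G' D_pos unfolding R_def by auto
  define c where "c = a n"
  define R1 where "R1 = (\<Sum>i<n. a i * G ^ i)"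
  have R: "R = R1 + c * G ^ n" by (simp add: a(2) n R1_def c_def)
  have R1: "R1 = 0 \<or> degree R1 < n * D" unfolding R1_def by (rule degree_power_sum) (use G' a in auto)
  have dF: "degree F - D = n * D" by (simp add: deg_F n)
  have "G \<noteq> 0" using G' by auto
  then have Gn: "degree (G ^ n) = n * D" "G ^ n \<noteq> 0" "G \<noteq> 0"
    using G' by (simp_all add: degree_power_eq)
  have c0: "c \<noteq> 0"
  proof
    assume "c = 0"
    then have "R = R1" by (simp add: R)
    then show False using R1 ge R0 dF by (simp add: R_def)
  qed
  have dc: "degree (c * G ^ n) = degree c + n * D"
    using c0 Gn by (simp add: degree_mult_eq)
  have dR: "degree R = degree c + n * D"
  proof (cases "R1 = 0")
    case False
    then show ?thesis using R1 unfolding R dc[symmetric] by (intro degree_add_eq_right) (simp add: dc)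
  qed (simp add: R dc)
  \<comment> \<open>With this h the term N h G^(N-1) of (G + h)^N cancels the top term c G^(N-1) of
    F - G^N.\<close>
  define h where "h = smult (fps_const (inverse (of_nat N))) c"
  have Nh: "of_nat N * h = c"
  proof -
    have "(of_nat N :: 'a fps poly) = [:fps_const (of_nat N):]"
      by (simp add: of_nat_poly fps_of_nat)
    then show ?thesis using of_nat_N(1) by (simp add: h_def)
  qed
  have h0: "h \<noteq> 0" using Nh c0 by auto
  have dh: "degree h \<le> degree c" unfolding h_def by (rule degree_smult_le)
  have dcD: "degree c < D" using a by (simp add: c_def)
  then have dhD: "degree h < D" using dh by simp
  obtain w \<gamma> where ul: "\<gamma> \<noteq> 0" "ulead (pb k h) w \<gamma>" using small[OF h0 dhD] by blast
  have "ulead (pb k c) w (of_nat N * \<gamma>)"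
  proof -
    have "pb k c = of_nat N * pb k h" unfolding Nh[symmetric] by (simp add: pb_simps rhom_of_nat[OF rhom_pb])
    then show ?thesis using ul by (simp add: ulead_def of_nat_poly fps_mult_of_nat_nth)
  qed
  then have ulc: "ulead (pb k (a n)) w (of_nat N * \<gamma>)" by (simp only: c_def)
  have "F = G ^ N + (\<Sum>i<N. a i * G ^ i)" using a(2) by (simp only: R_def diff_eq_eq add.commute)
  then have "N * V < w + n * V"
    by (rule coeff_valuation[of G a n w "of_nat N * \<gamma>", OF G _ a(1) _ _ ulc]) (use n c0 ul(1) of_nat_N(2) in \<open>auto simp: c_def simp del: of_nat_Suc\<close>)
  then have "V < w" by (simp add: n)
  have shp: "shape (G + h)" by (rule shape_add[OF G dhD ul(2) \<open>V < w\<close>])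
  have "(G + h) ^ N = (\<Sum>j\<le>N. of_nat (N choose j) * h ^ j * G ^ (N - j))"
    by (subst add.commute) (rule binomial_ring)
  also have "{..N} = {0, 1} \<union> {2..N}" using n by auto
  also have "(\<Sum>j\<in>{0, 1} \<union> {2..N}. of_nat (N choose j) * h ^ j * G ^ (N - j))
      = G ^ N + of_nat N * h * G ^ n + (\<Sum>j\<in>{2..N}. of_nat (N choose j) * h ^ j * G ^ (N - j))"
    by (subst sum.union_disjoint) (auto simp: n)
  finally have Fd: "F - (G + h) ^ N = R1 - (\<Sum>j\<in>{2..N}. of_nat (N choose j) * h ^ j * G ^ (N - j))"
    using R unfolding R_def Nh by (simp add: algebra_simps)
  have sm: "(\<Sum>j\<in>{2..N}. of_nat (N choose j) * h ^ j * G ^ (N - j)) = 0 \<or>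
    degree (\<Sum>j\<in>{2..N}. of_nat (N choose j) * h ^ j * G ^ (N - j)) < degree R"
  proof (cases "{2..N} = {}")
    case False
    have "degree (of_nat (N choose j) * h ^ j * G ^ (N - j)) \<le> degree R - 1" if j: "j \<in> {2..N}" for j
    proof -
      have "degree (of_nat (N choose j) * h ^ j * G ^ (N - j)) \<le> degree h * j + D * (N - j)"
        using degree_mult_le[of "of_nat (N choose j) * h ^ j" "G ^ (N - j)"] degree_mult_le[of "of_nat (N choose j)" "h ^ j"]
          degree_power_le[of h j] degree_power_le[of G "N - j"] G'(2)
        by (simp add: degree_of_nat)
      also have "\<dots> \<le> degree c * j + D * (N - j)" using dh by simp
      \<comment> \<open>Replacing one factor G by h gives at most degree R. Every further
        replacement lowers the degree, because deg c < D.\<close>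
      also have "\<dots> < degree R"
      proof -
        obtain i where i: "j = Suc (Suc i)" using j by (metis Suc_le_D atLeastAtMost_iff numeral_2_eq_2 Suc_le_mono)
        obtain l where l: "N = j + l" using j by (metis atLeastAtMost_iff le_Suc_ex)
        have "degree c * i \<le> D * i" using dcD by simp
        with dcD have "degree c + degree c * i < D + D * i" by (rule add_less_le_mono)
        moreover have "n = Suc i + l" using n l i by simp
        ultimately show ?thesis unfolding dR using dcD i l by (simp add: algebra_simps)
      qed
      finally show ?thesis by simp
    qed
    then have "degree (\<Sum>j\<in>{2..N}. of_nat (N choose j) * h ^ j * G ^ (N - j)) \<le> degree R - 1"
      by (intro degree_sum_le) auto
    moreover have "degree R > 0" using False n D_pos dR by auto
    ultimately show ?thesis by linarith
  qed simp
  have "R1 = 0 \<or> degree R1 < degree R" using R1 dR by linarith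
  then have "F - (G + h) ^ N = 0 \<or> degree (F - (G + h) ^ N) < degree R"
    unfolding Fd using sm by (auto intro: degree_diff_less)
  then show thesis using that[OF shp] by (auto simp: R_def)
qed

lemma approx_root_ex: "\<exists>\<psi>. shape \<psi> \<and> (F = \<psi> ^ N \<or> degree (F - \<psi> ^ N) < degree F - D)"
proof -
  \<comment> \<open>The value 0 is reserved for F = G^N, which \<open>degree 0 = 0\<close> would not
    distinguish from a nonzero constant difference.\<close>
  define f where "f G = (if F = G ^ N then 0 else Suc (degree (F - G ^ N)))" for G
  have "\<exists>G. shape G" using shape_ex by (simp add: shape_def)
  then obtain G where G: "shape G" "\<And>G'. shape G' \<Longrightarrow> f G \<le> f G'"
    using exists_least_iff[of "\<lambda>n. \<exists>G. shape G \<and> f G = n"] by (metis not_less)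
  have "F = G ^ N \<or> degree (F - G ^ N) < degree F - D"
  proof (rule ccontr)
    assume c: "\<not> ?thesis"
    then obtain G' where "shape G'" "F = G' ^ N \<or> degree (F - G' ^ N) < degree (F - G ^ N)"
      using tschirnhausen_step[OF G(1)] by blast
    then have "f G' < f G" using c by (auto simp: f_def)
    then show False using G(2)[OF \<open>shape G'\<close>] by simp
  qed
  then show ?thesis using G by blast
qed

text \<open>The difference of the N-th powers is (\<psi> - \<psi>') S, where S has coefficient N in
  degree (N - 1) D, and N is nonzero in K. Different candidates would thus have N-th powers that
  differ in degree (N - 1) D or more.\<close>

lemma approx_root_unique:
  assumes "lead_coeff \<psi> = 1" "degree \<psi> = D" "F = \<psi> ^ N \<or> degree (F - \<psi> ^ N) < degree F - D"
    and "lead_coeff \<psi>' = 1" "degree \<psi>' = D" "F = \<psi>' ^ N \<or> degree (F - \<psi>' ^ N) < degree F - D"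
  shows "\<psi> = \<psi>'"
proof (rule ccontr)
  assume ne: "\<psi> \<noteq> \<psi>'"
  obtain n where n: "N = Suc n" using N_pos by (cases N) auto
  have dF: "degree F - D = n * D" by (simp add: deg_F n)
  define S where "S = (\<Sum>i<N. \<psi> ^ i * \<psi>' ^ (N - Suc i))"
  have "\<psi> \<noteq> 0" "\<psi>' \<noteq> 0" using assms by auto
  have eq: "\<psi> ^ N - \<psi>' ^ N = (\<psi> - \<psi>') * S"
    unfolding S_def n by (simp only: power_diff_sumr2 lessThan_Suc_atMost)
      (auto simp: mult.commute intro!: sum.cong)
  have cS: "coeff S (n * D) = of_nat N"
  proof -
    have "coeff (\<psi> ^ i * \<psi>' ^ (N - Suc i)) (n * D) = 1" if "i < N" for i
    proof -
      have "degree (\<psi> ^ i * \<psi>' ^ (N - Suc i)) = i * D + (N - Suc i) * D"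
        using \<open>\<psi> \<noteq> 0\<close> \<open>\<psi>' \<noteq> 0\<close> assms by (simp add: degree_mult_eq degree_power_eq)
      also have "\<dots> = n * D" using that n by (simp flip: add_mult_distrib)
      finally have "degree (\<psi> ^ i * \<psi>' ^ (N - Suc i)) = n * D" .
      moreover have "lead_coeff (\<psi> ^ i * \<psi>' ^ (N - Suc i)) = 1"
        using assms by (simp only: lead_coeff_mult lead_coeff_power power_one mult_1_left)
      ultimately show ?thesis by simp
    qed
    then show ?thesis by (simp add: S_def coeff_sum)
  qed
  have "coeff S (n * D) $ 0 \<noteq> 0" unfolding cS using of_nat_N(1) by (simp flip: fps_of_nat)
  then have S: "n * D \<le> degree S" "S \<noteq> 0" by (auto intro!: le_degree)
  have "degree (\<psi> ^ N - \<psi>' ^ N) = degree (\<psi> - \<psi>') + degree S"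
    unfolding eq using ne S by (simp add: degree_mult_eq)
  then have ge: "n * D \<le> degree (\<psi> ^ N - \<psi>' ^ N)" using S by simp
  have nz: "\<psi> ^ N - \<psi>' ^ N \<noteq> 0" unfolding eq using ne S by simp
  define A B where "A = F - \<psi>' ^ N" and "B = F - \<psi> ^ N"
  have AB: "\<psi> ^ N - \<psi>' ^ N = A - B" by (simp add: A_def B_def)
  have "A = 0 \<or> degree A < n * D" "B = 0 \<or> degree B < n * D"
    using assms(3,6) unfolding A_def B_def dF by simp_all
  moreover have "A - B \<noteq> 0" using nz AB by simp
  ultimately have "degree (A - B) < n * D"
    using degree_diff_less[of A "n * D" B] by (cases "A = 0"; cases "B = 0") simp_all
  then have "degree (\<psi> ^ N - \<psi>' ^ N) < n * D" by (simp only: AB)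
  then show False using ge by simp
qed

definition psi :: "'a fps poly" where "psi = approx_root N F"

lemma psi: "shape psi" "F = psi ^ N \<or> degree (F - psi ^ N) < degree F - D"
proof -
  have dD: "degree F div N = D" using deg_F N_pos by simp
  obtain \<psi> where \<psi>: "shape \<psi>" "F = \<psi> ^ N \<or> degree (F - \<psi> ^ N) < degree F - D"
    using approx_root_ex by blast
  have "psi = \<psi>"
    unfolding psi_def approx_root_def dD
    by (rule the_equality) (use \<psi> approx_root_unique in \<open>auto simp: shape_def\<close>)
  then show "shape psi" "F = psi ^ N \<or> degree (F - psi ^ N) < degree F - D" using \<psi> by auto
qed

lemma psi_monic: "lead_coeff psi = 1" "degree psi = D"
  using shapeD[OF psi(1)] by simp_all

text \<open>The defining bound \<open>degree F - D\<close> equals (N - 1) D, so the expansion stops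
  before the power N - 1.\<close>

lemma F_psi_expansion:
  obtains a where "\<And>i. degree (a i) < D" "F = psi ^ N + (\<Sum>i<N - 1. a i * psi ^ i)"
proof -
  have c: "F - psi ^ N = 0 \<or> degree (F - psi ^ N) < (N - 1) * degree psi"
    using psi(2) by (auto simp: deg_F psi_monic diff_mult_distrib)
  have "degree psi > 0" by (simp add: psi_monic D_pos)
  obtain a where a: "\<And>i. degree (a i) < degree psi" "F - psi ^ N = (\<Sum>i<N - 1. a i * psi ^ i)"
    using monic_expansion[OF psi_monic(1) \<open>degree psi > 0\<close> c] by blast
  from a(2) have "F = psi ^ N + (\<Sum>i<N - 1. a i * psi ^ i)" by (simp add: algebra_simps)
  then show thesis using that[of a] a(1) by (simp add: psi_monic)
qed

end

section \<open>The minimal polynomial as a limit of approximations\<close>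

context level
begin

lemma pb_X: "pb k [:fps_X ^ n:] = [:fps_const (mu ^ n) * fps_X ^ (e * n):]"
  by (simp add: pb_X_power fst_tpi power_mult_distrib power_mult fps_const_power)

lemma smult_X_power: "smult (fps_X ^ n) A = [:fps_X ^ n:] * (A :: 'c::comm_ring_1 fps poly)"
  by simp

lemma nth_pb_X_power_mult:
  "coeff (pb k (smult (fps_X ^ n) A)) i $ j = (if j < e * n then 0 else mu ^ n * coeff (pb k A) i $ (j - e * n))"
  unfolding smult_X_power rhom_mult[OF rhom_pb] pb_X
  by (simp add: mult.assoc fps_X_power_mult_nth)

text \<open>The coefficient of x^n at y = 0 is removed by an element supplied by
  \<open>lift\<close>. The correction is x^h times an element of value n - e h, with h as large as
  the condition V \<le> n - e h of \<open>lift\<close> permits. Since h grows with n, successive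
  corrections converge x-adically.\<close>

lemma root_approximation_step:
  assumes G: "shape G" and n: "V < n" and z: "\<And>j. j < n \<Longrightarrow> coeff (pb k G) 0 $ j = 0"
  obtains G' where "shape G'" "\<And>j. j < Suc n \<Longrightarrow> coeff (pb k G') 0 $ j = 0"
    "\<And>i j. j < (n - V) div e \<Longrightarrow> coeff G' i $ j = coeff G i $ j"
proof -
  define h where "h = (n - V) div e"
  define b where "b = coeff (pb k G) 0 $ n"
  have "e * h \<le> n - V" by (simp add: h_def)
  then have w: "V \<le> n - e * h" "e * h \<le> n" using n by linarith+
  have "b / mu ^ h \<in> tK T k"
    using over[of G] K mu(2) by (auto simp: b_def fpoly_over_def intro!: subfld_closed)
  then obtain A where A: "degree A < D" "ulead (pb k A) (n - e * h) (b / mu ^ h)"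
    using lift w(1) by blast
  define B where "B = - smult (fps_X ^ h) A"
  have ul: "ulead (pb k B) n (- b)"
    using A(2) w(2) mu(1) by (auto simp: B_def ulead_def pb_simps nth_pb_X_power_mult)
  have dB: "degree B < D" using A(1) by (simp add: B_def)
  show thesis
  proof (rule that[of "G + B"])
    show "shape (G + B)" by (rule shape_add[OF G dB ul n])
    show "coeff (pb k (G + B)) 0 $ j = 0" if "j < Suc n" for j
      using that ul z[of j] by (auto simp: pb_simps ulead_def b_def less_Suc_eq)
    show "coeff (G + B) i $ j = coeff G i $ j" if "j < (n - V) div e" for i j
      using that by (simp add: B_def h_def fps_X_power_mult_nth)
  qed
qed

text \<open>Coefficientwise limit of the approximations: the coefficients of x^j no longer change
  from step e (j + 1) on.\<close>

lemma min_poly_ex: "\<exists>\<phi>. shape \<phi> \<and> coeff (pb k \<phi>) 0 = 0"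
proof -
  define Q where "Q n G \<longleftrightarrow> shape G \<and> (\<forall>j<Suc (V + n). coeff (pb k G) 0 $ j = 0)" for n G
  have "\<exists>f. \<forall>n. Q n (f n) \<and> (\<forall>i. \<forall>j<Suc n div e. coeff (f (Suc n)) i $ j = coeff (f n) i $ j)"
  proof (rule dependent_nat_choice)
    show "\<exists>G. Q 0 G" using psi(1) by (auto simp: Q_def shape_def ylead_def less_Suc_eq)
    show "\<exists>G'. Q (Suc n) G' \<and> (\<forall>i. \<forall>j<Suc n div e. coeff G' i $ j = coeff G i $ j)" if "Q n G" for n G
    proof -
      have G: "shape G" "V < Suc (V + n)" "\<And>j. j < Suc (V + n) \<Longrightarrow> coeff (pb k G) 0 $ j = 0"
        using that by (auto simp: Q_def)
      obtain G' where "shape G'" "\<And>j. j < Suc (Suc (V + n)) \<Longrightarrow> coeff (pb k G') 0 $ j = 0"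
        "\<And>i j. j < (Suc (V + n) - V) div e \<Longrightarrow> coeff G' i $ j = coeff G i $ j"
        using root_approximation_step[OF G] by blast
      then show ?thesis by (intro exI[of _ G']) (auto simp: Q_def)
    qed
  qed
  then obtain f where f: "\<And>n. Q n (f n)" "\<And>n i j. j < Suc n div e \<Longrightarrow> coeff (f (Suc n)) i $ j = coeff (f n) i $ j"
    by blast
  have stable: "coeff (f n) i $ j = coeff (f (e * Suc j)) i $ j" if "e * Suc j \<le> n" for n i j
    using that
  proof (induction n rule: dec_induct)
    case (step n)
    have "Suc j \<le> Suc n div e" using step(1) e_pos
      by (metis div_le_mono le_SucI nonzero_mult_div_cancel_left not_gr_zero)
    then show ?case using f(2)[of j n i] step by simp
  qed simp
  define \<phi> where "\<phi> = (\<Sum>i\<le>D. monom (Abs_fps (\<lambda>j. coeff (f (e * Suc j)) i $ j)) i)"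
  have fD: "lead_coeff (f n) = 1" "degree (f n) = D" for n
    using f(1)[of n] shapeD by (auto simp: Q_def)
  have c: "coeff \<phi> i $ j = coeff (f n) i $ j" if "e * Suc j \<le> n" for i j n
    using stable[OF that, of i] fD(2)[of "e * Suc j"] fD(2)[of n]
    by (auto simp: \<phi>_def coeff_sum coeff_eq_0)
  \<comment> \<open>The limit differs from \<open>f n\<close> by a multiple of x^(j+1), whose
    pullback is divisible by x^(e (j+1)); the coefficient of x^j is not affected.\<close>
  have pbc: "coeff (pb k \<phi>) i $ j = coeff (pb k (f n)) i $ j" if "e * Suc j \<le> n" for i j n
  proof -
    define R where "R = map_poly (fps_shift (Suc j)) (\<phi> - f n)"
    have "coeff \<phi> l $ j' = coeff (f n) l $ j'" if "j' < Suc j" for l j'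
    proof -
      have "e * Suc j' \<le> e * Suc j" using that by (intro mult_le_mono2) simp
      then show ?thesis using \<open>e * Suc j \<le> n\<close> by (intro c) linarith
    qed
    then have "\<phi> - f n = smult (fps_X ^ Suc j) R"
      by (intro poly_eqI fps_ext)
        (auto simp: R_def coeff_map_poly fps_X_power_mult_nth simp del: power_Suc)
    then have "\<phi> = f n + smult (fps_X ^ Suc j) R" by (simp add: algebra_simps)
    then have "coeff (pb k \<phi>) i $ j = coeff (pb k (f n)) i $ j + coeff (pb k (smult (fps_X ^ Suc j) R)) i $ j"
      by (simp add: rhom_add[OF rhom_pb])
    moreover have "j < e * Suc j" using e_pos mult_le_mono1[of 1 e "Suc j"] by simp
    ultimately show ?thesis by (simp add: nth_pb_X_power_mult del: power_Suc)
  qed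
  have z: "coeff (pb k \<phi>) 0 $ j = 0" for j
  proof -
    have "coeff (pb k \<phi>) 0 $ j = coeff (pb k (f (e * Suc j + j))) 0 $ j" by (rule pbc) simp
    then show ?thesis using f(1)[of "e * Suc j + j"] by (simp add: Q_def)
  qed
  have "shape \<phi>"
    unfolding shape_def
  proof (intro conjI)
    have "coeff \<phi> D = 1"
    proof (rule fps_ext)
      fix j show "coeff \<phi> D $ j = 1 $ j"
        using c[of j "e * Suc j" D] fD[of "e * Suc j"] by simp
    qed
    moreover have "degree \<phi> \<le> D" unfolding \<phi>_def by (intro degree_sum_le) (auto intro: order.trans[OF degree_monom_le])
    ultimately show "degree \<phi> = D" "lead_coeff \<phi> = 1"
      by (metis le_antisym le_degree zero_neq_one)+
    have "ylead (pb k (f (e * Suc V))) V lam" using f(1) shapeD by (auto simp: Q_def)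
    moreover have "coeff (pb k \<phi>) i $ j = coeff (pb k (f (e * Suc V))) i $ j" if "j \<le> V" for i j
      by (rule pbc) (use that in simp)
    ultimately show "ylead (pb k \<phi>) V lam" by (simp add: ylead_def)
  qed
  then show ?thesis using z by (auto simp: fps_eq_iff)
qed

text \<open>Setting y = 0 in the pullback is evaluation at the parametrisation (\<mu> x^e, S(x)) by
  which \<open>min_poly\<close> is defined.\<close>

lemma root_condition:
  "poly (map_poly (\<lambda>a. fps_compose (fps_map emb a) (fst (tpi T k))) p) (coeff (snd (tpi T k)) 0)
    = coeff (pb k p) 0"
proof -
  have h: "rhom (\<lambda>a. fps_map emb a oo fst (tpi T k))"
    by (rule rhom_comp[OF rhom_fps_compose[OF fst_tpi_nth_0] rhom_fps_map[OF rhom_emb]])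
  have "poly (map_poly (\<lambda>a. fps_map emb a oo fst (tpi T k)) p) (coeff (snd (tpi T k)) 0) = poly (pb k p) 0"
    by (rule rhom_eqI[of "\<lambda>p. poly (map_poly (\<lambda>a. fps_map emb a oo fst (tpi T k)) p) (coeff (snd (tpi T k)) 0)"
          "\<lambda>p. poly (pb k p) 0"])
      (simp_all add: rhom_poly_eval[OF h] rhom_comp[OF rhom_poly rhom_pb] pb_const pb_y map_poly_pCons
        rhom_0[OF h] rhom_1[OF h] del: poly_0_coeff_0, simp add: poly_0_coeff_0)
  then show ?thesis by (simp add: poly_0_coeff_0)
qed

lemma small_root: "A \<noteq> 0 \<Longrightarrow> degree A < D \<Longrightarrow> coeff (pb k A) 0 \<noteq> 0"
  using small[of A] by (auto simp: ulead_def)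

definition phi :: "'a fps poly" where "phi = min_poly emb T k"

text \<open>Evaluation along the parametrisation is a ring homomorphism into a domain and kills no
  nonzero polynomial of degree below D. So a monic element of degree D in its kernel is irreducible
  and divides the whole kernel. The element of class \<open>shape\<close> found before is therefore
  \<open>phi\<close>, which gets the same V and \<open>lam\<close> as \<open>psi\<close>.\<close>

lemma phi: "shape phi" "coeff (pb k phi) 0 = 0"
proof -
  obtain \<phi> where \<phi>: "shape \<phi>" "coeff (pb k \<phi>) 0 = 0" using min_poly_ex by blast
  note \<phi>D = shapeD[OF \<phi>(1)]
  have rm: "coeff (pb k (a * b)) 0 = coeff (pb k a) 0 * coeff (pb k b) 0" for a b
    by (simp add: pb_simps coeff_mult)
  have irr: "irreducible \<phi>"
  proof (rule irreducibleI)
    show "\<phi> \<noteq> 0" using \<phi>D by auto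
    show "\<not> \<phi> dvd 1" using \<phi>D D_pos by (auto simp: is_unit_poly_iff)
    fix a b assume ab: "\<phi> = a * b"
    have *: "b dvd 1" if ab: "\<phi> = a * b" and z: "coeff (pb k a) 0 = 0" for a b
    proof -
      have nz: "a \<noteq> 0" "b \<noteq> 0" using ab \<open>\<phi> \<noteq> 0\<close> by auto
      have "D \<le> degree a" using small_root[OF nz(1)] z by force
      moreover have "D = degree a + degree b" using \<phi>D(2) ab nz by (simp add: degree_mult_eq)
      ultimately have "degree b = 0" by simp
      then obtain c where c: "b = [:c:]" by (auto elim: degree_eq_zeroE)
      have "lead_coeff a * lead_coeff b = 1" using \<phi>D(1) ab by (simp only: lead_coeff_mult)
      then have "lead_coeff a * c = 1" using c by simp
      then have "c dvd 1" by (metis dvd_triv_right)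
      then show "b dvd 1" by (simp add: c is_unit_poly_iff)
    qed
    have "coeff (pb k a) 0 = 0 \<or> coeff (pb k b) 0 = 0" using \<phi>(2) ab rm by simp
    then show "a dvd 1 \<or> b dvd 1" using *[of a b] *[of b a] ab by (auto simp: mult.commute)
  qed
  have uniq: "p = \<phi>" if p: "lead_coeff p = 1" "irreducible p" "coeff (pb k p) 0 = 0" for p
  proof -
    obtain u r where ur: "p = \<phi> * u + r" "degree r < degree \<phi>"
      using monic_division[of \<phi> UNIV p] \<phi>D D_pos by auto
    have "coeff (pb k r) 0 = 0"
      using p(3) \<phi>(2) unfolding ur(1) by (simp add: rhom_add[OF rhom_pb] rm)
    then have "r = 0" using small_root[of r] ur(2) \<phi>D(2) by auto
    then have pu: "p = \<phi> * u" using ur by simp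
    then have "u dvd 1" using irreducibleD[OF p(2) pu] \<phi>D D_pos by (auto simp: is_unit_poly_iff)
    then obtain c where c: "u = [:c:]" by (auto simp: is_unit_poly_iff)
    have "lead_coeff p = lead_coeff \<phi> * lead_coeff u" using pu by (simp only: lead_coeff_mult)
    then have "c = 1" using p(1) \<phi>D(1) c by simp
    then show ?thesis using pu c by (simp add: one_pCons)
  qed
  have "phi = \<phi>"
    unfolding phi_def min_poly_def root_condition
  proof (rule the_equality)
    show "lead_coeff \<phi> = 1 \<and> irreducible \<phi> \<and> coeff (pb k \<phi>) 0 = 0"
      by (intro conjI \<phi>D(1) irr \<phi>(2))
  qed (elim conjE, rule uniq)
  then show "shape phi" "coeff (pb k phi) 0 = 0" using \<phi> by auto
qed

text \<open>Otherwise the \<open>\<phi>\<close>-adic expansion of \<open>F\<close> would reduce to \<open>F = \<phi>^N\<close>.\<close>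
lemma H_not_monom:
  assumes "N > 1"
  shows "tH T k \<noteq> monom 1 N"
proof
  assume H: "tH T k = monom 1 N"
  note phiD = shapeD[OF phi(1)]
  have dpos: "degree phi > 0" using phiD D_pos by simp
  have c: "F - phi ^ N = 0 \<or> degree (F - phi ^ N) < N * degree phi"
    unfolding phiD(2) by (rule F_minus_power[OF phiD(1,2)])
  obtain a where a: "\<And>i. degree (a i) < degree phi" "F - phi ^ N = (\<Sum>i<N. a i * phi ^ i)"
    using monic_expansion[OF phiD(1) dpos c] by blast
  have "a i = 0" if "i < N" for i
    using that
  proof (induction i rule: less_induct)
    case (less i)
    let ?r = "pb k phi"
    have pbF: "pb k F = (\<Sum>l<N. pb k (a l) * ?r ^ l) + ?r ^ N"
    proof -
      have "F = (\<Sum>l<N. a l * phi ^ l) + phi ^ N" using a(2) by (simp only: diff_eq_eq)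
      then have "pb k F = pb k ((\<Sum>l<N. a l * phi ^ l) + phi ^ N)" by (rule arg_cong)
      then show ?thesis by (simp only: pb_simps)
    qed
    have "coeff (pb k F) i = 0"
      using less.prems by (simp add: pb_F H coeff_monom_mult)
    moreover have "coeff (?r ^ N) i = 0"
      using coeff_mult_power_lowest(1)[OF phi(2), of i N 1] less.prems by simp
    \<comment> \<open>Terms with l < i vanish by induction, and those with l > i have y-order above
      i because \<open>phi\<close> pulls back to a multiple of y.\<close>
    moreover have "coeff (\<Sum>l<N. pb k (a l) * ?r ^ l) i = coeff (pb k (a i)) 0 * coeff ?r 1 ^ i"
    proof -
      have "coeff (\<Sum>l<N. pb k (a l) * ?r ^ l) i = (\<Sum>l<N. if l = i then coeff (pb k (a i)) 0 * coeff ?r 1 ^ i else 0)"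
        unfolding coeff_sum
      proof (rule sum.cong)
        fix l assume "l \<in> {..<N}"
        consider "l < i" | "l = i" | "i < l" by linarith
        then show "coeff (pb k (a l) * ?r ^ l) i = (if l = i then coeff (pb k (a i)) 0 * coeff ?r 1 ^ i else 0)"
        proof cases
          case 1
          then have "a l = 0" using less by simp
          then show ?thesis using 1 by (simp add: pb_simps)
        qed (simp_all add: coeff_mult_power_lowest[OF phi(2)])
      qed simp
      then show ?thesis using less.prems by simp
    qed
    moreover have "coeff ?r 1 \<noteq> 0" using phiD(3) lam by (auto simp: ylead_def)
    ultimately have "coeff (pb k (a i)) 0 = 0" unfolding pbF by simp
    then show ?case using small_root[of "a i"] a(1)[of i] phiD(2) by auto
  qed
  then have "F = phi ^ N" using a(2) by simp
  then have "phi ^ 2 dvd F" using assms by (simp add: le_imp_power_dvd)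
  then have "phi dvd 1" using F_sqf by (simp add: squarefree_def)
  then show False using dpos by (auto simp: is_unit_poly_iff)
qed

text \<open>The line of slope -m/q through (N, 0) supports the Newton polygon of H_k. It may touch
  the polygon in (N, 0) only, and q and m may have a common factor.\<close>

definition good :: "nat \<Rightarrow> nat \<Rightarrow> bool" where
  "good q m \<longleftrightarrow> q > 0 \<and> m > 0 \<and> (\<forall>i j. coeff (tH T k) i $ j \<noteq> 0 \<longrightarrow> m * N \<le> q * j + m * i)"

lemma lead_weighted_X_power:
  assumes "q > 0" shows "lead (weighted q m [:fps_X ^ v:]) (q * v) (1 :: 'b poly)"
proof (rule lead_weightedI[OF assms])
  fix i j
  show "q * v \<le> q * j + m * i" if "coeff [:fps_X ^ v :: 'b fps:] i $ j \<noteq> 0"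
    using that by (cases i) (auto split: if_splits)
  show "coeff 1 i = coeff [:fps_X ^ v:] i $ j" if "q * j + m * i = q * v"
    using that assms by (cases i) auto
  show "\<exists>j. q * j + m * i = q * v" if "coeff (1 :: 'b poly) i \<noteq> 0"
    using that by (cases i) auto
qed

text \<open>For good weights, the part of H_k on the supporting line, with x set to 1.\<close>

definition edge_form :: "nat \<Rightarrow> nat \<Rightarrow> 'b poly" where
  "edge_form q m = weighted q m (tH T k) $ (m * N)"

lemma edge_form:
  assumes "good q m"
  shows "lead (weighted q m (tH T k)) (m * N) (edge_form q m)"
    and "q * j + m * i = m * N \<Longrightarrow> coeff (edge_form q m) i = coeff (tH T k) i $ j"
    and "coeff (edge_form q m) i \<noteq> 0 \<Longrightarrow> \<exists>j. q * j + m * i = m * N"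
    and "coeff (edge_form q m) N = 1"
proof -
  have q: "q > 0" using assms by (simp add: good_def)
  have "weighted q m (tH T k) $ n = 0" if "n < m * N" for n
    using q _ that by (rule weighted_nth_eq_0) (use assms in \<open>simp add: good_def\<close>)
  then show l: "lead (weighted q m (tH T k)) (m * N) (edge_form q m)"
    by (simp add: lead_def edge_form_def)
  show *: "q * j + m * i = m * N \<Longrightarrow> coeff (edge_form q m) i = coeff (tH T k) i $ j" for i j
    by (rule lead_weightedD(2)[OF q l])
  show "coeff (edge_form q m) i \<noteq> 0 \<Longrightarrow> \<exists>j. q * j + m * i = m * N"
    by (rule lead_weightedD(3)[OF q l])
  show "coeff (edge_form q m) N = 1"
    using *[of 0 N] H_W H_deg by (simp add: weierstrass_def)
qed

lemma lead_pb_F: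
  assumes "good q m"
  shows "lead (weighted q m (pb k F)) (q * v + m * N) (smult (coeff U 0 $ 0) (edge_form q m))"
proof -
  have q: "q > 0" "m > 0" using assms by (simp_all add: good_def)
  have "lead (weighted q m U) (q * 0) [:coeff U 0 $ 0:]"
    by (rule lead_weighted_ulead[OF q]) (simp add: ulead_def)
  from lead_mult[OF lead_weighted_X_power[OF q(1), of m] lead_mult[OF edge_form(1)[OF assms] this]]
  have "lead (weighted q m [:fps_X ^ v:] * (weighted q m (tH T k) * weighted q m U)) (q * v + m * N)
    (smult (coeff U 0 $ 0) (edge_form q m))" by (simp add: mult.commute)
  then show ?thesis by (simp only: pb_F rhom_mult[OF rhom_weighted[OF q(1)]])
qed

text \<open>
  If the pullback of the approximate root had a term \<open>x^j\<close> on or below the edge, its \<open>N\<close>-th power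
  would contribute a term in \<open>y^(N-1)\<close> to the leading form of the pullback of \<open>F\<close>, which has none.
\<close>
lemma psi_good:
  assumes good: "good q m" and nz: "coeff (pb k psi) 0 $ j \<noteq> 0"
  shows "q * V + m < q * j"
proof (rule ccontr)
  assume "\<not> ?thesis"
  then have le: "q * j \<le> q * V + m" by simp
  note psiD = shapeD[OF psi(1)]
  define j0 where "j0 = (LEAST j. coeff (pb k psi) 0 $ j \<noteq> 0)"
  have j0: "coeff (pb k psi) 0 $ j0 \<noteq> 0" "j0 \<le> j" "\<And>l. l < j0 \<Longrightarrow> coeff (pb k psi) 0 $ l = 0"
    using LeastI[of "\<lambda>j. coeff (pb k psi) 0 $ j \<noteq> 0", OF nz] Least_le[of "\<lambda>j. coeff (pb k psi) 0 $ j \<noteq> 0", OF nz]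
      not_less_Least[of _ "\<lambda>j. coeff (pb k psi) 0 $ j \<noteq> 0"] unfolding j0_def by blast+
  have "V < j0"
    using j0(1) psiD(3) unfolding ylead_def by (metis linorder_neqE_nat)
  \<comment> \<open>The weights (1, r) put the lowest pure power x^j0 on a line with the linear
    term, so that the leading form of \<open>psi\<close> is s + lam y with s nonzero. As q r \<le>
    m, this line is no steeper than the given one and still supports the polygon.\<close>
  then obtain r where r: "j0 = V + r" "r > 0" by (metis less_imp_add_positive)
  have "q * j0 \<le> q * V + m" using le j0(2) by (meson le_trans mult_le_mono2)
  then have qr: "q * r \<le> m" by (simp add: r algebra_simps)
  have q: "q > 0" using good by (simp add: good_def)
  have good1: "good 1 r"
    unfolding good_def
  proof (intro conjI allI impI)
    fix i l assume nz: "coeff (tH T k) i $ l \<noteq> 0"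
    then have i: "i \<le> N" using H_deg le_degree by (metis fps_zero_nth)
    have "q * (r * (N - i)) \<le> m * (N - i)" using qr by (metis mult.assoc mult_le_mono1)
    also have "\<dots> \<le> q * l" using good nz by (simp add: good_def diff_mult_distrib2 diff_le_mono le_diff_conv)
    finally have "r * (N - i) \<le> l" using q by simp
    then show "r * N \<le> 1 * l + r * i" using i by (simp add: diff_mult_distrib2 le_diff_conv)
  qed (use r in auto)
  define s where "s = coeff (pb k psi) 0 $ (V + r)"
  have s: "s \<noteq> 0" using j0(1) r by (simp add: s_def)
  have "lead (weighted 1 r (pb k psi)) (1 * V + r) [:s, lam:]"
  proof (rule lead_weighted_linear[OF _ r(2) psiD(3)])
    show "1 * V + r \<le> 1 * j" if "coeff (pb k psi) 0 $ j \<noteq> 0" for j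
      using that j0(3)[of j] r(1) by (simp add: not_less[symmetric]) blast
  qed (simp_all add: s_def)
  then have lpsi: "lead (weighted 1 r (pb k psi)) (V + r) [:s, lam:]" by simp
  obtain a where a: "\<And>i. degree (a i) < D" "F = psi ^ N + (\<Sum>i<N - 1. a i * psi ^ i)"
    using F_psi_expansion by blast
  obtain I a' c u where I: "finite I" "N \<in> I" "I \<subseteq> insert N {..<N - 1}" and Fs: "F = (\<Sum>i\<in>I. a' i * psi ^ i)"
    and uc: "\<forall>i\<in>I. c i \<noteq> 0 \<and> ulead (pb k (a' i)) (u i) (c i)" "c N = 1"
    using leading_terms[OF a(2) diff_le_self a(1)] by (elim exE conjE)
  have la: "lead (weighted 1 r (pb k (a' i))) (u i) [:c i:]" if "i \<in> I" for i
    using lead_weighted_ulead[of 1 r "pb k (a' i)" "u i" "c i"] uc(1) that r(2) by simp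
  have "\<exists>M J. J \<noteq> {} \<and> J = {i\<in>I. u i + i * (V + r) = M} \<and> (\<forall>i\<in>I. M \<le> u i + i * (V + r))
      \<and> lead (\<Sum>i\<in>I. weighted 1 r (pb k (a' i)) * weighted 1 r (pb k psi) ^ i) M (\<Sum>i\<in>J. [:c i:] * [:s, lam:] ^ i)"
    by (rule lead_power_sum_min) (use I la lpsi in auto)
  then obtain M J where J: "J \<noteq> {}" "J = {i\<in>I. u i + i * (V + r) = M}"
    and l: "lead (\<Sum>i\<in>I. weighted 1 r (pb k (a' i)) * weighted 1 r (pb k psi) ^ i) M (\<Sum>i\<in>J. [:c i:] * [:s, lam:] ^ i)"
    by (elim exE conjE)
  have finJ: "finite J" using I(1) J(2) by simp
  define S where "S = (\<Sum>i\<in>J. [:c i:] * [:s, lam:] ^ i)"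
  have lS: "lead (weighted 1 r (pb k F)) M S"
    using l unfolding S_def by (subst Fs) (simp only: rhom_simps[OF rhom_weighted[OF zero_less_one]] pb_simps)
  have dpw: "degree ([:c i:] * [:s, lam:] ^ i) = i" if "i \<in> J" for i
    using uc(1) that J(2) lam by (simp add: degree_power_eq)
  have S0: "S \<noteq> 0"
  proof -
    \<comment> \<open>The power with index i has degree i, so the largest index alone contributes to
      the top degree.\<close>
    define i2 where "i2 = Max J"
    have i2: "i2 \<in> J" "\<And>i. i \<in> J \<Longrightarrow> i \<le> i2" unfolding i2_def using J(1) finJ by auto
    have "coeff S i2 = (\<Sum>i\<in>J. if i = i2 then coeff ([:c i2:] * [:s, lam:] ^ i2) i2 else 0)"
      unfolding S_def coeff_sum
    proof (rule sum.cong)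
      fix i assume i: "i \<in> J"
      have "coeff ([:c i:] * [:s, lam:] ^ i) i2 = 0" if "i \<noteq> i2"
        using dpw[OF i] i2(2)[OF i] that by (intro coeff_eq_0) linarith
      then show "coeff ([:c i:] * [:s, lam:] ^ i) i2 = (if i = i2 then coeff ([:c i2:] * [:s, lam:] ^ i2) i2 else 0)"
        by (cases "i = i2") simp_all
    qed simp
    also have "\<dots> = lead_coeff ([:c i2:] * [:s, lam:] ^ i2)" using i2 finJ dpw by simp
    also have "\<dots> \<noteq> 0" using i2 uc(1) J(2) lam by simp
    finally show ?thesis by auto
  qed
  have E: "S = smult (coeff U 0 $ 0) (edge_form 1 r)"
  proof -
    have "edge_form 1 r \<noteq> 0" using edge_form(4)[OF good1] by auto
    then show ?thesis
      using lead_unique[OF lS lead_pb_F[OF good1]] S0 U0 by simp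
  qed
  \<comment> \<open>The expansion in \<open>psi\<close> has no index N - 1, so in degrees N - 1 and
    above only the index N contributes.\<close>
  have cf: "coeff S l = (if N \<in> J then coeff ([:s, lam:] ^ N) l else 0)" if l: "N - 1 \<le> l" for l
  proof -
    have "coeff S l = (\<Sum>i\<in>J. if i = N then coeff ([:s, lam:] ^ N) l else 0)"
      unfolding S_def coeff_sum
    proof (rule sum.cong)
      fix i assume i: "i \<in> J"
      have "coeff ([:c i:] * [:s, lam:] ^ i) l = 0" if "i \<noteq> N"
        using that i J(2) I(3) dpw[OF i] l by (intro coeff_eq_0) auto
      then show "coeff ([:c i:] * [:s, lam:] ^ i) l = (if i = N then coeff ([:s, lam:] ^ N) l else 0)"
        using uc(2) by (cases "i = N") simp_all
    qed simp
    then show ?thesis using finJ by simp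
  qed
  have "coeff S N \<noteq> 0" unfolding E using edge_form(4)[OF good1] U0 by simp
  then have "N \<in> J" using cf[of N] by (auto split: if_splits)
  \<comment> \<open>This is N lam^(N-1) s and hence nonzero, whereas H_k has no term in
    y^(N-1).\<close>
  then have "coeff S (N - 1) = of_nat (N choose (N - 1)) * lam ^ (N - 1) * s ^ (N - (N - 1))"
    using cf[of "N - 1"] by (simp add: coeff_linear_poly_power del: diff_diff_cancel)
  also have "N choose (N - 1) = N" using binomial_symmetric[of "N - 1" N] N_pos by simp
  finally have "coeff S (N - 1) \<noteq> 0" using of_nat_N lam s by simp
  moreover have "coeff (edge_form 1 r) (N - 1) = coeff (tH T k) (N - 1) $ r"
    using N_pos by (intro edge_form(2)[OF good1]) (cases N; simp)
  ultimately show False unfolding E using H_mid by simp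
qed

lemma lead_psi:
  assumes "good q m"
  shows "lead (weighted q m (pb k psi)) (q * V + m) [:0, lam:]"
  using assms psi_good[OF assms] shapeD[OF psi(1)]
  by (intro lead_weighted_linear) (force simp: good_def)+

text \<open>The pullback of \<open>phi\<close> has no pure powers of x, and that of
  \<open>psi\<close> has them only strictly above the line. So both have the same leading form, and
  hence the same values and coefficients at the later levels.\<close>

lemma lead_phi:
  assumes "good q m"
  shows "lead (weighted q m (pb k phi)) (q * V + m) [:0, lam:]"
  using assms shapeD[OF phi(1)] phi(2)
  by (intro lead_weighted_linear) (auto simp: good_def)

lemma good_ex: "\<exists>q m. good q m"
proof (cases "tH T k = monom 1 N")
  case True
  then have "good 1 1" using H_not_monom by (auto simp: good_def split: if_splits)
  then show ?thesis by blast
next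
  case False
  then obtain q m i j where "q > 0" "m > 0" "\<And>i j. coeff (tH T k) i $ j \<noteq> 0 \<Longrightarrow> m * N \<le> q * j + m * i"
    "i < N" "coeff (tH T k) i $ j \<noteq> 0" "q * j + m * i = m * N"
    using exists_edge_weights[OF H_W] unfolding H_deg by blast
  then show ?thesis by (auto simp: good_def)
qed

end

section \<open>Coefficients in the residue fields, and the Euler operator\<close>

lemma fpoly_over_add: "subfld L \<Longrightarrow> fpoly_over L p \<Longrightarrow> fpoly_over L r \<Longrightarrow> fpoly_over L (p + r)"
  by (simp add: fpoly_over_def subfld_closed)

lemma fpoly_over_mult: "subfld L \<Longrightarrow> fpoly_over L p \<Longrightarrow> fpoly_over L r \<Longrightarrow> fpoly_over L (p * r)"
  by (simp add: fpoly_over_def coeff_mult fps_sum_nth fps_mult_nth subfld_closed)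

lemma fpoly_over_pcompose:
  assumes L: "subfld L" and H: "fpoly_over L H" and c: "\<And>j. \<kappa> $ j \<in> L"
  shows "fpoly_over L (pcompose H [:\<kappa>, 1:])"
  using H
proof (induction H)
  case 0
  then show ?case by simp
next
  case (pCons a p)
  have a: "a $ j \<in> L" for j using pCons.prems by (auto simp: fpoly_over_def dest: spec[of _ 0])
  have p: "fpoly_over L p" using pCons.prems unfolding fpoly_over_def by (metis coeff_pCons_Suc)
  have 1: "fpoly_over L [:a:]" using a L by (auto simp: fpoly_over_def coeff_pCons subfld_closed split: nat.splits)
  have 2: "fpoly_over L [:\<kappa>, 1:]" using c L by (auto simp: fpoly_over_def coeff_pCons subfld_closed split: nat.splits)
  show ?case unfolding pcompose_pCons
    by (intro fpoly_over_add fpoly_over_mult L 1 2 pCons.IH p)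
qed

lemma fpoly_over_monom_subst:
  assumes "subfld L" "fpoly_over L H" "\<zeta> \<in> L" "q > 0"
  shows "fpoly_over L (monom_subst \<zeta> q m H)"
  using assms by (auto simp: fpoly_over_def nth_coeff_monom_subst subfld_closed)

text \<open>The Euler operator y d/dy keeps exponents, so the twisting factors of the terms carry
  over unchanged to the derivative.\<close>

lemma poly_pderiv_monom_sum:
  "poly (pderiv (\<Sum>i\<in>I. monom (b i) i)) c * c = (\<Sum>i\<in>I. of_nat i * b i * (c::'b::field) ^ i)"
proof -
  have "poly (monom (of_nat i * b i) (i - Suc 0)) c * c = of_nat i * b i * c ^ i" for i
    by (cases i) (simp_all add: poly_monom)
  moreover have "pderiv (\<Sum>i\<in>I. monom (b i) i) = (\<Sum>i\<in>I. monom (of_nat i * b i) (i - Suc 0))"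
    by (induction I rule: infinite_finite_induct) (simp_all add: pderiv_add pderiv_monom)
  ultimately show ?thesis by (simp add: poly_sum sum_distrib_right)
qed

context level
begin

lemma ulead_in_K: "ulead (pb k A) w c \<Longrightarrow> c \<in> tK T k"
  using over[of A] by (auto simp: ulead_def fpoly_over_def)

lemma lam_in_K: "lam \<in> tK T k"
  using over[of psi] shapeD(3)[OF psi(1)] by (auto simp: ylead_def fpoly_over_def)

end

section \<open>From level k to level k + 1\<close>

locale level_step = level +
  assumes Suc_le: "Suc k \<le> g"
begin

abbreviation q where "q \<equiv> tq T (Suc k)"
abbreviation m where "m \<equiv> tm T (Suc k)"
abbreviation P where "P \<equiv> tP T (Suc k)"
abbreviation N' where "N' \<equiv> tN T (Suc k)"
abbreviation z where "z \<equiv> tz T (Suc k)"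
abbreviation t where "t \<equiv> tt T (Suc k)"
abbreviation l where "l \<equiv> degree (tP T (Suc k))"
abbreviation \<kappa> where "\<kappa> \<equiv> fps_const (tz T (Suc k) powi ts T (Suc k)) + tc T (Suc k)"

definition s where "s = nat (ts T (Suc k))"

lemma st: "tower_step T (Suc k)"
  using step[of "Suc k"] Suc_le by simp

lemma N_gt: "N > 1" and ed: "edge_data (tK T k) (tH T k) q m P N'"
  and Pz: "poly P z = 0" and K': "tK T (Suc k) = adjoin (tK T k) z"
  and bez: "int q * ts T (Suc k) - int t * int m = 1"
  using st by (simp_all add: tower_step_def)

lemma H_ne: "tH T k \<noteq> monom 1 (degree (tH T k))"
  using H_not_monom[OF N_gt] H_deg by simp

lemma H_deg_pos: "degree (tH T k) > 0"
  using N_gt H_deg by simp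

lemmas line = edge_data_line[OF ed K H_deg_pos H_ne, unfolded H_deg]

lemma N_eq: "N = q * l * N'" and m_pos: "m > 0" and q_pos: "q > 0" and P0: "coeff P 0 \<noteq> 0"
  and cop: "coprime q m" and P_monic: "lead_coeff P = 1" and P_irr: "irreducible_over (tK T k) P"
  using line(1-3) ed by (simp_all add: edge_data_def)

lemma N'_pos: "N' > 0" and l_pos: "l > 0"
  using N_eq N_gt by (auto intro: Nat.gr0I)

lemma good: "good q m"
  using q_pos m_pos line(4) by (simp add: good_def)

lemma z_nz: "z \<noteq> 0"
proof
  assume "z = 0"
  then have "coeff P 0 = 0" using Pz by (simp add: poly_0_coeff_0)
  then show False using P0 by simp
qed

sublocale simple_ext "tK T k" P z
  by standard (use K P_irr P_monic Pz in auto)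

text \<open>Since the product of q and s_k is 1 + t m > 0, the integer s_k is positive and can be
  handled as a natural number.\<close>

lemma ts_eq: "ts T (Suc k) = int s" and qs: "q * s = t * m + 1"
proof -
  have "int q * ts T (Suc k) > 0" using bez by (smt (verit) of_nat_0_le_iff mult_nonneg_nonneg)
  then have "ts T (Suc k) > 0" using q_pos by (simp add: zero_less_mult_iff)
  then show ts: "ts T (Suc k) = int s" by (simp add: s_def)
  have "int (q * s) = int (t * m + 1)" using bez ts by simp
  then show "q * s = t * m + 1" by (simp only: of_nat_eq_iff)
qed

lemma K'_subfld: "subfld (tK T (Suc k))" and K_sub: "tK T k \<subseteq> tK T (Suc k)" and z_in: "z \<in> tK T (Suc k)"
  unfolding K' by (rule subfld_adjoin subset_adjoin generator_in_adjoin)+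

lemma of_nat_le_N: "0 < n \<Longrightarrow> n \<le> N \<Longrightarrow> of_nat n \<noteq> (0::'b)"
  using of_nat_neq_0(2)[of n] deg_F D_pos by (metis le_trans mult.right_neutral mult_le_mono2 One_nat_def Suc_leI)

lemma q_le: "q \<le> N" and l_le: "l \<le> N" and N'_le: "N' \<le> N"
  using N'_pos l_pos q_pos unfolding N_eq by simp_all

lemma G: "weierstrass (tG T (Suc k))" "degree (tG T (Suc k)) = N'" "fpoly_over (tK T (Suc k)) (tG T (Suc k))"
  and tc: "tc T (Suc k) = - coeff (tG T (Suc k)) (N' - 1) / of_nat N'"
  and tH: "tH T (Suc k) = pcompose (tG T (Suc k)) [:tc T (Suc k), 1:]"
  using st unfolding tower_step_def diff_Suc_1 by blast+

lemmas centred = weierstrass_centred[OF G(1,2) N'_pos of_nat_le_N[OF N'_pos N'_le], folded tc, folded tH]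

lemma tc_in: "tc T (Suc k) $ j \<in> tK T (Suc k)"
  using G(3) K'_subfld unfolding tc
  by (simp add: fps_nth_divide_of_nat of_nat_le_N[OF N'_pos N'_le] fpoly_over_def subfld_closed)

lemma sigma: "tsigma T (Suc k) = (fps_const (z ^ t) * fps_X ^ q, [:fps_X ^ m * \<kappa>, fps_X ^ m:])"
  by (simp add: tsigma_def)

lemma \<kappa>_0: "\<kappa> $ 0 = z ^ s"
  by (simp add: centred(1) ts_eq)

lemma pb_next: "pb (Suc k) A = pcompose (monom_subst (z ^ t) q m (pb k A)) [:\<kappa>, 1:]"
  unfolding pb_Suc[OF Suc_le] sigma monom_subst_def
  by (subst pcompose_subst_xy) (use q_pos in \<open>simp_all add: pcompose_pCons algebra_simps\<close>)

lemma over_next: "fpoly_over (tK T (Suc k)) (pb (Suc k) A)"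
proof -
  have "fpoly_over (tK T (Suc k)) (pb k A)" using over[of A] K_sub by (auto simp: fpoly_over_def)
  moreover have "\<kappa> $ j \<in> tK T (Suc k)" for j
    using tc_in[of j] K'_subfld z_in by (auto simp: ts_eq subfld_closed)
  ultimately show ?thesis unfolding pb_next
    by (intro fpoly_over_pcompose fpoly_over_monom_subst K'_subfld)
      (auto simp: q_pos z_in subfld_power K'_subfld)
qed

text \<open>Along the edge \<open>psi\<close> has leading form lam y and each a_i a constant one, so
  the sum has an explicit polynomial in y as leading form, which \<open>lead_sigma\<close>
  transports. Terms of weight above w enter with \<open>b i = 0\<close>.\<close>

lemma lead_next:
  assumes fin: "finite I" and ul: "\<And>i. i \<in> I \<Longrightarrow> ulead (pb k (a i)) (u i) (c i)"
    and w: "\<And>i. i \<in> I \<Longrightarrow> w \<le> q * u i + i * (q * V + m)"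
  defines "b \<equiv> (\<lambda>i. if q * u i + i * (q * V + m) = w then c i * lam ^ i else 0)"
  shows "lead (swap_xy (pb (Suc k) (\<Sum>i\<in>I. a i * psi ^ i))) w
    (pcompose (\<Sum>i\<in>I. monom (b i * z ^ (t * ((w - m * i) div q))) i) [:z ^ s, 1:])"
proof -
  let ?A = "\<Sum>i\<in>I. a i * psi ^ i"
  define p where "p = (\<Sum>i\<in>I. monom (b i) i)"
  have "lead (weighted q m (pb k (a i))) (q * u i) [:c i:]" if "i \<in> I" for i
    by (rule lead_weighted_ulead[OF q_pos m_pos ul[OF that]])
  from lead_power_sum[OF fin this lead_psi[OF good] w]
  have "lead (\<Sum>i\<in>I. weighted q m (pb k (a i)) * weighted q m (pb k psi) ^ i) w
    (\<Sum>i\<in>I. if q * u i + i * (q * V + m) = w then [:c i:] * [:0, lam:] ^ i else 0)" by simp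
  also have "(\<Sum>i\<in>I. if q * u i + i * (q * V + m) = w then [:c i:] * [:0, lam:] ^ i else 0) = p"
  proof -
    have "[:0, lam:] ^ i = monom (lam ^ i) i" for i
      using monom_power[of lam 1 i] by (simp add: monom_altdef)
    then show ?thesis unfolding p_def by (intro sum.cong) (auto simp: b_def smult_monom)
  qed
  also have "(\<Sum>i\<in>I. weighted q m (pb k (a i)) * weighted q m (pb k psi) ^ i) = weighted q m (pb k ?A)"
    by (simp only: pb_simps rhom_simps[OF rhom_weighted[OF q_pos]])
  finally have lp: "lead (weighted q m (pb k ?A)) w p" .
  have cp: "coeff p i = (if i \<in> I then b i else 0)" for i
    using fin by (simp add: p_def coeff_sum)
  have "(\<Sum>i\<le>degree p. monom (coeff p i * (z ^ t) ^ ((w - m * i) div q)) i)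
      = (\<Sum>i\<in>I. monom (b i * z ^ (t * ((w - m * i) div q))) i)"
  proof (rule poly_eqI)
    fix i
    have "coeff (\<Sum>i\<le>degree p. monom (coeff p i * (z ^ t) ^ ((w - m * i) div q)) i) i
      = coeff p i * (z ^ t) ^ ((w - m * i) div q)"
      by (auto simp: coeff_sum coeff_eq_0)
    also have "\<dots> = coeff (\<Sum>i\<in>I. monom (b i * z ^ (t * ((w - m * i) div q))) i) i"
      using fin by (simp add: cp coeff_sum power_mult)
    finally show "coeff (\<Sum>i\<le>degree p. monom (coeff p i * (z ^ t) ^ ((w - m * i) div q)) i) i
      = coeff (\<Sum>i\<in>I. monom (b i * z ^ (t * ((w - m * i) div q))) i) i" .
  qed
  then show ?thesis
    using lead_sigma[OF q_pos lp, of "z ^ t" \<kappa>] unfolding pb_Suc[OF Suc_le] sigma \<kappa>_0 by simp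
qed

lemma value_next:
  "coeff (pcompose (\<Sum>i\<in>I. monom (b i * z ^ (t * j i)) i) [:z ^ s, 1:]) 0 = (\<Sum>i\<in>I. b i * z ^ (t * j i + s * i))"
  by (simp add: coeff_pcompose_linear poly_sum poly_monom power_add power_mult[symmetric] mult.assoc)

lemma dg_next: "dg (Suc k) = (q * l) * D"
  by (simp add: dg_Suc tell_def)

lemma on_line: "q * u + i * (q * V + m) = w \<Longrightarrow> q * ((w - m * i) div q) + m * i = w"
proof -
  assume w: "q * u + i * (q * V + m) = w"
  then have "w - m * i = q * (u + i * V)" by (auto simp: algebra_simps)
  moreover have "m * i \<le> w" using w by (auto simp: algebra_simps)
  ultimately show ?thesis using q_pos by simp
qed

text \<open>In the expansion in powers of \<open>psi\<close> the exponents stay below q l by the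
  degree bound, and the coefficients are unit-like by \<open>small\<close>. The terms of least
  weight lie on one line, so \<open>line_sum_eq_0\<close> keeps their sum at y = 0 from
  vanishing.\<close>

lemma small_next:
  assumes "A \<noteq> 0" "degree A < dg (Suc k)"
  shows "\<exists>w c. c \<noteq> 0 \<and> ulead (pb (Suc k) A) w c"
proof -
  have dp: "degree psi > 0" using psi_monic D_pos by simp
  obtain a where a: "\<And>i. degree (a i) < degree psi" "A = (\<Sum>i<q * l. a i * psi ^ i)"
    using monic_expansion[OF psi_monic(1) dp, of A "q * l"] assms psi_monic(2) dg_next by auto
  define I where "I = {i. i < q * l \<and> a i \<noteq> 0}"
  have fin: "finite I" by (simp add: I_def)
  have A: "A = (\<Sum>i\<in>I. a i * psi ^ i)"
    unfolding a(2) I_def by (rule sum.mono_neutral_right) auto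
  have I0: "I \<noteq> {}" using A assms(1) by auto
  have "\<exists>w c. c \<noteq> 0 \<and> ulead (pb k (a i)) w c" if "i \<in> I" for i
    using small[of "a i"] a(1)[of i] that psi_monic(2) by (auto simp: I_def)
  then obtain u c where uc: "\<And>i. i \<in> I \<Longrightarrow> c i \<noteq> 0" "\<And>i. i \<in> I \<Longrightarrow> ulead (pb k (a i)) (u i) (c i)"
    by metis
  define w where "w = Min ((\<lambda>i. q * u i + i * (q * V + m)) ` I)"
  have w: "w \<le> q * u i + i * (q * V + m)" if "i \<in> I" for i using that fin by (simp add: w_def)
  have "w \<in> (\<lambda>i. q * u i + i * (q * V + m)) ` I" unfolding w_def by (rule Min_in) (use fin I0 in auto)
  then obtain i1 where i1: "i1 \<in> I" "q * u i1 + i1 * (q * V + m) = w" by auto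
  define b where "b i = (if q * u i + i * (q * V + m) = w then c i * lam ^ i else 0)" for i
  let ?j = "\<lambda>i. (w - m * i) div q"
  define J where "J = {i\<in>I. q * u i + i * (q * V + m) = w}"
  have "(\<Sum>i\<in>I. b i * z ^ (t * ?j i + s * i)) = (\<Sum>i\<in>J. b i * z ^ (t * ?j i + s * i))"
    by (rule sum.mono_neutral_right) (auto simp: J_def b_def fin)
  moreover have "(\<Sum>i\<in>J. b i * z ^ (t * ?j i + s * i)) \<noteq> 0"
  proof
    assume eq: "(\<Sum>i\<in>J. b i * z ^ (t * ?j i + s * i)) = 0"
    have "b i1 = 0"
    proof (rule line_sum_eq_0[OF z_nz cop q_pos qs _ _ _ _ eq])
      show "b i \<in> tK T k" if "i \<in> J" for i
        using that ulead_in_K[OF uc(2)] lam_in_K K by (auto simp: J_def b_def intro!: subfld_closed)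
      show "q * ?j i + m * i = w" if "i \<in> J" for i
        using that on_line[of "u i" i w] by (simp add: J_def)
    qed (use fin i1 in \<open>auto simp: J_def I_def\<close>)
    then show False using i1 uc(1) lam by (simp add: b_def)
  qed
  moreover have "ulead (pb (Suc k) A) w (\<Sum>i\<in>I. b i * z ^ (t * ?j i + s * i))"
    unfolding ulead_swap value_next[symmetric] A b_def using lead_next[OF fin uc(2) w] by blast
  ultimately show ?thesis by (intro exI conjI) simp_all
qed

text \<open>The weight of psi^(q l) along the edge; it becomes V at the next level.\<close>

definition V' where "V' = q * l * (q * V + m)"

text \<open>The converse of \<open>small_next\<close>: up to a power of z, c is a polynomial Q in z
  of degree below l over K_k, and the coefficients of Q are distributed over the l lattice points
  with y-exponent below q l on the line of weight w.\<close>

lemma lift_next: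
  assumes "c \<in> tK T (Suc k)" "V' \<le> w"
  shows "\<exists>A. degree A < dg (Suc k) \<and> ulead (pb (Suc k) A) w c"
proof -
  \<comment> \<open>Modulo q one has t m = -1 and hence m r = w, so the y-exponents on the line of
    weight w are those congruent to r modulo q.\<close>
  define r where "r = nat ((- (int t * int w)) mod int q)"
  have r: "r < q" "int r = (- (int t * int w)) mod int q" using q_pos by (auto simp: r_def nat_less_iff)
  have "int q dvd int t * int w + int r"
    unfolding r(2) by (simp add: dvd_eq_mod_eq_0 mod_add_right_eq)
  then have "int q dvd int m * (int t * int w + int r)" by (rule dvd_mult)
  also have "int m * (int t * int w + int r) = int q * (int s * int w) - (int w - int m * int r)"
  proof -
    have "int t * int m = int q * int s - 1" using qs by (metis add_diff_cancel_right' of_nat_1 of_nat_add of_nat_mult)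
    then have "int m * int t * int w = (int q * int s - 1) * int w" by (simp add: mult.commute)
    then show ?thesis by (simp add: algebra_simps)
  qed
  finally have dvd: "int q dvd int w - int m * int r"
    by (metis dvd_diff_right_iff dvd_triv_left)
  \<comment> \<open>The common exponent of z from \<open>line_exponent\<close>.\<close>
  define C where "C = (t * w + r) div q"
  have zC: "z ^ C \<noteq> 0" using z_nz by simp
  have "c / z ^ C \<in> adjoin (tK T k) z" using assms(1) K'_subfld z_in unfolding K' by (intro subfld_closed) auto
  then obtain Q where Q: "poly_over (tK T k) Q" "degree Q < l" "c / z ^ C = poly Q z"
    by (rule adjoin_reduced)
  define I where "I = {i. i < q * l \<and> i mod q = r}"
  have fin: "finite I" by (simp add: I_def)
  let ?j = "\<lambda>i. (w - m * i) div q"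
  \<comment> \<open>The bound \<open>V'\<close> on w leaves room for i factors \<open>psi\<close>:
    the coefficient of psi^i needs the value j - i V, and this is at least V, as \<open>lift\<close>
    requires.\<close>
  have key: "q * ?j i + m * i = w \<and> i * V + V \<le> ?j i" if i: "i \<in> I" for i
  proof -
    have "(q * V + m) * Suc i \<le> (q * V + m) * (q * l)" using i by (intro mult_le_mono2) (simp add: I_def)
    also have "\<dots> \<le> w" using assms(2) by (simp add: V'_def mult.commute)
    finally have ge: "(q * V + m) * Suc i \<le> w" .
    then have mi: "m * i + q * (i * V + V) \<le> w" by (simp add: algebra_simps)
    have "i = r + q * (i div q)" using i by (metis (mono_tags, lifting) I_def mem_Collect_eq mod_mult_div_eq)
    then have ieq: "int w - int m * int i = int w - int m * int r - int q * (int m * int (i div q))"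
      by (metis (no_types, lifting) diff_diff_eq distrib_left mult.left_commute of_nat_add of_nat_mult)
    have "int q dvd int w - int m * int i" unfolding ieq by (intro dvd_diff dvd dvd_triv_left)
    moreover have "int w - int m * int i = int (w - m * i)" using mi by (simp add: of_nat_diff)
    ultimately have "q dvd w - m * i" by simp
    then have e: "q * ?j i = w - m * i" by simp
    then have "q * (i * V + V) \<le> q * ?j i" using mi by simp
    then have "i * V + V \<le> ?j i" using q_pos by (simp only: nat_mult_le_cancel1)
    then show ?thesis using e mi by simp
  qed
  have "\<exists>A. degree A < D \<and> ulead (pb k A) (?j i - i * V) (coeff Q (i div q) / lam ^ i)" if "i \<in> I" for i
    by (rule lift) (use key[OF that] Q(1) lam_in_K K in \<open>auto simp: poly_over_def intro!: subfld_closed\<close>)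
  then obtain a0 where a0: "\<And>i. i \<in> I \<Longrightarrow> degree (a0 i) < D"
    "\<And>i. i \<in> I \<Longrightarrow> ulead (pb k (a0 i)) (?j i - i * V) (coeff Q (i div q) / lam ^ i)" by metis
  define a where "a i = (if i \<in> I then a0 i else 0)" for i
  define A where "A = (\<Sum>i\<in>I. a i * psi ^ i)"
  have weq: "q * (?j i - i * V) + i * (q * V + m) = w" if "i \<in> I" for i
  proof -
    have "?j i = (?j i - i * V) + i * V" using key[OF that] by simp
    then have "w = q * ((?j i - i * V) + i * V) + m * i" using key[OF that] by metis
    then show ?thesis by (simp add: algebra_simps)
  qed
  have ul: "ulead (pb k (a i)) (?j i - i * V) (coeff Q (i div q) / lam ^ i)" if "i \<in> I" for i
    using a0 that by (simp add: a_def)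
  have wle: "w \<le> q * (?j i - i * V) + i * (q * V + m)" if "i \<in> I" for i
    using weq[OF that] by simp
  have "ulead (pb (Suc k) A) w (\<Sum>i\<in>I. (if q * (?j i - i * V) + i * (q * V + m) = w
      then coeff Q (i div q) / lam ^ i * lam ^ i else 0) * z ^ (t * ?j i + s * i))"
    unfolding ulead_swap value_next[symmetric] A_def using lead_next[OF fin ul wle] by blast
  also have "(\<Sum>i\<in>I. (if q * (?j i - i * V) + i * (q * V + m) = w
      then coeff Q (i div q) / lam ^ i * lam ^ i else 0) * z ^ (t * ?j i + s * i))
    = (\<Sum>i\<in>I. z ^ C * (coeff Q (i div q) * z ^ (i div q)))"
  proof (rule sum.cong)
    fix i assume i: "i \<in> I"
    have "t * ?j i + s * i = C + i div q"
      using line_exponent[OF q_pos qs, of "?j i" i w] key[OF i] i by (simp add: C_def I_def)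
    then show "(if q * (?j i - i * V) + i * (q * V + m) = w
      then coeff Q (i div q) / lam ^ i * lam ^ i else 0) * z ^ (t * ?j i + s * i)
      = z ^ C * (coeff Q (i div q) * z ^ (i div q))"
      using weq[OF i] lam by (simp add: power_add)
  qed simp
  also have "\<dots> = z ^ C * (\<Sum>n<l. coeff Q n * z ^ n)"
  proof -
    have "(\<Sum>i\<in>I. coeff Q (i div q) * z ^ (i div q)) = (\<Sum>n<l. coeff Q n * z ^ n)"
    proof (rule sum.reindex_bij_witness[of _ "\<lambda>n. r + q * n" "\<lambda>i. i div q"])
      fix i assume i: "i \<in> I"
      show "r + q * (i div q) = i" using i by (auto simp: I_def)
      show "i div q \<in> {..<l}" using i by (auto simp: I_def less_mult_imp_div_less mult.commute)
    next
      fix n assume n: "n \<in> {..<l}"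
      then have "r + q * n < q + q * n" using r by simp
      also have "\<dots> = q * Suc n" by simp
      also have "\<dots> \<le> q * l" using n by (intro mult_le_mono2) simp
      finally show "r + q * n \<in> I" using r by (simp add: I_def)
      show "(r + q * n) div q = n" using r by simp
    qed simp
    then show ?thesis by (simp only: sum_distrib_left[symmetric])
  qed
  also have "(\<Sum>n<l. coeff Q n * z ^ n) = poly Q z"
    unfolding poly_altdef by (rule sum.mono_neutral_right[symmetric, THEN sym]) (use Q(2) in \<open>auto simp: coeff_eq_0\<close>)
  also have "z ^ C * poly Q z = c" using Q(3) zC by (metis nonzero_mult_div_cancel_left times_divide_eq_right)
  finally have "ulead (pb (Suc k) A) w c" .
  moreover have "degree A < dg (Suc k)"
  proof -
    have "A = (\<Sum>i<q * l. a i * psi ^ i)"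
      unfolding A_def I_def by (rule sum.mono_neutral_left) (auto simp: a_def I_def)
    moreover have "degree (a i) < D" for i using a0(1) D_pos by (simp add: a_def)
    moreover have "0 < q * l * D" using q_pos l_pos D_pos by simp
    ultimately show ?thesis using degree_power_sum[OF psi_monic(2), of a "q * l"] unfolding dg_next by auto
  qed
  ultimately show ?thesis by blast
qed

text \<open>Value and coefficient are chosen such that every term with psi^(q n) gets the same
  weight \<open>V'\<close>, with leading coefficient P_n lam^(q l).\<close>

definition P_lift :: "nat \<Rightarrow> 'a fps poly" where
  "P_lift n = (SOME A. degree A < D \<and> ulead (pb k A) ((q * V + m) * (l - n)) (coeff P n * lam ^ (q * (l - n))))"

lemma P_lift:
  assumes "n < l"
  shows "degree (P_lift n) < D" "ulead (pb k (P_lift n)) ((q * V + m) * (l - n)) (coeff P n * lam ^ (q * (l - n)))"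
proof -
  have "V \<le> q * V + m" using q_pos by (simp add: trans_le_add1)
  also have "\<dots> = (q * V + m) * 1" by simp
  also have "\<dots> \<le> (q * V + m) * (l - n)" by (rule mult_le_mono2) (use assms in linarith)
  finally have "V \<le> (q * V + m) * (l - n)" .
  moreover have "coeff P n * lam ^ (q * (l - n)) \<in> tK T k"
    using P_irr lam_in_K K by (auto simp: irreducible_over_def poly_over_def intro!: subfld_closed)
  ultimately have "\<exists>A. degree A < D \<and> ulead (pb k A) ((q * V + m) * (l - n)) (coeff P n * lam ^ (q * (l - n)))"
    by (intro lift)
  from someI_ex[OF this] show "degree (P_lift n) < D"
    "ulead (pb k (P_lift n)) ((q * V + m) * (l - n)) (coeff P n * lam ^ (q * (l - n)))"
    unfolding P_lift_def by blast+
qed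

text \<open>A lift of the edge polynomial \<open>P\<close>; after the substitution, the simple root \<open>z\<close> of \<open>P\<close> makes it linear in \<open>y\<close>.\<close>
lemma shape_next: "\<exists>G lam'. lam' \<noteq> 0 \<and> lead_coeff G = 1 \<and> degree G = dg (Suc k) \<and> ylead (pb (Suc k) G) V' lam'"
proof -
  define I where "I = {i. i \<le> q * l \<and> q dvd i}"
  define a where "a i = (if i = q * l then 1 else if i \<in> I then P_lift (i div q) else 0)" for i
  define u where "u i = (q * V + m) * (l - i div q)" for i
  define c where "c i = coeff P (i div q) * lam ^ (q * (l - i div q))" for i
  define G where "G = (\<Sum>i\<in>I. a i * psi ^ i)"
  have fin: "finite I" by (simp add: I_def)
  have idiv: "i div q < l" if "i < q * l" for i using that by (simp add: less_mult_imp_div_less mult.commute)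
  have ul: "ulead (pb k (a i)) (u i) (c i)" if "i \<in> I" for i
  proof (cases "i = q * l")
    case True
    then show ?thesis using ulead_pb_1 q_pos P_monic by (simp add: a_def u_def c_def)
  next
    case False
    then show ?thesis using P_lift(2)[OF idiv, of i] that by (auto simp: a_def u_def c_def I_def)
  qed
  have weq: "q * u i + i * (q * V + m) = V'" if i: "i \<in> I" for i
  proof -
    obtain n where n: "i = q * n" "n \<le> l" using i q_pos by (auto simp: I_def)
    have "q * u i + i * (q * V + m) = q * (q * V + m) * (l - n + n)"
      using q_pos unfolding u_def n(1) by (simp add: algebra_simps)
    then show ?thesis using n(2) by (simp add: V'_def mult_ac)
  qed
  define p where "p = (\<Sum>i\<in>I. monom (c i * lam ^ i * z ^ (t * ((V' - m * i) div q))) i)"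
  have peq: "p = (\<Sum>i\<in>I. monom ((if q * u i + i * (q * V + m) = V' then c i * lam ^ i else 0)
      * z ^ (t * ((V' - m * i) div q))) i)"
    unfolding p_def by (rule sum.cong) (simp_all add: weq)
  have wle: "V' \<le> q * u i + i * (q * V + m)" if "i \<in> I" for i using weq[OF that] by simp
  have lG: "lead (swap_xy (pb (Suc k) G)) V' (pcompose p [:z ^ s, 1:])"
    unfolding G_def peq by (rule lead_next[OF fin ul wle])
  \<comment> \<open>The exponents i are multiples of q here, and E is the common exponent of z on
    the line of weight \<open>V'\<close>. The form at y = z^s thus becomes a constant times
    P(z).\<close>
  define E where "E = t * (l * (q * V + m))"
  have ex: "c i * lam ^ i * z ^ (t * ((V' - m * i) div q)) * (z ^ s) ^ i = lam ^ (q * l) * z ^ E * (coeff P (i div q) * z ^ (i div q))"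
    if i: "i \<in> I" for i
  proof -
    obtain n where n: "i = q * n" "n \<le> l" using i q_pos by (auto simp: I_def)
    have "q * (l - n) + q * n = q * l" using n(2) by (simp flip: add_mult_distrib2)
    then have L: "lam ^ (q * (l - n)) * lam ^ (q * n) = lam ^ (q * l)" by (simp flip: power_add)
    have "t * ((V' - m * i) div q) + s * i = (t * V' + i mod q) div q + i div q"
      by (rule line_exponent[OF q_pos qs on_line[OF weq[OF i]]])
    also have "\<dots> = E + n" using q_pos by (simp add: V'_def E_def n(1) mult_ac)
    finally have Z: "z ^ (t * ((V' - m * i) div q)) * (z ^ s) ^ i = z ^ E * z ^ n" by (simp flip: power_add power_mult)
    have "c i * lam ^ i * z ^ (t * ((V' - m * i) div q)) * (z ^ s) ^ i
      = coeff P n * (lam ^ (q * (l - n)) * lam ^ (q * n)) * (z ^ (t * ((V' - m * i) div q)) * (z ^ s) ^ i)"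
      using q_pos by (simp add: c_def n(1) mult_ac)
    also have "\<dots> = lam ^ (q * l) * z ^ E * (coeff P (i div q) * z ^ (i div q))"
      unfolding L Z using q_pos by (simp add: n(1) mult_ac)
    finally show ?thesis .
  qed
  have re: "(\<Sum>i\<in>I. f (i div q)) = (\<Sum>n\<le>l. f n)" for f :: "nat \<Rightarrow> 'b"
    by (rule sum.reindex_bij_witness[of _ "\<lambda>n. q * n" "\<lambda>i. i div q"])
      (use q_pos in \<open>auto simp: I_def\<close>)
  have "poly p (z ^ s) = (\<Sum>i\<in>I. lam ^ (q * l) * z ^ E * (coeff P (i div q) * z ^ (i div q)))"
    unfolding p_def poly_sum poly_monom by (rule sum.cong) (simp_all only: ex)
  also have "\<dots> = lam ^ (q * l) * z ^ E * poly P z"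
    unfolding re[of "\<lambda>n. lam ^ (q * l) * z ^ E * (coeff P n * z ^ n)"] poly_altdef by (simp add: sum_distrib_left)
  finally have p0: "poly p (z ^ s) = 0" using Pz by simp
  \<comment> \<open>The Euler operator multiplies the term with i = q n by q n, which yields q z
    P'(z) times the same constant.\<close>
  have "poly (pderiv p) (z ^ s) * z ^ s
      = (\<Sum>i\<in>I. of_nat i * (c i * lam ^ i * z ^ (t * ((V' - m * i) div q))) * (z ^ s) ^ i)"
    unfolding p_def by (rule poly_pderiv_monom_sum)
  also have "\<dots> = (\<Sum>i\<in>I. of_nat q * lam ^ (q * l) * z ^ E * (of_nat (i div q) * coeff P (i div q) * z ^ (i div q)))"
  proof (rule sum.cong)
    fix i assume i: "i \<in> I"
    have "(of_nat i :: 'b) = of_nat q * of_nat (i div q)"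
      using i by (simp add: I_def flip: of_nat_mult)
    then show "of_nat i * (c i * lam ^ i * z ^ (t * ((V' - m * i) div q))) * (z ^ s) ^ i
      = of_nat q * lam ^ (q * l) * z ^ E * (of_nat (i div q) * coeff P (i div q) * z ^ (i div q))"
      using ex[OF i] by (simp add: mult_ac)
  qed simp
  also have "\<dots> = of_nat q * lam ^ (q * l) * z ^ E * (\<Sum>n\<le>l. of_nat n * coeff P n * z ^ n)"
    unfolding re[of "\<lambda>n. of_nat q * lam ^ (q * l) * z ^ E * (of_nat n * coeff P n * z ^ n)"] by (simp add: sum_distrib_left)
  also have "(\<Sum>n\<le>l. of_nat n * coeff P n * z ^ n) = poly (pderiv P) z * z"
    using poly_pderiv_monom_sum[of "coeff P" "{..l}" z] by (simp add: poly_as_sum_of_monoms)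
  finally have pd: "poly (pderiv p) (z ^ s) * z ^ s = of_nat q * lam ^ (q * l) * z ^ E * (poly (pderiv P) z * z)" .
  \<comment> \<open>P' has smaller degree than P, so it can vanish at z only identically; but its
    coefficient l in degree l - 1 is nonzero, as l \<le> N \<le> degree of F.\<close>
  have "poly (pderiv P) z \<noteq> 0"
  proof
    assume "poly (pderiv P) z = 0"
    moreover have "poly_over (tK T k) (pderiv P)"
      using P_over K by (auto simp: poly_over_def coeff_pderiv intro!: subfld_mult subfld_of_nat simp del: of_nat_Suc)
    moreover have "degree (pderiv P) < l" 
    proof -
      have "degree (pderiv P) \<le> l - 1" by (rule degree_le) (auto simp: coeff_pderiv coeff_eq_0)
      then show ?thesis using l_pos by linarith
    qed
    ultimately have "pderiv P = 0" by (intro root_degree)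
    then have "coeff (pderiv P) (l - 1) = 0" by simp
    then have "of_nat l = (0::'b)" using l_pos P_monic by (simp add: coeff_pderiv del: of_nat_Suc)
    then show False using of_nat_le_N[OF l_pos l_le] by simp
  qed
  then have "poly (pderiv p) (z ^ s) \<noteq> 0"
    using pd z_nz lam of_nat_le_N[OF q_pos q_le] by auto
  moreover have "ylead (pb (Suc k) G) V' (poly (pderiv p) (z ^ s))"
    unfolding ylead_swap using lG coeff_pcompose_linear[of p "z ^ s"] p0 by (metis One_nat_def)
  moreover have "degree G = dg (Suc k)" "lead_coeff G = 1"
  proof -
    define R where "R = (\<Sum>i<q * l. a i * psi ^ i)"
    have I: "I = insert (q * l) (I - {q * l})" by (auto simp: I_def)
    have "G = psi ^ (q * l) + (\<Sum>i\<in>I - {q * l}. a i * psi ^ i)"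
      unfolding G_def by (subst I, subst sum.insert) (use fin in \<open>auto simp: a_def\<close>)
    also have "(\<Sum>i\<in>I - {q * l}. a i * psi ^ i) = R"
      unfolding R_def by (rule sum.mono_neutral_left) (auto simp: I_def a_def)
    finally have GR: "G = psi ^ (q * l) + R" .
    have "psi \<noteq> 0" using psi_monic by auto
    then have d: "degree (psi ^ (q * l)) = q * l * D" by (simp add: degree_power_eq psi_monic)
    have lc: "lead_coeff (psi ^ (q * l)) = 1" by (simp only: lead_coeff_power psi_monic(1) power_one)
    define a' where "a' i = (if i < q * l then a i else 0)" for i
    have "degree (a' i) < D" for i using P_lift(1)[OF idiv, of i] D_pos by (auto simp: a_def a'_def)
    moreover have "R = (\<Sum>i<q * l. a' i * psi ^ i)" by (simp add: R_def a'_def)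
    ultimately have "R = 0 \<or> degree R < q * l * D" using degree_power_sum[OF psi_monic(2), of a'] by simp
    then have dR: "degree R < degree (psi ^ (q * l))" using q_pos l_pos D_pos by (auto simp: d)
    show dG: "degree G = dg (Suc k)" unfolding GR dg_next by (subst degree_add_eq_left[OF dR]) (simp add: d)
    have "lead_coeff (R + psi ^ (q * l)) = lead_coeff (psi ^ (q * l))" by (rule lead_coeff_add_le[OF dR])
    then show "lead_coeff G = 1" unfolding GR lc by (simp only: add.commute)
  qed
  ultimately show ?thesis by blast
qed

lemma ulead_0_next:
  assumes "ulead A 0 c"
  shows "ulead (subst_xy A (tsigma T (Suc k))) 0 c"
proof -
  have "lead (weighted q m A) (q * 0) [:c:]" by (rule lead_weighted_ulead[OF q_pos m_pos assms])
  then have "lead (weighted q m A) 0 [:c:]" by simp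
  from lead_sigma[OF q_pos this, of "z ^ t" \<kappa>] show ?thesis
    unfolding sigma ulead_swap by (intro exI conjI) (auto simp: monom_0)
qed

text \<open>The tower step factors H_k under the substitution without \<open>tc\<close>. Translating
  y by \<open>tc\<close> gives the factorisation under \<open>tsigma\<close>, and the power of z
  that comes from x^v is absorbed into the unit.\<close>

lemma pb_F_next: "\<exists>v' U'. pb (Suc k) F = [:fps_X ^ v':] * (tH T (Suc k) * U') \<and> coeff U' 0 $ 0 \<noteq> 0"
proof -
  let ?\<sigma>' = "(fps_const (z ^ t) * fps_X ^ q, [:fps_X ^ m * fps_const (z powi ts T (Suc k)), fps_X ^ m:])"
  let ?M = "q * m * tell T (Suc k) * N'"
  obtain W where W: "fps2_unit_over (tK T (Suc k)) W"
    "fps_of_poly (subst_xy (tH T k) ?\<sigma>') = fps_const (fps_X ^ ?M) * fps_of_poly (tG T (Suc k)) * W"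
    using st unfolding tower_step_def diff_Suc_1 by blast
  have "degree (tG T (Suc k)) > 0" using G(2) N'_pos by simp
  from weierstrass_division[OF G(1) this W(2)] obtain W' where
    W': "subst_xy (tH T k) ?\<sigma>' = [:fps_X ^ ?M:] * (tG T (Suc k) * W')" "coeff W' 0 = W $ 0" by blast
  obtain Y where "W * Y = 1" using W(1) by (auto simp: fps2_unit_over_def)
  then have "(W * Y) $ 0 $ 0 = 1" by simp
  then have W0: "coeff W' 0 $ 0 \<noteq> 0" unfolding W'(2) by auto
  let ?c = "[:tc T (Suc k), 1:]"
  have "subst_xy (tH T k) (tsigma T (Suc k)) = pcompose (subst_xy (tH T k) ?\<sigma>') ?c"
    unfolding sigma by (subst pcompose_subst_xy) (use q_pos in \<open>simp_all add: pcompose_pCons algebra_simps\<close>)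
  also have "\<dots> = [:fps_X ^ ?M:] * (tH T (Suc k) * pcompose W' ?c)"
    unfolding W'(1) tH by (simp add: pcompose_mult pcompose_smult)
  finally have HH: "subst_xy (tH T k) (tsigma T (Suc k)) = [:fps_X ^ ?M:] * (tH T (Suc k) * pcompose W' ?c)" .
  have W'c: "coeff (pcompose W' ?c) 0 $ 0 = coeff W' 0 $ 0"
  proof -
    have "lead (swap_xy W') 0 (swap_xy W' $ 0)" by (simp add: lead_def)
    from lead_translate[OF this, of "tc T (Suc k)"] have "swap_xy (pcompose W' ?c) $ 0 = swap_xy W' $ 0"
      by (simp add: lead_def centred(1))
    then show ?thesis by (metis coeff_swap_xy)
  qed
  have "ulead U 0 (coeff U 0 $ 0)" by (simp add: ulead_def)
  then have Us: "coeff (subst_xy U (tsigma T (Suc k))) 0 $ 0 = coeff U 0 $ 0"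
    using ulead_0_next by (auto simp: ulead_def)
  have rs: "rhom (\<lambda>H. subst_xy H (tsigma T (Suc k)))"
    by (rule rhom_subst_xy) (use q_pos in \<open>simp add: sigma\<close>)
  have X: "subst_xy [:fps_X ^ v:] (tsigma T (Suc k)) = [:fps_X ^ (q * v) * fps_const (z ^ (t * v)):]"
  proof -
    have "fps_X ^ v oo (fps_const (z ^ t) * fps_X ^ q) = (fps_const (z ^ t) * fps_X ^ q) ^ v"
      using q_pos by (simp add: fps_compose_power[symmetric])
    also have "\<dots> = fps_X ^ (q * v) * fps_const (z ^ (t * v))"
      unfolding power_mult_distrib power_mult fps_const_power by (rule mult.commute)
    finally show ?thesis by (simp only: subst_xy_const sigma fst_conv)
  qed
  define U' where "U' = [:fps_const (z ^ (t * v)):] * (pcompose W' ?c * subst_xy U (tsigma T (Suc k)))"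
  have "pb (Suc k) F = subst_xy [:fps_X ^ v:] (tsigma T (Suc k))
      * (subst_xy (tH T k) (tsigma T (Suc k)) * subst_xy U (tsigma T (Suc k)))"
    unfolding pb_Suc[OF Suc_le] pb_F by (simp only: rhom_mult[OF rs])
  also have "\<dots> = [:fps_X ^ (q * v) * fps_X ^ ?M:] * (tH T (Suc k) * U')"
    unfolding X HH U'_def by (simp add: mult_ac)
  finally have "pb (Suc k) F = [:fps_X ^ (q * v + ?M):] * (tH T (Suc k) * U')" by (simp only: power_add)
  moreover have "coeff U' 0 $ 0 \<noteq> 0"
    using W0 U0 z_nz W'c Us by (simp add: U'_def coeff_mult)
  ultimately show ?thesis by blast
qed

lemma level_next: "\<exists>V lam mu e v U. level emb F g T (Suc k) V lam mu e v U"
proof -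
  obtain v' U' where U': "pb (Suc k) F = [:fps_X ^ v':] * (tH T (Suc k) * U')" "coeff U' 0 $ 0 \<noteq> 0"
    using pb_F_next by blast
  obtain lam' where lam': "lam' \<noteq> 0" "\<exists>G. lead_coeff G = 1 \<and> degree G = dg (Suc k) \<and> ylead (pb (Suc k) G) V' lam'"
    using shape_next by blast
  have "level emb F g T (Suc k) V' lam' (mu * z ^ (t * e)) (q * e) v' U'"
  proof unfold_locales
    show "Suc k \<le> g" by (rule Suc_le)
    show "subfld (tK T (Suc k))" by (rule K'_subfld)
    show "degree F = N' * dg (Suc k)" unfolding dg_next deg_F N_eq by (simp add: mult_ac)
    show "N' > 0" by (rule N'_pos)
    show "weierstrass (tH T (Suc k))" "degree (tH T (Suc k)) = N'" "coeff (tH T (Suc k)) (N' - 1) = 0"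
      by (rule centred(2-4))+
    show "fst (tpi T (Suc k)) = fps_const (mu * z ^ (t * e)) * fps_X ^ (q * e)"
      using q_pos by (simp add: comp_xy_def fst_tpi sigma fps_compose_mult_distrib fps_compose_power[symmetric]
          power_mult_distrib fps_const_power power_mult[symmetric] mult_ac flip: fps_const_mult)
    show "mu * z ^ (t * e) \<noteq> 0" using mu(1) z_nz by simp
    show "mu * z ^ (t * e) \<in> tK T (Suc k)" using mu(2) K_sub z_in K'_subfld by (auto intro!: subfld_closed)
    show "q * e > 0" using q_pos e_pos by simp
  qed (use U' lam' over_next small_next lift_next in auto)
  then show ?thesis by blast
qed

end

section \<open>The base level and the induction over all levels\<close>

context approximant_tower
begin

lemma level_0: "level emb F g T 0 0 1 1 1 0 1"
proof unfold_locales
  let ?d = "degree F" and ?F = "map_poly (fps_map emb) F"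
  have f0: "fps_map emb 0 = 0" and f1: "fps_map emb 1 = 1"
    using rhom_0[OF rhom_fps_map[OF rhom_emb]] rhom_1[OF rhom_fps_map[OF rhom_emb]] by auto
  have nth: "fps_map emb a $ j = emb (a $ j)" for a j by (simp add: fps_map_def)
  have K: "tK T 0 = range emb" and N: "tN T 0 = ?d"
    and c: "tc T 0 = - fps_map emb (coeff F (?d - 1)) / of_nat ?d"
    and H: "tH T 0 = pcompose ?F [:tc T 0, 1:]"
    using start by (simp_all add: tower_start_def)
  have lF: "lead_coeff F = 1" using F_W by (simp add: weierstrass_def)
  have dF: "degree ?F = ?d" by (rule degree_map_poly) (auto simp: fps_eq_iff nth emb_eq_0_iff)
  have cF: "coeff ?F i = fps_map emb (coeff F i)" for i by (simp add: coeff_map_poly f0)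
  have W: "weierstrass ?F"
    using F_W rhom_0[OF rhom_emb] by (simp add: weierstrass_def dF cF f1 nth)
  have d0: "of_nat ?d \<noteq> (0::'b)" "of_nat ?d \<noteq> (0::'a)" using of_nat_neq_0[of ?d] F_deg by auto
  have c': "tc T 0 = - coeff ?F (?d - 1) / of_nat ?d" by (simp add: c cF)
  note cen = weierstrass_centred[OF W dF F_deg d0(1), folded c', folded H]
  show "subfld (tK T 0)"
  proof -
    have "inverse (emb a) = emb (inverse a)" for a
      using rhom_mult[OF rhom_emb, of a "inverse a"] rhom_1[OF rhom_emb] rhom_0[OF rhom_emb]
      by (cases "a = 0") (auto intro: inverse_unique)
    then show ?thesis
      unfolding K subfld_def
      using rhom_0[OF rhom_emb] rhom_1[OF rhom_emb] rhom_add[OF rhom_emb] rhom_mult[OF rhom_emb] rhom_uminus[OF rhom_emb]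
      by (auto simp: image_iff) metis+
  qed
  then have Ks: "subfld (tK T 0)" .
  show "?d = tN T 0 * dg 0" by (simp add: N dg_0)
  show "tN T 0 > 0" using F_deg by (simp add: N)
  show "weierstrass (tH T 0)" "degree (tH T 0) = tN T 0" "coeff (tH T 0) (tN T 0 - 1) = 0"
    using cen N by simp_all
  show "pb 0 F = [:fps_X ^ 0:] * (tH T 0 * 1)" by (simp add: pb_0 H)
  show "fst (tpi T 0) = fps_const 1 * fps_X ^ 1" by simp
  show "1 \<in> tK T 0" by (rule subfld_1[OF Ks])
  show "fpoly_over (tK T 0) (pb 0 G)" for G
  proof -
    have "tc T 0 $ j \<in> tK T 0" for j
      using Ks unfolding c by (auto simp: fps_nth_divide_of_nat[OF d0(1)] nth K intro!: subfld_divide subfld_uminus subfld_of_nat)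
    then show ?thesis unfolding pb_0
      by (intro fpoly_over_pcompose Ks) (auto simp: fpoly_over_def coeff_map_poly f0 nth K)
  qed
  show "\<exists>w c. c \<noteq> 0 \<and> ulead (pb 0 A) w c" if A: "A \<noteq> 0" "degree A < dg 0" for A
  proof -
    obtain a where a: "A = [:a:]" using A(2) by (auto simp: dg_0 elim: degree_eq_zeroE)
    then have "a \<noteq> 0" using A(1) by simp
    have "pb 0 A = [:fps_map emb a:]" unfolding a pb_const by simp
    then have "ulead (pb 0 A) (subdegree a) (emb (a $ subdegree a))"
      using rhom_0[OF rhom_emb] by (auto simp: ulead_def nth coeff_pCons split: nat.splits)
    moreover have "emb (a $ subdegree a) \<noteq> 0" using \<open>a \<noteq> 0\<close> emb_eq_0_iff by simp
    ultimately show ?thesis by blast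
  qed
  show "\<exists>A. degree A < dg 0 \<and> ulead (pb 0 A) w c" if c: "c \<in> tK T 0" for c w
  proof -
    obtain a where a: "c = emb a" using c by (auto simp: K)
    have "pb 0 [:fps_const a * fps_X ^ w:] = [:fps_map emb (fps_const a * fps_X ^ w):]" unfolding pb_const by simp
    then have "ulead (pb 0 [:fps_const a * fps_X ^ w:]) w c"
      using rhom_0[OF rhom_emb] by (auto simp: ulead_def nth a coeff_pCons split: nat.splits)
    then show ?thesis by (intro exI[of _ "[:fps_const a * fps_X ^ w:]"]) (simp add: dg_0)
  qed
  show "\<exists>G. lead_coeff G = 1 \<and> degree G = dg 0 \<and> ylead (pb 0 G) 0 1"
  proof -
    \<comment> \<open>This is y - c_0, which the shift of level 0 carries to y; hence V = 0 and lam
      = 1.\<close>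
    let ?G = "[:coeff F (?d - 1) / of_nat ?d, 1:]"
    have "fps_map emb (coeff F (?d - 1) / of_nat ?d) = - tc T 0"
    proof (rule fps_ext)
      fix j
      have "emb (a / of_nat ?d) = emb a / of_nat ?d" for a
        using rhom_mult[OF rhom_emb, of "a / of_nat ?d" "of_nat ?d"] rhom_of_nat[OF rhom_emb] d0
        by (simp add: field_simps)
      then show "fps_map emb (coeff F (?d - 1) / of_nat ?d) $ j = (- tc T 0) $ j"
        unfolding c fps_neg_nth by (simp add: nth fps_nth_divide_of_nat[OF d0(1)] fps_nth_divide_of_nat[OF d0(2)])
    qed
    then have "pb 0 ?G = [:0, 1:]" by (simp add: pb_0 map_poly_pCons f0 f1 pcompose_pCons)
    then show ?thesis by (intro exI[of _ ?G]) (simp add: dg_0 ylead_def coeff_pCons split: nat.splits)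
  qed
qed simp_all

lemma level_ex: "k \<le> g \<Longrightarrow> \<exists>V lam mu e v U. level emb F g T k V lam mu e v U"
proof (induction k)
  case 0
  then show ?case using level_0 by blast
next
  case (Suc k)
  then obtain V lam mu e v U where "level emb F g T k V lam mu e v U" by auto
  then interpret level emb F g T k V lam mu e v U .
  interpret level_step emb F g T k V lam mu e v U by standard (rule Suc.prems)
  show ?case by (rule level_next)
qed

end

section \<open>Values of the approximate roots and independence of their leading coefficients\<close>

context approximant_tower
begin

abbreviation Vn :: "nat \<Rightarrow> nat \<Rightarrow> nat" where "Vn \<equiv> V_entry emb T"
abbreviation Ln :: "nat \<Rightarrow> nat \<Rightarrow> 'b" where "Ln k j \<equiv> lambda_k emb T k (Phi emb T j)"

lemma ulead_values:
  assumes "ulead (pb k H) w c" "c \<noteq> 0"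
  shows "the_enat (vk emb T k H) = w" "lambda_k emb T k H = c"
proof -
  have "H \<noteq> 0" using assms by (auto simp: ulead_def rhom_0[OF rhom_pb])
  then show "the_enat (vk emb T k H) = w" "lambda_k emb T k H = c"
    using ulead_vx[OF assms] by (simp_all add: vk_def lambda_k_def)
qed

text \<open>Positions up to k are the original indices below k, whose polynomials have a unit-like
  pullback at level k. The last position is still linear in y and is treated in
  \<open>entry_last\<close>. The same value and coefficient serve for \<phi> and \<psi>.\<close>

definition entries :: "nat \<Rightarrow> bool" where
  "entries k \<longleftrightarrow> (\<forall>j\<le>k. Ln k j \<noteq> 0 \<and> ulead (pb k (Phi emb T j)) (Vn k j) (Ln k j)
    \<and> ulead (pb k (Psi F T j)) (Vn k j) (Ln k j))"

lemma entriesI: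
  assumes "ulead (pb k (Phi emb T j)) w c" "ulead (pb k (Psi F T j)) w c" "c \<noteq> 0"
  shows "Ln k j \<noteq> 0 \<and> ulead (pb k (Phi emb T j)) (Vn k j) (Ln k j) \<and> ulead (pb k (Psi F T j)) (Vn k j) (Ln k j)
    \<and> Vn k j = w \<and> Ln k j = c"
  using ulead_values[OF assms(1,3)] assms by (simp add: V_entry_def)

lemma entries_0: "entries 0" "Vn 0 0 = 1" "Ln 0 0 = 1"
proof -
  have "pb 0 [:fps_X:] = [:fps_X:]"
    using pb_X_power[of 0 1] by simp
  then have "ulead (pb 0 [:fps_X:]) 1 1" by (auto simp: ulead_def coeff_pCons split: nat.splits)
  then show "entries 0" "Vn 0 0 = 1" "Ln 0 0 = 1"
    using entriesI[of 0 0 1 1] by (auto simp: entries_def Phi_def Psi_def)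
qed

end

context level
begin

lemma Phi_last: "Phi emb T (Suc k) = phi" and Psi_last: "Psi F T (Suc k) = psi"
  by (simp_all add: Phi_def phi_def Psi_def psi_def)

lemma entry_last: "Vn k (Suc k) = V" "Ln k (Suc k) = lam"
proof -
  have "phi \<noteq> 0" using shapeD(1)[OF phi(1)] by auto
  then show "Vn k (Suc k) = V" "Ln k (Suc k) = lam"
    unfolding V_entry_def Phi_last using ylead_vx[OF shapeD(3)[OF phi(1)] lam]
    by (simp_all add: vk_def lambda_k_def)
qed

lemma entry_first: "Vn k 0 = e" "Ln k 0 = mu"
proof -
  have "pb k [:fps_X:] = [:fps_const mu * fps_X ^ e:]" using pb_X_power[of k 1] by (simp add: fst_tpi)
  then have "ulead (pb k [:fps_X:]) e mu" by (auto simp: ulead_def coeff_pCons split: nat.splits)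
  from ulead_values[OF this mu(1)] show "Vn k 0 = e" "Ln k 0 = mu"
    by (simp_all add: V_entry_def Phi_def)
qed

lemma emb_in_K: "emb c \<in> tK T k"
proof -
  have "pb k [:fps_const c:] = [:fps_const (emb c):]"
  proof -
    have "fps_map emb (fps_const c) = fps_const (emb c)"
      using rhom_0[OF rhom_emb] by (intro fps_ext) (simp add: fps_map_def)
    then show ?thesis by (simp add: pb_const)
  qed
  then have "coeff (pb k [:fps_const c:]) 0 $ 0 = emb c" by simp
  then show ?thesis using over[of "[:fps_const c:]"] unfolding fpoly_over_def by metis
qed

end

context level_step
begin

lemma ulead_step:
  assumes "ulead (pb k A) w c"
  shows "ulead (pb (Suc k) A) (q * w) (c * z ^ (t * w))"
proof -
  have "lead (weighted q m (pb k A)) (q * w) [:c:]" by (rule lead_weighted_ulead[OF q_pos m_pos assms])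
  from lead_sigma[OF q_pos this, of "z ^ t" \<kappa>]
  have "lead (swap_xy (pb (Suc k) A)) (q * w)
      (pcompose (\<Sum>i\<le>degree [:c:]. monom (coeff [:c:] i * (z ^ t) ^ ((q * w - m * i) div q)) i) [:\<kappa> $ 0, 1:])"
    unfolding pb_Suc[OF Suc_le] sigma .
  moreover have "coeff (pcompose (\<Sum>i\<le>degree [:c:]. monom (coeff [:c:] i * (z ^ t) ^ ((q * w - m * i) div q)) i) [:\<kappa> $ 0, 1:]) 0
      = c * z ^ (t * w)"
    using q_pos by (simp add: monom_0 power_mult)
  ultimately show ?thesis unfolding ulead_swap by blast
qed

text \<open>The translation of y by z^s turns the linear leading form into a nonzero constant, so
  \<open>phi\<close> and \<open>psi\<close> become unit-like one level later.\<close>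

lemma ulead_step_linear:
  assumes "lead (weighted q m (pb k A)) (q * V + m) [:0, lam:]"
  shows "ulead (pb (Suc k) A) (q * V + m) (lam * z ^ (t * V + s))"
proof -
  have "(\<Sum>i\<le>degree [:0, lam:]. monom (coeff [:0, lam:] i * (z ^ t) ^ ((q * V + m - m * i) div q)) i) = [:0, lam * z ^ (t * V):]"
    using lam q_pos by (simp add: monom_altdef power_mult)
  from lead_sigma[OF q_pos assms, of "z ^ t" \<kappa>, unfolded this]
  have "lead (swap_xy (pb (Suc k) A)) (q * V + m) (pcompose [:0, lam * z ^ (t * V):] [:z ^ s, 1:])"
    unfolding pb_Suc[OF Suc_le] sigma \<kappa>_0 .
  moreover have "coeff (pcompose [:0, lam * z ^ (t * V):] [:z ^ s, 1:]) 0 = lam * z ^ (t * V + s)"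
    by (simp add: pcompose_pCons power_add)
  ultimately show ?thesis unfolding ulead_swap by blast
qed

lemma entries_next:
  assumes "entries k"
  shows "entries (Suc k)"
    and "j \<le> k \<Longrightarrow> Vn (Suc k) j = q * Vn k j \<and> Ln (Suc k) j = Ln k j * z ^ (t * Vn k j)"
    and "Vn (Suc k) (Suc k) = q * V + m" "Ln (Suc k) (Suc k) = lam * z ^ (t * V + s)"
proof -
  have 1: "Ln (Suc k) j \<noteq> 0 \<and> ulead (pb (Suc k) (Phi emb T j)) (Vn (Suc k) j) (Ln (Suc k) j)
      \<and> ulead (pb (Suc k) (Psi F T j)) (Vn (Suc k) j) (Ln (Suc k) j)
      \<and> Vn (Suc k) j = q * Vn k j \<and> Ln (Suc k) j = Ln k j * z ^ (t * Vn k j)" if "j \<le> k" for j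
    by (rule entriesI) (use assms that z_nz in \<open>auto simp: entries_def intro!: ulead_step\<close>)
  have 2: "Ln (Suc k) (Suc k) \<noteq> 0 \<and> ulead (pb (Suc k) (Phi emb T (Suc k))) (Vn (Suc k) (Suc k)) (Ln (Suc k) (Suc k))
      \<and> ulead (pb (Suc k) (Psi F T (Suc k))) (Vn (Suc k) (Suc k)) (Ln (Suc k) (Suc k))
      \<and> Vn (Suc k) (Suc k) = q * V + m \<and> Ln (Suc k) (Suc k) = lam * z ^ (t * V + s)"
    by (rule entriesI) (use lam z_nz in \<open>auto simp: Phi_last Psi_last intro!: ulead_step_linear lead_phi lead_psi good\<close>)
  show "entries (Suc k)" unfolding entries_def using 1 2 le_Suc_eq by blast
  show "j \<le> k \<Longrightarrow> Vn (Suc k) j = q * Vn k j \<and> Ln (Suc k) j = Ln k j * z ^ (t * Vn k j)" using 1 by blast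
  show "Vn (Suc k) (Suc k) = q * V + m" "Ln (Suc k) (Suc k) = lam * z ^ (t * V + s)" using 2 by blast+
qed

end

section \<open>Linear independence of the leading coefficients over K\<close>

context approximant_tower
begin

text \<open>Only b_k = 0 is considered: for fixed b_k the last factor is a common constant, restored
  in \<open>independent_exponents_at\<close>.\<close>

definition low_exps :: "nat \<Rightarrow> nat \<Rightarrow> (nat \<Rightarrow> nat) set" where
  "low_exps k w = {B \<in> exponents T k. B (Suc k) = 0 \<and> (\<Sum>j\<le>k. B j * Vn k j) = w}"

definition low_mon :: "nat \<Rightarrow> (nat \<Rightarrow> nat) \<Rightarrow> 'b" where
  "low_mon k B = (\<Prod>j\<le>k. Ln k j ^ B j)"

definition independent_at :: "nat \<Rightarrow> bool" where
  "independent_at k \<longleftrightarrow> (\<forall>w h. (\<Sum>B\<in>low_exps k w. emb (h B) * low_mon k B) = 0 \<longrightarrow> (\<forall>B\<in>low_exps k w. h B = 0))"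

lemma finite_exponents_bounded: "finite {B \<in> exponents T k. B 0 \<le> M \<and> B (Suc k) \<le> M'}"
proof -
  define C where "C = M + M' + (\<Sum>i\<in>{1..k}. tq T i * tell T i)"
  have "{B \<in> exponents T k. B 0 \<le> M \<and> B (Suc k) \<le> M'} \<subseteq>
    {B. \<forall>j. (j \<in> {..Suc k} \<longrightarrow> B j \<in> {..C}) \<and> (j \<notin> {..Suc k} \<longrightarrow> B j = 0)}"
  proof (intro subsetI CollectI allI conjI impI)
    fix B j
    assume B: "B \<in> {B \<in> exponents T k. B 0 \<le> M \<and> B (Suc k) \<le> M'}"
    show "B j \<in> {..C}" if jk: "j \<in> {..Suc k}"
    proof -
      consider "j = 0" | "j = Suc k" | "j \<in> {1..k}" using jk by fastforce
      then show ?thesis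
      proof cases
        case 3
        then have "B j < tq T j * tell T j" using B by (simp add: exponents_def)
        also have "\<dots> \<le> (\<Sum>i\<in>{1..k}. tq T i * tell T i)" by (rule member_le_sum) (use 3 in auto)
        finally show ?thesis by (simp add: C_def)
      qed (use B in \<open>auto simp: C_def\<close>)
    qed
    show "B j = 0" if "j \<notin> {..Suc k}" using that B by (simp add: exponents_def)
  qed
  then show ?thesis by (rule finite_subset) (intro finite_set_of_finite_funs; simp)
qed

lemma independent_0: "independent_at 0"
  unfolding independent_at_def
proof (intro allI impI ballI)
  fix w h B
  assume 0: "(\<Sum>B\<in>low_exps 0 w. emb (h B) * low_mon 0 B) = 0" and B: "B \<in> low_exps 0 w"
  have "C = B" if C: "C \<in> low_exps 0 w" for C
  proof
    fix j
    show "C j = B j"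
      using C B by (cases j; cases "j - 1") (auto simp: low_exps_def exponents_def entries_0(2))
  qed
  then have "low_exps 0 w = {B}" using B by blast
  then have "emb (h B) = 0" using 0 by (simp add: low_mon_def entries_0(3))
  then show "h B = 0" by (simp add: emb_eq_0_iff)
qed

end

context level
begin

lemma finite_low_exps: "finite (low_exps k w)"
proof -
  have "low_exps k w \<subseteq> {B \<in> exponents T k. B 0 \<le> w \<and> B (Suc k) \<le> 0}"
  proof
    fix B assume B: "B \<in> low_exps k w"
    have "B 0 \<le> B 0 * Vn k 0" using e_pos by (simp add: entry_first)
    also have "\<dots> \<le> (\<Sum>j\<le>k. B j * Vn k j)" by (rule member_le_sum) auto
    finally show "B \<in> {B \<in> exponents T k. B 0 \<le> w \<and> B (Suc k) \<le> 0}" using B by (simp add: low_exps_def)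
  qed
  then show ?thesis by (rule finite_subset) (rule finite_exponents_bounded)
qed

lemma low_sum_in_K:
  assumes "entries k"
  shows "(\<Sum>B\<in>S. emb (h B) * low_mon k B) \<in> tK T k"
proof -
  have "Ln k j \<in> tK T k" if "j \<le> k" for j
    using assms that ulead_in_K unfolding entries_def by blast
  then show ?thesis unfolding low_mon_def
    using K emb_in_K by (auto intro!: subfld_sum subfld_mult subfld_prod subfld_power)
qed

end

context level_step
begin

text \<open>Grouping by the exponent i < q l of the newest polynomial gives a sum of Y_i lam^i z^(t
  j + s i) over points of one line, with Y_i in K_k. By \<open>line_sum_eq_0\<close> each Y_i
  vanishes, and this is a relation at the previous level.\<close>

lemma independent_next:
  assumes ent: "entries k" and ind: "independent_at k"
  shows "independent_at (Suc k)"
  unfolding independent_at_def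
proof (intro allI impI ballI)
  fix w h B
  assume 0: "(\<Sum>B\<in>low_exps (Suc k) w. emb (h B) * low_mon (Suc k) B) = 0" and B: "B \<in> low_exps (Suc k) w"
  define I where "I = {i. i < q * l \<and> (\<exists>w'. q * w' + i * (q * V + m) = w)}"
  define w' where "w' i = (w - i * (q * V + m)) div q" for i
  have fin: "finite I" by (simp add: I_def)
  have w': "q * w' i + i * (q * V + m) = w" if iI: "i \<in> I" for i
  proof -
    obtain w0 where w0: "q * w0 + i * (q * V + m) = w" using iI by (auto simp: I_def)
    then have "w - i * (q * V + m) = q * w0" by simp
    then show ?thesis using w0 q_pos by (simp add: w'_def)
  qed
  note rec = entries_next[OF ent]
  have drop: "C(Suc k := 0) \<in> exponents T k" if C: "C \<in> low_exps (Suc k) w" for C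
  proof -
    have "C j = 0" if "Suc k < j" for j
      using that C by (cases "j = Suc (Suc k)") (auto simp: low_exps_def exponents_def)
    then show ?thesis using C by (auto simp: low_exps_def exponents_def)
  qed
  have weight: "(\<Sum>j\<le>Suc k. C j * Vn (Suc k) j) = q * (\<Sum>j\<le>k. C j * Vn k j) + C (Suc k) * (q * V + m)" for C
    using rec(2,3) by (simp add: sum_distrib_left mult_ac)
  have mon: "low_mon (Suc k) C = low_mon k C * z ^ (t * (\<Sum>j\<le>k. C j * Vn k j)) * (lam * z ^ (t * V + s)) ^ C (Suc k)" for C
  proof -
    have "(\<Prod>j\<le>k. Ln (Suc k) j ^ C j) = (\<Prod>j\<le>k. Ln k j ^ C j * z ^ (t * (C j * Vn k j)))"
      using rec(2) by (intro prod.cong) (auto simp: power_mult_distrib power_mult[symmetric] mult_ac)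
    also have "\<dots> = low_mon k C * z ^ (t * (\<Sum>j\<le>k. C j * Vn k j))"
      by (simp add: prod.distrib low_mon_def power_sum sum_distrib_left)
    finally show ?thesis using rec(4) by (simp add: low_mon_def)
  qed
  define Y where "Y i = (\<Sum>C\<in>low_exps k (w' i). emb (h (C(Suc k := i))) * low_mon k C)" for i
  \<comment> \<open>The x-exponent that belongs to y^i on the line q j + m i = w.\<close>
  define j where "j i = w' i + i * V" for i
  have upd: "low_mon k (C(Suc k := i)) = low_mon k C" "(\<Sum>j\<le>k. (C(Suc k := i)) j * Vn k j) = (\<Sum>j\<le>k. C j * Vn k j)" for C i
    by (auto simp: low_mon_def intro!: prod.cong sum.cong)
  have "(\<Sum>B\<in>low_exps (Suc k) w. emb (h B) * low_mon (Suc k) B)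
    = (\<Sum>(i, C)\<in>Sigma I (\<lambda>i. low_exps k (w' i)). emb (h (C(Suc k := i))) * low_mon k C * (lam ^ i * z ^ (t * j i + s * i)))"
  proof (rule sum.reindex_bij_witness[of _ "\<lambda>(i, C). C(Suc k := i)" "\<lambda>B. (B (Suc k), B(Suc k := 0))"])
    fix C assume C: "C \<in> low_exps (Suc k) w"
    show "(\<lambda>(i, C). C(Suc k := i)) (C (Suc k), C(Suc k := 0)) = C" by auto
    have wC: "q * (\<Sum>j\<le>k. C j * Vn k j) + C (Suc k) * (q * V + m) = w"
      using C weight[of C] by (simp add: low_exps_def)
    have i: "C (Suc k) \<in> I" using C wC by (auto simp: I_def low_exps_def exponents_def tell_def)
    have "q * (\<Sum>j\<le>k. C j * Vn k j) = q * w' (C (Suc k))" using w'[OF i] wC by linarith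
    then have wk: "(\<Sum>j\<le>k. C j * Vn k j) = w' (C (Suc k))" using q_pos by simp
    have "C(Suc k := 0) \<in> low_exps k (w' (C (Suc k)))"
      using drop[OF C] wk upd(2)[of C 0] by (simp add: low_exps_def)
    then show "(C (Suc k), C(Suc k := 0)) \<in> Sigma I (\<lambda>i. low_exps k (w' i))" using i by blast
    have "low_mon (Suc k) C = low_mon k C * (lam ^ C (Suc k) * z ^ (t * j (C (Suc k)) + s * C (Suc k)))"
      unfolding mon wk j_def
      by (simp add: power_mult_distrib power_add algebra_simps flip: power_mult)
    then show "(case (C (Suc k), C(Suc k := 0)) of (i, C) \<Rightarrow> emb (h (C(Suc k := i))) * low_mon k C * (lam ^ i * z ^ (t * j i + s * i)))
      = emb (h C) * low_mon (Suc k) C"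
      using upd(1)[of C 0] by simp
  next
    fix p assume p: "p \<in> Sigma I (\<lambda>i. low_exps k (w' i))"
    obtain i C where iC: "p = (i, C)" "i \<in> I" "C \<in> low_exps k (w' i)" using p by auto
    have "C(Suc k := 0) = C" using iC(3) by (auto simp: low_exps_def)
    then show "((\<lambda>(i, C). C(Suc k := i)) p (Suc k), ((\<lambda>(i, C). C(Suc k := i)) p)(Suc k := 0)) = p" using iC(1) by simp
    have "(\<Sum>j\<le>Suc k. (C(Suc k := i)) j * Vn (Suc k) j) = w"
      unfolding weight using upd(2)[of C i] w'[OF iC(2)] iC(3) by (simp add: low_exps_def)
    moreover have "C(Suc k := i) \<in> exponents T (Suc k)"
      using iC(2,3) by (auto simp: low_exps_def exponents_def I_def tell_def le_Suc_eq)
    moreover have "C (Suc (Suc k)) = 0" using iC(3) by (simp add: low_exps_def exponents_def)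
    ultimately show "(\<lambda>(i, C). C(Suc k := i)) p \<in> low_exps (Suc k) w" using iC(1) by (simp add: low_exps_def)
  qed
  also have "\<dots> = (\<Sum>i\<in>I. \<Sum>C\<in>low_exps k (w' i). emb (h (C(Suc k := i))) * low_mon k C * (lam ^ i * z ^ (t * j i + s * i)))"
    by (rule sum.Sigma[symmetric]) (use fin finite_low_exps in auto)
  also have "\<dots> = (\<Sum>i\<in>I. (Y i * lam ^ i) * z ^ (t * j i + s * i))"
    by (rule sum.cong) (simp_all add: Y_def sum_distrib_right mult.assoc)
  finally have Y0: "(\<Sum>i\<in>I. (Y i * lam ^ i) * z ^ (t * j i + s * i)) = 0" using 0 by simp
  have Yi: "Y i = 0" if "i \<in> I" for i
  proof -
    have "Y i * lam ^ i = 0"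
    proof (rule line_sum_eq_0[OF z_nz cop q_pos qs fin _ _ _ Y0 that])
      show "Y i * lam ^ i \<in> tK T k" for i
        using low_sum_in_K[OF ent] lam_in_K K unfolding Y_def by (intro subfld_mult subfld_power) auto
      show "q * j i + m * i = w" if "i \<in> I" for i using w'[OF that] by (simp add: j_def algebra_simps)
    qed (simp add: I_def)
    then show ?thesis using lam by simp
  qed
  have wB: "q * (\<Sum>j\<le>k. B j * Vn k j) + B (Suc k) * (q * V + m) = w"
    using B weight[of B] by (simp add: low_exps_def)
  have i: "B (Suc k) \<in> I" using B wB by (auto simp: I_def low_exps_def exponents_def tell_def)
  have "q * (\<Sum>j\<le>k. B j * Vn k j) = q * w' (B (Suc k))" using w'[OF i] wB by linarith
  then have "(\<Sum>j\<le>k. B j * Vn k j) = w' (B (Suc k))" using q_pos by simp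
  then have B': "B(Suc k := 0) \<in> low_exps k (w' (B (Suc k)))"
    using drop[OF B] upd(2)[of B 0] by (simp add: low_exps_def)
  define h' where "h' C = h (C(Suc k := B (Suc k)))" for C
  have "(\<Sum>C\<in>low_exps k (w' (B (Suc k))). emb (h' C) * low_mon k C) = 0"
    using Yi[OF i] by (simp add: Y_def h'_def)
  then have "h' (B(Suc k := 0)) = 0"
    using ind B' unfolding independent_at_def by blast
  then show "h B = 0" by (simp add: h'_def)
qed

end

context approximant_tower
begin

lemma entries_independent: "k \<le> g \<Longrightarrow> entries k \<and> independent_at k"
proof (induction k)
  case 0
  then show ?case using entries_0(1) independent_0 by blast
next
  case (Suc k)
  then obtain V lam mu e v U where "level emb F g T k V lam mu e v U" using level_ex[of k] by auto
  then interpret level emb F g T k V lam mu e v U .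
  interpret level_step emb F g T k V lam mu e v U by standard (rule Suc.prems)
  show ?case using entries_next(1) independent_next Suc by auto
qed

end

section \<open>Expansions in the approximate roots\<close>

context approximant_tower
begin

definition psi_mon :: "nat \<Rightarrow> (nat \<Rightarrow> nat) \<Rightarrow> 'a fps poly" where
  "psi_mon k b = (\<Prod>j\<in>{1..Suc k}. Psi F T j ^ b j)"

definition base :: "((nat \<Rightarrow> nat) \<Rightarrow> 'a) \<Rightarrow> (nat \<Rightarrow> nat) set" where
  "base f = {b. b 0 = 0 \<and> (\<exists>n. f (b(0 := n)) \<noteq> 0)}"

text \<open>The notion of \<open>adic_expansion\<close> for an arbitrary polynomial, so that
  uniqueness reduces to expansions of 0.\<close>

definition expansion :: "nat \<Rightarrow> ((nat \<Rightarrow> nat) \<Rightarrow> 'a) \<Rightarrow> 'a fps poly \<Rightarrow> bool" where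
  "expansion k f G \<longleftrightarrow> (\<forall>b. b \<notin> exponents T k \<longrightarrow> f b = 0) \<and> finite (base f)
    \<and> G = (\<Sum>b\<in>base f. smult (Abs_fps (\<lambda>n. f (b(0 := n)))) (psi_mon k b))"

lemma adic_expansion_iff: "adic_expansion F T k f \<longleftrightarrow> expansion k f F"
  by (simp add: adic_expansion_def expansion_def base_def psi_mon_def Let_def)

lemma expansion_superset:
  assumes "expansion k f G" "base f \<subseteq> S" "finite S" "\<And>b. b \<in> S \<Longrightarrow> b 0 = 0"
  shows "G = (\<Sum>b\<in>S. smult (Abs_fps (\<lambda>n. f (b(0 := n)))) (psi_mon k b))"
proof -
  have "Abs_fps (\<lambda>n. f (b(0 := n))) = 0" if "b \<in> S - base f" for b
    using that assms(4)[of b] by (intro fps_ext) (auto simp: base_def)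
  then have "(\<Sum>b\<in>base f. smult (Abs_fps (\<lambda>n. f (b(0 := n)))) (psi_mon k b))
      = (\<Sum>b\<in>S. smult (Abs_fps (\<lambda>n. f (b(0 := n)))) (psi_mon k b))"
    by (intro sum.mono_neutral_left assms) auto
  then show ?thesis using assms(1) by (simp add: expansion_def)
qed

lemma expansion_diff:
  assumes "expansion k f G" "expansion k f' G'"
  shows "expansion k (\<lambda>b. f b - f' b) (G - G')"
proof -
  let ?h = "\<lambda>b. f b - f' b"
  define S where "S = base f \<union> base f'"
  have S: "finite S" "\<And>b. b \<in> S \<Longrightarrow> b 0 = 0" using assms by (auto simp: S_def expansion_def base_def)
  have sub: "base ?h \<subseteq> S" by (auto simp: S_def base_def)
  have "G - G' = (\<Sum>b\<in>S. smult (Abs_fps (\<lambda>n. f (b(0 := n)))) (psi_mon k b))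
      - (\<Sum>b\<in>S. smult (Abs_fps (\<lambda>n. f' (b(0 := n)))) (psi_mon k b))"
    by (intro arg_cong2[where f = minus] expansion_superset[OF assms(1)] expansion_superset[OF assms(2)])
      (use S in \<open>auto simp: S_def\<close>)
  also have "\<dots> = (\<Sum>b\<in>S. smult (Abs_fps (\<lambda>n. ?h (b(0 := n)))) (psi_mon k b))"
    unfolding sum_subtractf[symmetric] smult_diff_left[symmetric]
    by (intro sum.cong refl arg_cong2[where f = smult] fps_ext) simp
  also have "\<dots> = (\<Sum>b\<in>base ?h. smult (Abs_fps (\<lambda>n. ?h (b(0 := n)))) (psi_mon k b))"
  proof (rule sum.mono_neutral_right[OF S(1) sub], rule ballI)
    fix b assume b: "b \<in> S - base ?h"
    then have "Abs_fps (\<lambda>n. ?h (b(0 := n))) = 0" using S(2)[of b] by (intro fps_ext) (auto simp: base_def)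
    then show "smult (Abs_fps (\<lambda>n. ?h (b(0 := n)))) (psi_mon k b) = 0" by simp
  qed
  finally show ?thesis using assms finite_subset[OF sub S(1)] by (simp add: expansion_def)
qed

lemma expansion_term:
  assumes b: "b \<in> exponents T k" "b 0 = 0" and a: "a \<noteq> 0"
  shows "expansion k (\<lambda>B. if B(0 := 0) = b then a $ B 0 else 0) (smult a (psi_mon k b))"
proof -
  define f where "f B = (if B(0 := 0) = b then a $ B 0 else 0)" for B
  have triv: "B(0 := 0) = B" if "B 0 = 0" for B :: "nat \<Rightarrow> nat" using that by (metis fun_upd_triv)
  obtain n where n: "a $ n \<noteq> 0" using a by (auto simp: fps_eq_iff)
  have f: "f (b(0 := n)) = a $ n" for n using triv[of b] b(2) by (simp add: f_def)
  have "f (b(0 := n)) \<noteq> 0" using n by (simp add: f)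
  then have "b \<in> base f" using b(2) by (auto simp: base_def)
  moreover have "c = b" if "c \<in> base f" for c
    using that triv[of c] by (auto simp: base_def f_def split: if_splits)
  ultimately have base: "base f = {b}" by blast
  have "f B = 0" if "B \<notin> exponents T k" for B
  proof -
    have "B(0 := 0) \<notin> exponents T k" using that by (auto simp: exponents_def)
    then show ?thesis using b by (auto simp: f_def)
  qed
  moreover have "Abs_fps (\<lambda>n. f (b(0 := n))) = a" by (intro fps_ext) (simp add: f)
  ultimately have "expansion k f (smult a (psi_mon k b))"
    unfolding expansion_def base by simp
  then show ?thesis unfolding f_def[abs_def] .
qed

definition rep :: "nat \<Rightarrow> nat \<Rightarrow> 'a fps poly \<Rightarrow> bool" where
  "rep k n G \<longleftrightarrow> (\<exists>f. expansion k f G \<and> (\<forall>B. n \<le> B (Suc k) \<longrightarrow> f B = 0))"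

lemma rep_0: "rep k n 0"
  unfolding rep_def by (intro exI[of _ "\<lambda>_. 0"]) (simp add: expansion_def base_def)

lemma rep_diff:
  assumes "rep k n G" "rep k n G'"
  shows "rep k n (G - G')"
proof -
  obtain f f' where "expansion k f G" "\<forall>B. n \<le> B (Suc k) \<longrightarrow> f B = 0"
    "expansion k f' G'" "\<forall>B. n \<le> B (Suc k) \<longrightarrow> f' B = 0"
    using assms unfolding rep_def by (elim exE conjE)
  then show ?thesis unfolding rep_def
    by (intro exI[of _ "\<lambda>b. f b - f' b"] conjI expansion_diff) simp_all
qed

lemma rep_sum: "(\<And>x. x \<in> A \<Longrightarrow> rep k n (f x)) \<Longrightarrow> rep k n (sum f A)"
proof (induction A rule: infinite_finite_induct)
  case (insert x A)
  then have "rep k n (f x - (0 - sum f A))" by (intro rep_diff rep_0) auto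
  then show ?case using insert by simp
qed (simp_all add: rep_0)

lemma rep_term:
  assumes "b \<in> exponents T k" "b 0 = 0" "b (Suc k) < n"
  shows "rep k n (smult a (psi_mon k b))"
proof (cases "a = 0")
  case False
  have "(if B(0 := 0) = b then a $ B 0 else 0) = 0" if "n \<le> B (Suc k)" for B
    using that assms(3) by auto
  then show ?thesis unfolding rep_def using expansion_term[OF assms(1,2) False] by blast
qed (simp add: rep_0)

text \<open>Expand in \<open>psi\<close>, then expand each coefficient at the level below. Its
  degree is less than q l times the previous d, which gives exactly the bound q l required in
  \<open>exponents\<close>.\<close>

lemma rep_ex: "k \<le> g \<Longrightarrow> G = 0 \<or> degree G < n * dg k \<Longrightarrow> rep k n G"
proof (induction k arbitrary: n G)
  case 0
  then obtain V lam mu e v U where "level emb F g T 0 V lam mu e v U" using level_ex[of 0] by auto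
  then interpret level emb F g T 0 V lam mu e v U .
  have c: "G = 0 \<or> degree G < n * degree psi" using 0 psi_monic by simp
  have "degree psi > 0" using psi_monic D_pos by simp
  obtain a where a: "\<And>i. degree (a i) < degree psi" "G = (\<Sum>i<n. a i * psi ^ i)"
    using monic_expansion[OF psi_monic(1) \<open>degree psi > 0\<close> c] by blast
  show ?case unfolding a(2)
  proof (rule rep_sum)
    fix i assume i: "i \<in> {..<n}"
    have "degree (a i) = 0" using a(1)[of i] psi_monic(2) by (simp add: dg_0)
    then obtain c where "a i = [:c:]" by (auto elim: degree_eq_zeroE)
    moreover have "rep 0 n (smult c (psi_mon 0 ((\<lambda>_. 0)(1 := i))))"
      by (rule rep_term) (use i in \<open>auto simp: exponents_def\<close>)
    ultimately show "rep 0 n (a i * psi ^ i)" using Psi_last by (simp add: psi_mon_def)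
  qed
next
  case (Suc k)
  then obtain V lam mu e v U where "level emb F g T (Suc k) V lam mu e v U" using level_ex[of "Suc k"] by auto
  then interpret level emb F g T "Suc k" V lam mu e v U .
  have c: "G = 0 \<or> degree G < n * degree psi" using Suc.prems psi_monic by simp
  have "degree psi > 0" using psi_monic D_pos by simp
  obtain a where a: "\<And>i. degree (a i) < degree psi" "G = (\<Sum>i<n. a i * psi ^ i)"
    using monic_expansion[OF psi_monic(1) \<open>degree psi > 0\<close> c] by blast
  show ?case unfolding a(2)
  proof (rule rep_sum)
    fix i assume i: "i \<in> {..<n}"
    have "degree (a i) < (tq T (Suc k) * tell T (Suc k)) * dg k"
      using a(1)[of i] psi_monic(2) by (simp add: dg_Suc mult.commute)
    then have "rep k (tq T (Suc k) * tell T (Suc k)) (a i)" using Suc.IH Suc.prems(1) by simp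
    then obtain f where f: "expansion k f (a i)" "\<And>B. tq T (Suc k) * tell T (Suc k) \<le> B (Suc k) \<Longrightarrow> f B = 0"
      by (auto simp: rep_def)
    define S where "S = base f"
    define c where "c b = Abs_fps (\<lambda>n. f (b(0 := n)))" for b
    have ai: "a i = (\<Sum>b\<in>S. smult (c b) (psi_mon k b))" using f(1) by (simp add: expansion_def S_def c_def)
    have "a i * psi ^ i = (\<Sum>b\<in>S. smult (c b) (psi_mon (Suc k) (b(Suc (Suc k) := i))))"
      unfolding ai sum_distrib_right
    proof (rule sum.cong)
      fix b assume "b \<in> S"
      have "psi_mon (Suc k) (b(Suc (Suc k) := i)) = psi_mon k b * psi ^ i"
        unfolding psi_mon_def by (simp add: prod.nat_ivl_Suc' Psi_last mult.commute)
      then show "smult (c b) (psi_mon k b) * psi ^ i = smult (c b) (psi_mon (Suc k) (b(Suc (Suc k) := i)))" by simp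
    qed simp
    moreover have "rep (Suc k) n (smult (c b) (psi_mon (Suc k) (b(Suc (Suc k) := i))))" if bS: "b \<in> S" for b
    proof (rule rep_term)
      obtain n where "b 0 = 0" "f (b(0 := n)) \<noteq> 0" using bS by (auto simp: S_def base_def)
      then have b: "b(0 := n) \<in> exponents T k" "b 0 = 0" "b (Suc k) < tq T (Suc k) * tell T (Suc k)"
        using f(1) f(2)[of "b(0 := n)"] by (auto simp: expansion_def not_le[symmetric])
      then have "b \<in> exponents T k" by (simp add: exponents_def)
      then show "b(Suc (Suc k) := i) \<in> exponents T (Suc k)" using b(3) by (auto simp: exponents_def le_Suc_eq)
    qed (use bS i in \<open>auto simp: S_def base_def\<close>)
    ultimately show "rep (Suc k) n (a i * psi ^ i)" by (simp add: rep_sum)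
  qed
qed

definition lam_mon :: "nat \<Rightarrow> (nat \<Rightarrow> nat) \<Rightarrow> 'b" where
  "lam_mon k B = (\<Prod>j\<le>Suc k. Ln k j ^ B j)"

end

section \<open>Leading forms of expansions, and uniqueness of the coefficients\<close>

context level
begin

lemma entries_k: "entries k" and independent_k: "independent_at k"
  using entries_independent[OF k_le] by auto

lemma atMost_split: "{..Suc k} = insert 0 {1..Suc k}" and Icc_split: "{1..Suc k} = insert (Suc k) {1..k}"
  by auto

text \<open>All factors but the last are unit-like and the last has leading form lam y, so the
  leading form is a single monomial.\<close>

lemma lead_psi_mon:
  assumes good: "good q m"
  shows "lead (weighted q m (pb k (psi_mon k b))) (q * (\<Sum>j\<in>{1..Suc k}. b j * Vn k j) + m * b (Suc k))
    (monom (\<Prod>j\<in>{1..Suc k}. Ln k j ^ b j) (b (Suc k)))"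
proof -
  have qm: "q > 0" "m > 0" using good by (simp_all add: good_def)
  define u where "u j = (if j = Suc k then q * V + m else q * Vn k j)" for j
  define p where "p j = (if j = Suc k then [:0, lam:] else [:Ln k j:])" for j
  have "lead (weighted q m (pb k (Psi F T j))) (u j) (p j)" if "j \<in> {1..Suc k}" for j
  proof (cases "j = Suc k")
    case True
    then show ?thesis using lead_psi[OF good] by (simp add: u_def p_def Psi_last)
  next
    case False
    then have "ulead (pb k (Psi F T j)) (Vn k j) (Ln k j)" using entries_k that by (auto simp: entries_def)
    from lead_weighted_ulead[OF qm this] show ?thesis using False by (simp add: u_def p_def)
  qed
  then have "lead (\<Prod>j\<in>{1..Suc k}. weighted q m (pb k (Psi F T j)) ^ b j) (\<Sum>j\<in>{1..Suc k}. b j * u j) (\<Prod>j\<in>{1..Suc k}. p j ^ b j)"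
    by (intro lead_prod lead_power)
  also have "(\<Prod>j\<in>{1..Suc k}. weighted q m (pb k (Psi F T j)) ^ b j) = weighted q m (pb k (psi_mon k b))"
    by (simp only: psi_mon_def pb_simps rhom_simps[OF rhom_weighted[OF qm(1)]])
  also have "(\<Sum>j\<in>{1..Suc k}. b j * u j) = q * (\<Sum>j\<in>{1..Suc k}. b j * Vn k j) + m * b (Suc k)"
  proof -
    have "(\<Sum>j\<in>{1..k}. b j * u j) = (\<Sum>j\<in>{1..k}. q * (b j * Vn k j))"
      by (rule sum.cong) (auto simp: u_def)
    then show ?thesis unfolding Icc_split
      by (simp add: u_def entry_last sum_distrib_left algebra_simps)
  qed
  also have "(\<Prod>j\<in>{1..Suc k}. p j ^ b j) = monom (\<Prod>j\<in>{1..Suc k}. Ln k j ^ b j) (b (Suc k))"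
  proof -
    have "(\<Prod>j\<in>{1..k}. p j ^ b j) = (\<Prod>j\<in>{1..k}. [:Ln k j ^ b j:])"
      by (rule prod.cong) (auto simp: p_def poly_const_pow)
    also have "\<dots> = [:\<Prod>j\<in>{1..k}. Ln k j ^ b j:]"
      using rhom_prod[OF rhom_const_poly, of "\<lambda>j. Ln k j ^ b j" "{1..k}"] by simp
    finally have 1: "(\<Prod>j\<in>{1..k}. p j ^ b j) = [:\<Prod>j\<in>{1..k}. Ln k j ^ b j:]" .
    have "[:0, lam:] = monom lam 1" by (simp add: monom_altdef)
    then have 2: "p (Suc k) ^ b (Suc k) = monom (lam ^ b (Suc k)) (b (Suc k))"
      by (simp add: p_def monom_power)
    show ?thesis unfolding Icc_split using 1 2 by (simp add: entry_last smult_monom mult.commute)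
  qed
  finally show ?thesis .
qed

lemma lam_mon_split: "lam_mon k (b(0 := n)) = mu ^ n * (\<Prod>j\<in>{1..Suc k}. Ln k j ^ b j)"
  unfolding lam_mon_def atMost_split
  by (subst prod.insert) (auto simp: entry_first intro!: arg_cong2[where f = "(*)"] prod.cong)

lemma weight_split: "weight emb T k (b(0 := n)) = n * e + (\<Sum>j\<in>{1..Suc k}. b j * Vn k j)"
  unfolding weight_def atMost_split
  by (subst sum.insert) (auto simp: entry_first intro!: sum.cong)

text \<open>The weight of the leading monomial of the pullback of \<Psi>^B.\<close>

definition tot :: "nat \<Rightarrow> nat \<Rightarrow> (nat \<Rightarrow> nat) \<Rightarrow> nat" where
  "tot q m B = q * weight emb T k B + m * B (Suc k)"

lemma nth_weighted_const:
  assumes "q > 0"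
  shows "weighted q m (pb k [:c:]) $ n =
    (if q * e dvd n then [:emb (c $ (n div (q * e))) * mu ^ (n div (q * e)):] else 0)"
proof (rule poly_eqI)
  fix i
  have nth: "(fps_map emb c oo fst (tpi T k)) $ j = (if e dvd j then mu ^ (j div e) * emb (c $ (j div e)) else 0)" for j
    unfolding fst_tpi using e_pos by (simp add: fps_nth_compose_const_X_power fps_map_def)
  show "coeff (weighted q m (pb k [:c:]) $ n) i =
    coeff (if q * e dvd n then [:emb (c $ (n div (q * e))) * mu ^ (n div (q * e)):] else 0) i"
  proof (cases i)
    case 0
    have "coeff (weighted q m (pb k [:c:]) $ n) 0 = (if q dvd n then (fps_map emb c oo fst (tpi T k)) $ (n div q) else 0)"
      by (simp add: coeff_weighted assms pb_const)
    also have "\<dots> = (if q * e dvd n then emb (c $ (n div (q * e))) * mu ^ (n div (q * e)) else 0)"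
    proof (cases "q dvd n")
      case True
      then obtain n' where "n = q * n'" by blast
      then show ?thesis using assms by (simp add: nth mult.commute)
    next
      case False
      then have "\<not> q * e dvd n" by (meson dvd_mult_left)
      then show ?thesis using False by simp
    qed
    finally show ?thesis using 0 by simp
  next
    case (Suc i')
    then show ?thesis by (simp add: coeff_weighted assms pb_const)
  qed
qed

lemma finite_tot:
  assumes "q > 0" "m > 0"
  shows "finite {B \<in> exponents T k. tot q m B = n}"
proof -
  have "{B \<in> exponents T k. tot q m B = n} \<subseteq> {B \<in> exponents T k. B 0 \<le> n \<and> B (Suc k) \<le> n}"
  proof
    fix B assume B: "B \<in> {B \<in> exponents T k. tot q m B = n}"
    have "B 0 \<le> B 0 * e" using e_pos by simp
    also have "\<dots> \<le> weight emb T k B" using weight_split[of B "B 0"] by simp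
    also have "\<dots> \<le> q * weight emb T k B" using assms by simp
    also have "\<dots> \<le> n" using B by (simp add: tot_def)
    finally have "B 0 \<le> n" .
    moreover have "B (Suc k) \<le> n"
    proof -
      have "B (Suc k) \<le> m * B (Suc k)" using assms by simp
      also have "\<dots> \<le> n" using B by (simp add: tot_def)
      finally show ?thesis .
    qed
    ultimately show "B \<in> {B \<in> exponents T k. B 0 \<le> n \<and> B (Suc k) \<le> n}"
      using B by simp
  qed
  then show ?thesis by (rule finite_subset) (rule finite_exponents_bounded)
qed

text \<open>Each \<Psi>^B has a monomial leading form of weight \<open>tot\<close>, so the expansion
  can be read off termwise at the weight n0. It is infinite only in the power of x; hence terms are
  collected per tuple with zero exponent of x, and the series in x is treated as one factor.\<close>

lemma lead_expansion:
  assumes good: "good q m" and f: "expansion k f G" and n0: "\<And>B. f B \<noteq> 0 \<Longrightarrow> n0 \<le> tot q m B"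
  shows "lead (weighted q m (pb k G)) n0
    (\<Sum>B | f B \<noteq> 0 \<and> tot q m B = n0. monom (emb (f B) * lam_mon k B) (B (Suc k)))"
proof -
  have qm: "q > 0" "m > 0" using good by (simp_all add: good_def)
  define X where "X = {B. f B \<noteq> 0 \<and> tot q m B = n0}"
  have X: "X \<subseteq> {B \<in> exponents T k. tot q m B = n0}" using f by (auto simp: X_def expansion_def)
  then have finX: "finite X" using finite_tot[OF qm] by (rule finite_subset)
  have bf: "finite (base f)" "G = (\<Sum>b\<in>base f. smult (Abs_fps (\<lambda>n. f (b(0 := n)))) (psi_mon k b))"
    using f by (auto simp: expansion_def)
  define \<tau> where "\<tau> B = monom (emb (f B) * lam_mon k B) (B (Suc k))" for B
  have "lead (weighted q m (pb k (smult (Abs_fps (\<lambda>n. f (b(0 := n)))) (psi_mon k b)))) n0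
      (\<Sum>B | B \<in> X \<and> B(0 := 0) = b. \<tau> B)" if b: "b \<in> base f" for b
  proof -
    let ?c = "Abs_fps (\<lambda>n. f (b(0 := n)))"
    define W where "W = q * (\<Sum>j\<in>{1..Suc k}. b j * Vn k j) + m * b (Suc k)"
    define p where "p = monom (\<Prod>j\<in>{1..Suc k}. Ln k j ^ b j) (b (Suc k))"
    have lp: "lead (weighted q m (pb k (psi_mon k b))) W p"
      unfolding W_def p_def by (rule lead_psi_mon[OF good])
    have totb: "tot q m (b(0 := n)) = q * e * n + W" for n
      unfolding tot_def weight_split W_def by (simp add: algebra_simps)
    have tm: "weighted q m (pb k (smult ?c (psi_mon k b))) = weighted q m (pb k [:?c:]) * weighted q m (pb k (psi_mon k b))"
    proof -
      have "smult ?c (psi_mon k b) = [:?c:] * psi_mon k b" by simp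
      then show ?thesis by (simp only: rhom_mult[OF rhom_pb] rhom_mult[OF rhom_weighted[OF qm(1)]])
    qed
    have set: "{B. B \<in> X \<and> B(0 := 0) = b} = {b(0 := n) | n. f (b(0 := n)) \<noteq> 0 \<and> q * e * n + W = n0}"
    proof (intro set_eqI iffI)
      fix B assume "B \<in> {B. B \<in> X \<and> B(0 := 0) = b}"
      then have B: "B \<in> X" "B(0 := 0) = b" by auto
      then have "B = b(0 := B 0)" by auto
      moreover from this have "f (b(0 := B 0)) \<noteq> 0" "q * e * B 0 + W = n0"
        using B(1) totb[of "B 0"] by (auto simp: X_def)
      ultimately show "B \<in> {b(0 := n) | n. f (b(0 := n)) \<noteq> 0 \<and> q * e * n + W = n0}" by blast
    next
      fix B assume "B \<in> {b(0 := n) | n. f (b(0 := n)) \<noteq> 0 \<and> q * e * n + W = n0}"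
      then obtain n where n: "B = b(0 := n)" "f (b(0 := n)) \<noteq> 0" "q * e * n + W = n0" by blast
      moreover have "b 0 = 0" using b by (simp add: base_def)
      then have "b(0 := 0) = b" by auto
      ultimately show "B \<in> {B. B \<in> X \<and> B(0 := 0) = b}" using totb[of n] by (simp add: X_def)
    qed
    show ?thesis
    \<comment> \<open>If n0 < W, the whole product has too high an order. Otherwise the series
      factor contributes its coefficient at weight n0 - W, which can be nonzero only if q e divides
      it.\<close>
    proof (cases "n0 < W")
      case True
      have "lead (weighted q m (pb k [:?c:])) 0 (weighted q m (pb k [:?c:]) $ 0)" by (simp add: lead_def)
      from lead_weaken[OF lead_mult[OF this lp], of n0] True
      have "lead (weighted q m (pb k (smult ?c (psi_mon k b)))) n0 0" unfolding tm by simp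
      moreover have "{B. B \<in> X \<and> B(0 := 0) = b} = {}" unfolding set using True by auto
      ultimately show ?thesis by (simp only: sum.empty)
    next
      case False
      have "weighted q m (pb k [:?c:]) $ j = 0" if j: "j < n0 - W" for j
      proof (cases "q * e dvd j")
        case True
        then obtain n where n: "j = q * e * n" by blast
        then have "f (b(0 := n)) = 0" using n0[of "b(0 := n)"] totb[of n] j by force
        then show ?thesis using n qm(1) e_pos rhom_0[OF rhom_emb] by (simp add: nth_weighted_const)
      qed (simp add: nth_weighted_const qm)
      then have "lead (weighted q m (pb k [:?c:])) (n0 - W) (weighted q m (pb k [:?c:]) $ (n0 - W))"
        by (simp add: lead_def)
      from lead_mult[OF this lp] False
      have l: "lead (weighted q m (pb k (smult ?c (psi_mon k b)))) n0 (weighted q m (pb k [:?c:]) $ (n0 - W) * p)"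
        unfolding tm by simp
      have "weighted q m (pb k [:?c:]) $ (n0 - W) * p = (\<Sum>B | B \<in> X \<and> B(0 := 0) = b. \<tau> B)"
      proof (cases "q * e dvd n0 - W")
        case True
        then obtain n where n: "n0 - W = q * e * n" by blast
        then have n': "q * e * n + W = n0" using False by simp
        have "q * e * i + W = n0 \<longleftrightarrow> i = n" for i
          using n' qm(1) e_pos by (metis add_right_cancel mult_cancel1 mult_is_0 not_gr_zero)
        then have "{B. B \<in> X \<and> B(0 := 0) = b} = (if f (b(0 := n)) \<noteq> 0 then {b(0 := n)} else {})"
          unfolding set by auto
        moreover have "weighted q m (pb k [:?c:]) $ (n0 - W) * p = \<tau> (b(0 := n))"
          unfolding n nth_weighted_const[OF qm(1)] \<tau>_def lam_mon_split p_def using qm(1) e_pos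
          by (simp add: smult_monom mult_ac)
        ultimately show ?thesis using rhom_0[OF rhom_emb] by (simp add: \<tau>_def)
      next
        case F: False
        then have "{B. B \<in> X \<and> B(0 := 0) = b} = {}" unfolding set using False by auto
        then show ?thesis using F by (simp only: nth_weighted_const[OF qm(1)] sum.empty if_False mult_zero_left)
      qed
      then show ?thesis using l by simp
    qed
  qed
  then have "lead (\<Sum>b\<in>base f. weighted q m (pb k (smult (Abs_fps (\<lambda>n. f (b(0 := n)))) (psi_mon k b)))) n0
      (\<Sum>b\<in>base f. \<Sum>B | B \<in> X \<and> B(0 := 0) = b. \<tau> B)"
    by (rule lead_sum)
  also have "(\<Sum>b\<in>base f. \<Sum>B | B \<in> X \<and> B(0 := 0) = b. \<tau> B) = (\<Sum>B\<in>X. \<tau> B)"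
  proof (rule sum.group[OF finX bf(1)])
    show "(\<lambda>B. B(0 := 0)) ` X \<subseteq> base f"
    proof
      fix b assume "b \<in> (\<lambda>B. B(0 := 0)) ` X"
      then obtain B where B: "B \<in> X" "b = B(0 := 0)" by blast
      then have "f (b(0 := B 0)) \<noteq> 0" by (simp add: X_def)
      then show "b \<in> base f" using B(2) unfolding base_def by (auto intro!: exI[of _ "B 0"])
    qed
  qed
  also have "(\<Sum>b\<in>base f. weighted q m (pb k (smult (Abs_fps (\<lambda>n. f (b(0 := n)))) (psi_mon k b)))) = weighted q m (pb k G)"
    by (simp only: bf(2) rhom_sum[OF rhom_pb] rhom_sum[OF rhom_weighted[OF qm(1)]])
  finally show ?thesis by (simp add: X_def \<tau>_def)
qed

lemma finite_exponents_at: "finite (exponents_at emb T k i w)"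
proof -
  have "exponents_at emb T k i w \<subseteq> {B \<in> exponents T k. B 0 \<le> nat w \<and> B (Suc k) \<le> i}"
  proof
    fix B assume B: "B \<in> exponents_at emb T k i w"
    have "B 0 \<le> B 0 * e" using e_pos by simp
    also have "\<dots> \<le> weight emb T k B" using weight_split[of B "B 0"] by simp
    finally show "B \<in> {B \<in> exponents T k. B 0 \<le> nat w \<and> B (Suc k) \<le> i}" using B by (auto simp: exponents_at_def)
  qed
  then show ?thesis by (rule finite_subset) (rule finite_exponents_bounded)
qed

text \<open>With b_k = i fixed, the last factor is the constant lam^i and takes i V off the weight,
  which leads back to \<open>independent_at\<close>.\<close>

lemma independent_exponents_at:
  assumes 0: "(\<Sum>B\<in>exponents_at emb T k i (int w). emb (h B) * lam_mon k B) = 0"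
    and B: "B \<in> exponents_at emb T k i (int w)"
  shows "h B = 0"
proof -
  define w' where "w' = w - i * V"
  have wt: "weight emb T k C = (\<Sum>j\<le>k. C j * Vn k j) + C (Suc k) * V" for C
    by (simp add: weight_def entry_last)
  have lm: "lam_mon k C = low_mon k C * lam ^ C (Suc k)" for C
    by (simp add: lam_mon_def low_mon_def entry_last)
  have ge: "i * V \<le> w" using B wt[of B] by (auto simp: exponents_at_def)
  have upd: "low_mon k (C(Suc k := i)) = low_mon k C" "(\<Sum>j\<le>k. (C(Suc k := i)) j * Vn k j) = (\<Sum>j\<le>k. C j * Vn k j)" for C i
    by (auto simp: low_mon_def intro!: prod.cong sum.cong)
  define h' where "h' C = h (C(Suc k := i))" for C
  have inl: "C(Suc k := 0) \<in> low_exps k w'" if "C \<in> exponents_at emb T k i (int w)" for C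
    using that wt[of C] upd(2)[of C 0] by (auto simp: exponents_at_def low_exps_def exponents_def w'_def)
  have "(\<Sum>B\<in>exponents_at emb T k i (int w). emb (h B) * lam_mon k B)
    = (\<Sum>C\<in>low_exps k w'. emb (h' C) * low_mon k C * lam ^ i)"
  proof (rule sum.reindex_bij_witness[of _ "\<lambda>C. C(Suc k := i)" "\<lambda>C. C(Suc k := 0)"])
    fix C assume C: "C \<in> exponents_at emb T k i (int w)"
    then have i: "C (Suc k) = i" by (simp add: exponents_at_def)
    then show e: "C(Suc k := 0, Suc k := i) = C" by auto
    show "C(Suc k := 0) \<in> low_exps k w'" by (rule inl[OF C])
    show "emb (h' (C(Suc k := 0))) * low_mon k (C(Suc k := 0)) * lam ^ i = emb (h C) * lam_mon k C"
      unfolding h'_def e lm upd(1) i by simp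
  next
    fix C assume C: "C \<in> low_exps k w'"
    then show "C(Suc k := i, Suc k := 0) = C" by (auto simp: low_exps_def)
    show "C(Suc k := i) \<in> exponents_at emb T k i (int w)"
      using C wt[of "C(Suc k := i)"] upd(2)[of C i] ge by (auto simp: exponents_at_def low_exps_def exponents_def w'_def)
  qed
  then have "(\<Sum>C\<in>low_exps k w'. emb (h' C) * low_mon k C) * lam ^ i = 0"
    using 0 by (simp add: sum_distrib_right)
  then have "(\<Sum>C\<in>low_exps k w'. emb (h' C) * low_mon k C) = 0" using lam by simp
  then have "h' (B(Suc k := 0)) = 0"
    using independent_k inl[OF B] unfolding independent_at_def by blast
  moreover have "B(Suc k := i) = B" using B by (auto simp: exponents_at_def)
  ultimately show ?thesis by (simp add: h'_def)
qed

lemma coeff_lead_expansion: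
  assumes "good q m" "\<And>B. B \<notin> exponents T k \<Longrightarrow> f B = 0" "q * w + m * i = n0"
  shows "coeff (\<Sum>B | f B \<noteq> 0 \<and> tot q m B = n0. monom (emb (f B) * lam_mon k B) (B (Suc k))) i
    = (\<Sum>B\<in>exponents_at emb T k i (int w). emb (f B) * lam_mon k B)"
proof -
  have qm: "q > 0" "m > 0" using assms(1) by (simp_all add: good_def)
  define X where "X = {B. f B \<noteq> 0 \<and> tot q m B = n0}"
  have "X \<subseteq> {B \<in> exponents T k. tot q m B = n0}" using assms(2) by (auto simp: X_def)
  then have finX: "finite X" using finite_tot[OF qm] by (rule finite_subset)
  have "coeff (\<Sum>B\<in>X. monom (emb (f B) * lam_mon k B) (B (Suc k))) i
    = (\<Sum>B\<in>X. if B (Suc k) = i then emb (f B) * lam_mon k B else 0)"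
    by (simp add: coeff_sum)
  also have "\<dots> = (\<Sum>B | B \<in> X \<and> B (Suc k) = i. emb (f B) * lam_mon k B)"
    by (rule sum.inter_filter[OF finX, symmetric])
  also have "\<dots> = (\<Sum>B\<in>exponents_at emb T k i (int w). emb (f B) * lam_mon k B)"
  proof (rule sum.mono_neutral_left[OF finite_exponents_at])
    show "{B. B \<in> X \<and> B (Suc k) = i} \<subseteq> exponents_at emb T k i (int w)"
    proof
      fix B assume "B \<in> {B. B \<in> X \<and> B (Suc k) = i}"
      then have B: "f B \<noteq> 0" "B (Suc k) = i" "q * weight emb T k B + m * i = q * w + m * i"
        using assms(3) by (auto simp: X_def tot_def)
      then show "B \<in> exponents_at emb T k i (int w)" using assms(2) qm by (auto simp: exponents_at_def)
    qed
    show "\<forall>B\<in>exponents_at emb T k i (int w) - {B. B \<in> X \<and> B (Suc k) = i}. emb (f B) * lam_mon k B = 0"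
      using assms(3) rhom_0[OF rhom_emb] by (auto simp: exponents_at_def X_def tot_def)
  qed
  finally show ?thesis by (simp add: X_def)
qed

text \<open>The coefficient of the form at the power of y given by the last exponent of B is a sum
  to which independence applies, so it could vanish only if \<open>f B\<close> did.\<close>

lemma lead_expansion_nonzero:
  assumes "good q m" "\<And>B. B \<notin> exponents T k \<Longrightarrow> f B = 0" "f B \<noteq> 0"
  shows "(\<Sum>C | f C \<noteq> 0 \<and> tot q m C = tot q m B. monom (emb (f C) * lam_mon k C) (C (Suc k))) \<noteq> 0"
proof
  assume 0: "(\<Sum>C | f C \<noteq> 0 \<and> tot q m C = tot q m B. monom (emb (f C) * lam_mon k C) (C (Suc k))) = 0"
  have "(\<Sum>C\<in>exponents_at emb T k (B (Suc k)) (int (weight emb T k B)). emb (f C) * lam_mon k C) = 0"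
    using coeff_lead_expansion[OF assms(1), of f "weight emb T k B" "B (Suc k)" "tot q m B"] assms(2) 0 by (simp add: tot_def)
  then have "f B = 0"
    by (rule independent_exponents_at) (use assms(2,3) in \<open>auto simp: exponents_at_def\<close>)
  then show False using assms(3) by simp
qed

text \<open>Otherwise the leading form at the least weight would be nonzero, but the pullback of 0
  is 0.\<close>

lemma expansion_0:
  assumes "expansion k f 0"
  shows "f B = 0"
proof (rule ccontr)
  assume B: "f B \<noteq> 0"
  obtain q m where good: "good q m" using good_ex by blast
  define n0 where "n0 = (LEAST n. \<exists>B. f B \<noteq> 0 \<and> tot q m B = n)"
  have "\<exists>C. f C \<noteq> 0 \<and> tot q m C = n0"
    unfolding n0_def by (rule LeastI[of _ "tot q m B"]) (use B in blast)
  then obtain C where C: "f C \<noteq> 0" "tot q m C = n0" by blast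
  have le: "n0 \<le> tot q m C'" if "f C' \<noteq> 0" for C'
    unfolding n0_def by (rule Least_le) (use that in blast)
  have "lead (weighted q m (pb k 0)) n0 (\<Sum>B | f B \<noteq> 0 \<and> tot q m B = n0. monom (emb (f B) * lam_mon k B) (B (Suc k)))"
    by (rule lead_expansion[OF good assms le])
  then have "(\<Sum>B | f B \<noteq> 0 \<and> tot q m B = n0. monom (emb (f B) * lam_mon k B) (B (Suc k))) = 0"
    using good by (simp add: lead_def good_def rhom_0[OF rhom_pb] rhom_0[OF rhom_weighted])
  moreover have "\<And>B. B \<notin> exponents T k \<Longrightarrow> f B = 0" using assms by (simp add: expansion_def)
  ultimately show False using lead_expansion_nonzero[OF good, of f C] C by simp
qed

lemma expansion_unique:
  assumes "expansion k f G" "expansion k f' G"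
  shows "f = f'"
proof
  fix B
  have "expansion k (\<lambda>b. f b - f' b) 0" using expansion_diff[OF assms] by simp
  from expansion_0[OF this, of B] show "f B = f' B" by simp
qed

abbreviation cf :: "(nat \<Rightarrow> nat) \<Rightarrow> 'a" where "cf \<equiv> adic_coeff F T k"

text \<open>F - psi^N has degree below N D, so it needs only tuples with b_k < N. Adding psi^N
  contributes the single tuple \<open>B0\<close>.\<close>

lemma cf: "expansion k cf F" "N \<le> B (Suc k) \<Longrightarrow> cf B = (if B = B0 T k then 1 else 0)"
proof -
  have "F - psi ^ N = 0 \<or> degree (F - psi ^ N) < N * D" by (rule F_minus_power[OF psi_monic])
  then have "rep k N (F - psi ^ N)" by (rule rep_ex[OF k_le])
  then obtain f where f: "expansion k f (F - psi ^ N)" "\<And>b. N \<le> b (Suc k) \<Longrightarrow> f b = 0"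
    by (auto simp: rep_def)
  let ?B = "B0 T k"
  have B0: "?B 0 = 0" "?B (Suc k) = N" by (simp_all add: B0_def)
  have pm: "psi_mon k ?B = psi ^ N"
  proof -
    have "(\<Prod>j\<in>{1..k}. Psi F T j ^ ?B j) = 1" by (rule prod.neutral) (simp add: B0_def)
    then show ?thesis unfolding psi_mon_def Icc_split by (simp add: Psi_last B0_def)
  qed
  have B0_exp: "?B \<in> exponents T k"
  proof -
    have "0 < tq T i * tell T i" if "i \<in> {1..k}" for i
      using D_pos that unfolding dg_def by (metis finite_atLeastAtMost gr0I prod_zero)
    then show ?thesis by (auto simp: exponents_def B0_def)
  qed
  define f0 where "f0 B = (if B = ?B then 1 else 0 :: 'a)" for B
  have "(if B(0 := 0) = ?B then 1 $ B 0 else 0) = f0 B" for B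
  proof (cases "B 0 = 0")
    case True
    then have "B(0 := 0) = B" by (metis fun_upd_triv)
    then show ?thesis using True by (simp add: f0_def B0(1))
  qed (use B0 in \<open>auto simp: f0_def\<close>)
  then have e0: "expansion k f0 (psi ^ N)"
    using expansion_term[OF B0_exp B0(1), of 1] pm by simp
  define f1 where "f1 B = f B + f0 B" for B
  have "expansion k (\<lambda>b. 0 - f0 b) (0 - psi ^ N)"
    by (rule expansion_diff[OF _ e0]) (simp add: expansion_def base_def)
  from expansion_diff[OF f(1) this] have e1: "expansion k f1 F" by (simp add: f1_def[abs_def])
  have "cf = f1"
    unfolding adic_coeff_def adic_expansion_iff
  proof (rule the_equality)
    show "expansion k f1 F" by (rule e1)
    show "f' = f1" if "expansion k f' F" for f' by (rule expansion_unique[OF that e1])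
  qed
  then show "expansion k cf F" "N \<le> B (Suc k) \<Longrightarrow> cf B = (if B = B0 T k then 1 else 0)"
    using e1 f(2) by (simp_all add: f1_def f0_def)
qed

lemma cf_exponents: "B \<notin> exponents T k \<Longrightarrow> cf B = 0"
  using cf(1) by (simp add: expansion_def)

lemma vk_F: "the_enat (vk emb T k F) = v"
  using vx_lead[OF lead_swap_pb_F] by (simp add: vk_def)

text \<open>The leading form of the pullback of F is computed twice, from H_k times a unit and from
  the expansion; \<open>lead_unique\<close> identifies the results.\<close>

lemma expansion_edge:
  assumes good: "good q m"
  shows "cf B \<noteq> 0 \<Longrightarrow> q * v + m * N \<le> q * weight emb T k B + m * B (Suc k)"
    and "q * j + m * i = m * N \<Longrightarrow>
      (\<Sum>B\<in>exponents_at emb T k i (int (j + v)). emb (cf B) * lam_mon k B) = lam ^ N * coeff (tH T k) i $ j"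
proof -
  have qm: "q > 0" "m > 0" using good by (simp_all add: good_def)
  let ?u = "coeff U 0 $ 0"
  define n0 where "n0 = (LEAST n. \<exists>B. cf B \<noteq> 0 \<and> tot q m B = n)"
  have c0: "cf (B0 T k) \<noteq> 0" using cf(2)[of "B0 T k"] by (simp add: B0_def)
  have "\<exists>C. cf C \<noteq> 0 \<and> tot q m C = n0"
    unfolding n0_def by (rule LeastI[of _ "tot q m (B0 T k)"]) (use c0 in blast)
  then obtain C where C: "cf C \<noteq> 0" "tot q m C = n0" by blast
  have le: "n0 \<le> tot q m C'" if "cf C' \<noteq> 0" for C'
    unfolding n0_def by (rule Least_le) (use that in blast)
  let ?S = "\<Sum>B | cf B \<noteq> 0 \<and> tot q m B = n0. monom (emb (cf B) * lam_mon k B) (B (Suc k))"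
  have "lead (weighted q m (pb k F)) n0 ?S" by (rule lead_expansion[OF good cf(1) le])
  moreover have "?S \<noteq> 0" using lead_expansion_nonzero[OF good, of cf C, OF cf_exponents C(1)] C(2) by simp
  moreover have "smult ?u (edge_form q m) \<noteq> 0" using edge_form(4)[OF good] U0 by auto
  ultimately have n0: "n0 = q * v + m * N" and S: "?S = smult ?u (edge_form q m)"
    using lead_unique[OF _ lead_pb_F[OF good]] by blast+
  show "cf B \<noteq> 0 \<Longrightarrow> q * v + m * N \<le> q * weight emb T k B + m * B (Suc k)"
    using le[of B] by (simp add: n0 tot_def)
  have main: "(\<Sum>B\<in>exponents_at emb T k i (int (j + v)). emb (cf B) * lam_mon k B) = ?u * coeff (tH T k) i $ j"
    if "q * j + m * i = m * N" for i j
  proof -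
    have "q * (j + v) + m * i = n0" using that n0 by (simp add: algebra_simps)
    from coeff_lead_expansion[OF good, of cf "j + v" i n0, OF cf_exponents this] S edge_form(2)[OF good that]
    show ?thesis by simp
  qed
  have lN: "lam_mon k (B0 T k) = lam ^ N"
  proof -
    have "(\<Prod>j\<le>k. Ln k j ^ B0 T k j) = 1" by (rule prod.neutral) (simp add: B0_def)
    then show ?thesis by (simp add: lam_mon_def entry_last B0_def)
  qed
  \<comment> \<open>At the point (N, 0) only the tuple \<open>B0\<close> contributes, so U(0, 0) =
    lam^N. This is the constant that the exponent B - B_0 divides out.\<close>
  have s: "(\<Sum>B\<in>exponents_at emb T k N (int (0 + v)). emb (cf B) * lam_mon k B) = ?u"
    using main[of 0 N] H_W H_deg by (simp add: weierstrass_def)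
  have t: "(\<Sum>B\<in>exponents_at emb T k N (int (0 + v)). emb (cf B) * lam_mon k B)
      = (\<Sum>B\<in>exponents_at emb T k N (int (0 + v)). if B = B0 T k then lam ^ N else 0)"
    by (rule sum.cong) (use rhom_0[OF rhom_emb] rhom_1[OF rhom_emb] lN in \<open>auto simp: exponents_at_def cf(2)\<close>)
  have "?u = lam ^ N"
    using s[symmetric] U0 unfolding t sum.delta[OF finite_exponents_at] by (auto split: if_splits)
  then show "q * j + m * i = m * N \<Longrightarrow>
      (\<Sum>B\<in>exponents_at emb T k i (int (j + v)). emb (cf B) * lam_mon k B) = lam ^ N * coeff (tH T k) i $ j"
    using main by simp
qed

lemma Lambda_pow_eq: "Lambda_pow emb T k B = lam_mon k B / lam ^ N"
proof -
  have "(\<Prod>j\<le>k. Ln k j powi (int (B j) - int (B0 T k j))) = (\<Prod>j\<le>k. Ln k j ^ B j)"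
    by (rule prod.cong) (auto simp: B0_def)
  moreover have "lam powi (int (B (Suc k)) - int N) = lam ^ B (Suc k) / lam ^ N"
    using lam by (simp add: power_int_diff)
  ultimately show ?thesis by (simp add: Lambda_pow_def lam_mon_def entry_last B0_def)
qed

end

section \<open>Comparison of the boundary polynomials\<close>

context level
begin

abbreviation wts :: "nat \<Rightarrow> nat set" where "wts \<equiv> weights_at emb F T k"

definition S_coeff :: "nat \<Rightarrow> 'b" where
  "S_coeff i = (\<Sum>B\<in>exponents_at emb T k i (w' emb F T k i + int v). emb (cf B) * Lambda_pow emb T k B)"

text \<open>All terms at the points (i, w'_i), before restriction to the polygon. Since no
  \<open>S_coeff\<close> at a finite w'_i vanishes, its Newton polygon is the one defined from the
  w'_i and its boundary is \<open>boundary'\<close>, so the lemmas on supporting lines apply to both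
  sides.\<close>

definition expansion_poly :: "'b fls poly" where
  "expansion_poly = (\<Sum>i | i \<le> N \<and> wts i \<noteq> {}. monom (fls_const (S_coeff i) * fls_X powi (w' emb F T k i)) i)"

lemma w'_eq: "w' emb F T k i = int (LEAST w. w \<in> wts i) - int v"
  by (simp add: w'_def vk_F)

lemma S_coeff_eq:
  "S_coeff i = (\<Sum>B\<in>exponents_at emb T k i (int (LEAST w. w \<in> wts i)). emb (cf B) * lam_mon k B) / lam ^ N"
  by (simp add: S_coeff_def w'_eq Lambda_pow_eq sum_divide_distrib)

lemma S_coeff_nonzero:
  assumes "wts i \<noteq> {}"
  shows "S_coeff i \<noteq> 0"
proof
  assume "S_coeff i = 0"
  then have 0: "(\<Sum>B\<in>exponents_at emb T k i (int (LEAST w. w \<in> wts i)). emb (cf B) * lam_mon k B) = 0"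
    using lam by (simp add: S_coeff_eq)
  have "(LEAST w. w \<in> wts i) \<in> wts i" by (rule LeastI_ex) (use assms in blast)
  then obtain B where B: "B \<in> exponents T k" "B (Suc k) = i" "cf B \<noteq> 0" "weight emb T k B = (LEAST w. w \<in> wts i)"
    unfolding weights_at_def by auto
  have "cf B = 0" by (rule independent_exponents_at[OF 0]) (use B in \<open>simp add: exponents_at_def\<close>)
  then show False using B by simp
qed

lemma fls_const_X_powi_nth: "(fls_const c * fls_X powi n :: 'b fls) $$ j = (if j = n then c else 0)"
  by (simp add: fls_X_intpow_times_conv_shift)

lemma coeff_expansion_poly:
  "coeff expansion_poly i $$ j = (if i \<le> N \<and> wts i \<noteq> {} \<and> j = w' emb F T k i then S_coeff i else 0)"
proof -
  have "coeff expansion_poly i = (if i \<le> N \<and> wts i \<noteq> {} then fls_const (S_coeff i) * fls_X powi (w' emb F T k i) else 0)"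
    by (simp add: expansion_poly_def coeff_sum)
  then show ?thesis by (simp add: fls_const_X_powi_nth)
qed

lemma expansion_poly_neq_0: "coeff expansion_poly i \<noteq> 0 \<longleftrightarrow> i \<le> N \<and> wts i \<noteq> {}"
  using coeff_expansion_poly[of i] S_coeff_nonzero[of i] by (auto simp: fls_eq_iff)

lemma subdegree_expansion_poly:
  assumes "i \<le> N" "wts i \<noteq> {}"
  shows "fls_subdegree (coeff expansion_poly i) = w' emb F T k i"
  by (rule fls_subdegree_eqI) (use assms in \<open>auto simp: coeff_expansion_poly S_coeff_nonzero\<close>)

lemma newton_polygon_expansion_poly: "newton_polygon expansion_poly = newton_polygon' emb F T k"
proof -
  have "newton_points expansion_poly = {(real i, real_of_int (w' emb F T k i)) | i. i \<le> N \<and> wts i \<noteq> {}}"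
    using subdegree_expansion_poly expansion_poly_neq_0 by force
  then show ?thesis by (simp add: newton_polygon_def newton_polygon'_def)
qed

lemma boundary'_eq: "boundary' emb F T k = restrict_terms (newton_polygon expansion_poly) expansion_poly"
proof (intro poly_eqI fls_eqI)
  fix i j
  have "coeff (boundary' emb F T k) i = (if i \<le> N \<and> wts i \<noteq> {} \<and> (real i, real_of_int (w' emb F T k i)) \<in> newton_polygon' emb F T k
      then fls_const (S_coeff i) * fls_X powi (w' emb F T k i) else 0)"
    unfolding boundary'_def vk_F S_coeff_def[symmetric] by (simp add: coeff_sum)
  then show "coeff (boundary' emb F T k) i $$ j = coeff (restrict_terms (newton_polygon expansion_poly) expansion_poly) i $$ j"
    by (auto simp: coeff_restrict_terms coeff_expansion_poly newton_polygon_expansion_poly fls_const_X_powi_nth)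
qed

lemma weights_bound:
  assumes "good q m" "w \<in> wts i"
  shows "q * v + m * N \<le> q * w + m * i"
  using expansion_edge(1)[OF assms(1)] assms(2) by (auto simp: weights_at_def)

lemma above_line_expansion_poly:
  assumes "good q m"
  shows "above_line q m N expansion_poly"
  unfolding above_line_def
proof (intro allI impI)
  fix i j assume "coeff expansion_poly i $$ j \<noteq> 0"
  then have i: "wts i \<noteq> {}" "j = w' emb F T k i" by (auto simp: coeff_expansion_poly split: if_splits)
  have "(LEAST w. w \<in> wts i) \<in> wts i" by (rule LeastI_ex) (use i in blast)
  from weights_bound[OF assms this]
  have "real (q * v + m * N) \<le> real (q * (LEAST w. w \<in> wts i) + m * i)" by (simp only: of_nat_le_iff)
  then show "real m * real N \<le> real q * real_of_int j + real m * real i"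
    by (simp add: i(2) w'_eq algebra_simps)
qed

lemma above_line_H: "good q m \<Longrightarrow> above_line q m N (to_fls (tH T k))"
  by (rule above_line_to_fls) (simp add: good_def)

text \<open>If a point of the line carries a weight of the expansion, this weight is the least of
  its column by \<open>weights_bound\<close>, and \<open>expansion_edge\<close> compares the
  coefficients. If it carries none, the sum in \<open>expansion_edge\<close> is zero, and so is the
  coefficient of H_k.\<close>

lemma restrict_line_eq:
  assumes good: "good q m"
  shows "restrict_terms (support_line q m N) expansion_poly = restrict_terms (support_line q m N) (to_fls (tH T k))"
proof (intro poly_eqI fls_eqI)
  fix i j
  have q: "q > 0" using good by (simp add: good_def)
  have "coeff expansion_poly i $$ j = coeff (to_fls (tH T k)) i $$ j"
    if on: "(real i, real_of_int j) \<in> support_line q m N"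
  proof (cases "i \<le> N")
    case False
    then show ?thesis using H_deg by (simp add: coeff_expansion_poly coeff_eq_0)
  next
    case True
    have "real q * real_of_int j = real m * (real N - real i)" using on by (simp add: support_line_def algebra_simps)
    moreover have "0 \<le> real m * (real N - real i)" using True by simp
    ultimately have "0 \<le> real q * real_of_int j" by simp
    then have "j \<ge> 0" using q by (simp add: zero_le_mult_iff)
    define n where "n = nat j"
    have n: "j = int n" using \<open>j \<ge> 0\<close> by (simp add: n_def)
    have "real (q * n + m * i) = real (m * N)" using on n by (simp add: support_line_def)
    then have eq: "q * n + m * i = m * N" by (simp only: of_nat_eq_iff)
    note M = expansion_edge(2)[OF good eq]
    have rhs: "coeff (to_fls (tH T k)) i $$ j = coeff (tH T k) i $ n" by (simp add: n)
    have iff: "wts i \<noteq> {} \<and> j = w' emb F T k i \<longleftrightarrow> n + v \<in> wts i"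
    proof
      assume a: "wts i \<noteq> {} \<and> j = w' emb F T k i"
      have "(LEAST w. w \<in> wts i) \<in> wts i" by (rule LeastI_ex) (use a in blast)
      moreover have "(LEAST w. w \<in> wts i) = n + v" using a n by (simp add: w'_eq)
      ultimately show "n + v \<in> wts i" by simp
    next
      assume a: "n + v \<in> wts i"
      have "n + v \<le> w" if "w \<in> wts i" for w
      proof -
        have "q * (n + v) \<le> q * w" using weights_bound[OF good that] eq by (simp add: algebra_simps)
        then show ?thesis using q by simp
      qed
      then have "(LEAST w. w \<in> wts i) = n + v" using a by (intro Least_equality)
      then show "wts i \<noteq> {} \<and> j = w' emb F T k i" using a n by (auto simp: w'_eq)
    qed
    show ?thesis
    proof (cases "n + v \<in> wts i")
      case T: True
      then have w: "wts i \<noteq> {}" "j = w' emb F T k i" using iff by auto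
      then have "(LEAST w. w \<in> wts i) = n + v" using n by (simp add: w'_eq)
      then have "S_coeff i = coeff (tH T k) i $ n" using M lam by (simp add: S_coeff_eq)
      then show ?thesis using w True rhs by (simp add: coeff_expansion_poly)
    next
      case Fa: False
      have "cf B = 0" if "B \<in> exponents_at emb T k i (int (n + v))" for B
        using Fa that by (auto simp: weights_at_def exponents_at_def)
      then have "(\<Sum>B\<in>exponents_at emb T k i (int (n + v)). emb (cf B) * lam_mon k B) = 0"
        using rhom_0[OF rhom_emb] by (intro sum.neutral) auto
      then have "coeff (tH T k) i $ n = 0" using M lam by simp
      then show ?thesis using Fa iff rhs by (auto simp: coeff_expansion_poly)
    qed
  qed
  then show "coeff (restrict_terms (support_line q m N) expansion_poly) i $$ j
    = coeff (restrict_terms (support_line q m N) (to_fls (tH T k))) i $$ j"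
    by (auto simp: coeff_restrict_terms)
qed

lemma coeff_on_line:
  assumes "good q m" "q * n + m * i = m * N"
  shows "coeff expansion_poly i $$ int n = coeff (tH T k) i $ n"
proof -
  have "real (q * n + m * i) = real (m * N)" using assms(2) by (simp only:)
  then have "(real i, real_of_int (int n)) \<in> support_line q m N" by (simp add: support_line_def)
  then show ?thesis
    using arg_cong[OF restrict_line_eq[OF assms(1)], of "\<lambda>p. coeff p i $$ int n"]
    by (simp add: coeff_restrict_terms)
qed

lemma coeff_N: "coeff expansion_poly N $$ 0 = 1" "coeff (to_fls (tH T k)) N $$ 0 = 1"
proof -
  obtain q m where "good q m" using good_ex by blast
  from coeff_on_line[OF this, of 0 N] show "coeff expansion_poly N $$ 0 = 1"
    using H_W H_deg by (simp add: weierstrass_def)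
  show "coeff (to_fls (tH T k)) N $$ 0 = 1" using H_W H_deg by (simp add: weierstrass_def)
qed

text \<open>This happens only for N = 1. Then every line of slope -m with m > 0 supports the
  polygon, and together they exclude any term of the expansion in column 0.\<close>

lemma boundary_monom:
  assumes H: "tH T k = monom 1 N"
  shows "boundary (tH T k) = boundary' emb F T k"
proof -
  have N1: "N = 1" using H H_not_monom N_pos by (cases "N = 1") auto
  have good1: "good 1 m" if "m > 0" for m
    using that H by (auto simp: good_def split: if_splits)
  have w0: "wts 0 = {}"
  proof (rule ccontr)
    assume "wts 0 \<noteq> {}"
    then obtain w where w: "w \<in> wts 0" by blast
    \<comment> \<open>The slope w + 1 is steep enough to contradict the presence of the weight
      w.\<close>
    have "1 * v + Suc w * N \<le> 1 * w + Suc w * 0" by (rule weights_bound[OF good1 w]) simp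
    then show False using N1 by simp
  qed
  have "coeff expansion_poly i $$ j = coeff (to_fls (tH T k)) i $$ j" for i j
  proof -
    consider "i = 0" | "i = 1" | "i > 1" by linarith
    then show ?thesis
    proof cases
      case 1
      then show ?thesis using w0 N1 H by (simp add: coeff_expansion_poly)
    next
      case 2
      have "S_coeff 1 \<noteq> 0 \<and> w' emb F T k 1 = 0 \<and> wts 1 \<noteq> {} \<and> S_coeff 1 = 1"
        using coeff_N(1) N1 by (auto simp: coeff_expansion_poly split: if_splits)
      then show ?thesis using 2 N1 H by (auto simp: coeff_expansion_poly)
    next
      case 3
      then show ?thesis using N1 H by (simp add: coeff_expansion_poly)
    qed
  qed
  then have "expansion_poly = to_fls (tH T k)" by (intro poly_eqI fls_eqI)
  then show ?thesis by (simp add: boundary'_eq boundary_def)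
qed

text \<open>A supporting line through a second term of H_k carries the lowest edge of H_k and, by
  \<open>coeff_on_line\<close>, that of the expansion too. Both sides are then restrictions to this
  line, where the polynomials agree.\<close>

lemma lowest_edge_eq:
  "restrict_terms (lowest_edge N (newton_polygon (boundary (tH T k)))) (boundary (tH T k))
    = restrict_terms (lowest_edge N (newton_polygon (boundary' emb F T k))) (boundary' emb F T k)"
proof (cases "tH T k = monom 1 N")
  case True
  show ?thesis by (simp only: boundary_monom[OF True])
next
  case False
  then obtain q m i n where w: "q > 0" "m > 0" "\<And>i j. coeff (tH T k) i $ j \<noteq> 0 \<Longrightarrow> m * N \<le> q * j + m * i"
    "i < N" "coeff (tH T k) i $ n \<noteq> 0" "q * n + m * i = m * N"
    using exists_edge_weights[OF H_W] unfolding H_deg by blast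
  then have good: "good q m" by (simp add: good_def)
  have "real (q * n + m * i) = real (m * N)" using w(6) by (simp only:)
  then have on: "(real i, real_of_int (int n)) \<in> support_line q m N" by (simp add: support_line_def)
  have onN: "(real N, real_of_int 0) \<in> support_line q m N" by (simp add: support_line_def)
  \<comment> \<open>Passing to the boundary first changes nothing on the line, since the terms on a
    supporting line lie on the polygon.\<close>
  have *: "restrict_terms (lowest_edge N (newton_polygon (restrict_terms (newton_polygon A) A))) (restrict_terms (newton_polygon A) A)
      = restrict_terms (support_line q m N) A"
    if A: "above_line q m N A" "coeff A i $$ int n \<noteq> 0" "coeff A N $$ 0 \<noteq> 0" "\<And>i. coeff A i \<noteq> 0 \<Longrightarrow> i \<le> N" for A :: "'b fls poly"
  proof -
    have "restrict_terms (lowest_edge N (newton_polygon (restrict_terms (newton_polygon A) A))) (restrict_terms (newton_polygon A) A)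
      = restrict_terms (support_line q m N) (restrict_terms (newton_polygon A) A)"
    proof (rule restrict_terms_lowest_edge[OF _ w(1) _ _ w(4) _ on])
      show "above_line q m N (restrict_terms (newton_polygon A) A)" by (rule above_line_restrict_terms[OF A(1)])
      show "coeff (restrict_terms (newton_polygon A) A) N $$ 0 \<noteq> 0"
        using on_line_in_polygon(2)[OF A(1) w(1) A(3) onN] A(3) by (simp add: coeff_restrict_terms)
      show "coeff (restrict_terms (newton_polygon A) A) i $$ int n \<noteq> 0"
        using on_line_in_polygon(2)[OF A(1) w(1) A(2) on] A(2) by (simp add: coeff_restrict_terms)
      show "i \<le> N" if "coeff (restrict_terms (newton_polygon A) A) i \<noteq> 0" for i
      proof (rule A(4), rule notI)
        assume "coeff A i = 0"
        then have "coeff (restrict_terms (newton_polygon A) A) i = 0"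
          by (intro fls_eqI) (simp add: coeff_restrict_terms)
        then show False using that by simp
      qed
    qed
    also have "\<dots> = restrict_terms (support_line q m N) A" by (rule restrict_terms_line_polygon[OF A(1) w(1)])
    finally show ?thesis .
  qed
  have "restrict_terms (lowest_edge N (newton_polygon (boundary (tH T k)))) (boundary (tH T k))
    = restrict_terms (support_line q m N) (to_fls (tH T k))"
    unfolding boundary_def
  proof (rule *[OF above_line_H[OF good]])
    show "i \<le> N" if "coeff (to_fls (tH T k)) i \<noteq> 0" for i
      using that H_deg by (metis coeff_to_fls fps_zero_to_fls le_degree)
  qed (use w(5) coeff_N in simp_all)
  also have "\<dots> = restrict_terms (support_line q m N) expansion_poly" by (rule restrict_line_eq[OF good, symmetric])
  also have "\<dots> = restrict_terms (lowest_edge N (newton_polygon (boundary' emb F T k))) (boundary' emb F T k)"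
    unfolding boundary'_eq
    by (rule *[OF above_line_expansion_poly[OF good], symmetric])
      (use w(5) coeff_N expansion_poly_neq_0 coeff_on_line[OF good w(6)] in auto)
  finally show ?thesis .
qed

end

context level_step
begin

text \<open>The polygon of H_k is a single edge from (N, 0) to column 0. The expansion has the same
  two end terms, so its polygon lies on the same line, and both boundaries are restrictions to
  it.\<close>

lemma boundary_eq: "boundary (tH T k) = boundary' emb F T k"
proof -
  obtain j where j: "q * j = m * N" "coeff (tH T k) 0 $ j \<noteq> 0" using line(6) by blast
  have "real (q * j) = real (m * N)" using j by (simp only:)
  then have on: "(0, real_of_int (int j)) \<in> support_line q m N" by (simp add: support_line_def)
  have "newton_polygon expansion_poly \<subseteq> support_line q m N"
  proof (rule polygon_on_line[OF above_line_expansion_poly[OF good] q_pos N_pos _ _ _ on])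
    show "coeff expansion_poly 0 $$ int j \<noteq> 0" using coeff_on_line[OF good, of j 0] j by simp
  qed (use coeff_N expansion_poly_neq_0 in auto)
  then have "boundary' emb F T k = restrict_terms (support_line q m N) expansion_poly"
    unfolding boundary'_eq using q_pos by (rule restrict_terms_straight)
  also have "\<dots> = restrict_terms (support_line q m N) (to_fls (tH T k))" by (rule restrict_line_eq[OF good])
  also have "\<dots> = boundary (tH T k)"
    unfolding boundary_def by (rule restrict_terms_straight[OF line(5) q_pos, symmetric])
  finally show ?thesis by simp
qed

end

theorem theorem4:
  fixes emb :: "'a::field \<Rightarrow> 'b::field"
    and F :: "'a fps poly"
    and T :: "'b tower"
    and g :: nat
  assumes "perfect_field TYPE('a)"
    and "weierstrass F"
    and "degree F > 0"
    and "squarefree F"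
    and "CHAR('a) = 0 \<or> CHAR('a) > degree F"
    and "field_embedding emb"
    and "tower_of emb F g T"
  shows "(\<forall>k<g. boundary (tH T k) = boundary' emb F T k)
    \<and> restrict_terms (lowest_edge (tN T g) (newton_polygon (boundary (tH T g)))) (boundary (tH T g))
      = restrict_terms (lowest_edge (tN T g) (newton_polygon (boundary' emb F T g))) (boundary' emb F T g)"
proof (intro conjI allI impI)
  interpret approximant_tower emb F g T by standard (use assms in auto)
  show "boundary (tH T k) = boundary' emb F T k" if kg: "k < g" for k
  proof -
    obtain V lam mu e v U where "level emb F g T k V lam mu e v U" using level_ex[of k] kg by auto
    then interpret level emb F g T k V lam mu e v U .
    interpret level_step emb F g T k V lam mu e v U by standard (use kg in simp)
    show ?thesis by (rule boundary_eq)
  qed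
  obtain V lam mu e v U where "level emb F g T g V lam mu e v U" using level_ex[of g] by auto
  then interpret level emb F g T g V lam mu e v U .
  show "restrict_terms (lowest_edge (tN T g) (newton_polygon (boundary (tH T g)))) (boundary (tH T g))
      = restrict_terms (lowest_edge (tN T g) (newton_polygon (boundary' emb F T g))) (boundary' emb F T g)"
    by (rule lowest_edge_eq)
qed

end
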